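(* Let $G$ be a finite simple connected graph and let $n$ be a positive integer. If $|S(G)|<\binom{n}{4}$, then $\max(\chi(G),h(G))<n$.
   Context: All graphs are finite and simple. $\chi(G)$ is the chromatic number, and the Hadwiger number $h(G)$ is the maximum $t$ such that the complete graph $K^{t}$ is a minor of $G$. Solid graphs are the graphs of the following four kinds. (1) Pyramid: a graph consisting of a cycle $C$ and a vertex $w\notin V(C)$ together with at least three edges between $w$ and $C$. (2) Trihedron: the union of three paths $P_1,P_2,P_3$, each of length at least 2, having the same two (distinct) endpoints, such that no interior vertex of any of the paths is used in another of the paths. (3) Stamp: the union of a triangle $T$ and three paths $P_1,P_2,P_3$ of length $\ge 1$ that start at the three different vertices of $T$ and all end at the same vertex $x\notin V(T)$, such that the $P_i-x$ are pairwise vertex-disjoint and each $P_i$ meets $T$ only in its starting vertex. (4) Prism: $T\cup T'\cup P_1\cup P_2\cup P_3$ where $T,T'$ are vertex-disjoint triangles with vertices $x_1,x_2,x_3$ and $y_1,y_2,y_3$ respectively, and the $P_i$ are pairwise vertex-disjoint paths from $x_i$ to $y_i$ (so $P_i$ meets $T\cup T'$ only in $x_i,y_i$). A solid in $G$ is an induced subgraph of $G$ that is isomorphic to a solid graph; $S(G)$ is the set of all solids in $G$. *)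

theory Defs
  imports "Graph_Theory.Graph_Theory"
begin

text \<open>
  A finite simple graph is a \<^locale>\<open>pair_graph\<close>: its edge \<open>uv\<close> is the pair of arcs
  \<open>(u, v)\<close> and \<open>(v, u)\<close>.
\<close>

section \<open>Chromatic number and Hadwiger number\<close>

definition proper_colouring :: "'a pair_pre_digraph \<Rightarrow> nat \<Rightarrow> ('a \<Rightarrow> nat) \<Rightarrow> bool" where
  "proper_colouring G k f \<longleftrightarrow>
     (\<forall>v \<in> pverts G. f v < k) \<and> (\<forall>(u, v) \<in> parcs G. f u \<noteq> f v)"

definition chromatic_number :: "'a pair_pre_digraph \<Rightarrow> nat" where
  "chromatic_number G = (LEAST k. \<exists>f. proper_colouring G k f)"

text \<open>
  \<open>H\<close> is a minor of \<open>G\<close>, given by branch sets \<open>B x\<close>. Branch sets are nonempty, as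
  \<^const>\<open>Digraph_Component.connected\<close> graphs are.
\<close>

definition minor :: "'b pair_pre_digraph \<Rightarrow> 'a pair_pre_digraph \<Rightarrow> bool" where
  "minor H G \<longleftrightarrow> (\<exists>B :: 'b \<Rightarrow> 'a set.
     (\<forall>x \<in> pverts H. B x \<subseteq> pverts G \<and> Digraph_Component.connected (with_proj G \<restriction> B x)) \<and>
     (\<forall>x \<in> pverts H. \<forall>y \<in> pverts H. x \<noteq> y \<longrightarrow> B x \<inter> B y = {}) \<and>
     (\<forall>(x, y) \<in> parcs H. \<exists>u \<in> B x. \<exists>v \<in> B y. (u, v) \<in> parcs G))"

definition hadwiger_number :: "'a pair_pre_digraph \<Rightarrow> nat" where
  "hadwiger_number G =
     Max {t. \<exists>K :: nat pair_pre_digraph. K\<^bsub>t\<^esub> (with_proj K) \<and> minor K G}"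


section \<open>Solid graphs\<close>

text \<open>Paths are given by the list of their vertices, so a path has \<open>length p - 1\<close> edges.\<close>

definition path_from_to :: "'a \<Rightarrow> 'a list \<Rightarrow> 'a \<Rightarrow> bool" where
  "path_from_to a p b \<longleftrightarrow> p \<noteq> [] \<and> distinct p \<and> hd p = a \<and> last p = b"

definition path_graph :: "'a list \<Rightarrow> 'a pair_pre_digraph" where
  "path_graph p = \<lparr> pverts = set p, parcs = set (zip p (tl p)) \<union> set (zip (tl p) p) \<rparr>"

text \<open>The cycle through the vertices of \<open>c\<close>; meaningful if \<open>distinct c\<close> and \<open>length c \<ge> 3\<close>.\<close>

definition cycle_graph :: "'a list \<Rightarrow> 'a pair_pre_digraph" where
  "cycle_graph c = path_graph (c @ [hd c])"

definition graph_Union :: "'a pair_pre_digraph set \<Rightarrow> 'a pair_pre_digraph" where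
  "graph_Union \<G> = \<lparr> pverts = (\<Union>G \<in> \<G>. pverts G), parcs = (\<Union>G \<in> \<G>. parcs G) \<rparr>"

text \<open>\<open>N\<close> is the set of neighbours of \<open>w\<close> on the cycle.\<close>

definition pyramid :: "'a pair_pre_digraph \<Rightarrow> bool" where
  "pyramid K \<longleftrightarrow> (\<exists>c w N.
     distinct c \<and> 3 \<le> length c \<and> w \<notin> set c \<and> N \<subseteq> set c \<and> 3 \<le> card N \<and>
     K = \<lparr> pverts = insert w (set c),
           parcs = parcs (cycle_graph c) \<union> {w} \<times> N \<union> N \<times> {w} \<rparr>)"

definition trihedron :: "'a pair_pre_digraph \<Rightarrow> bool" where
  "trihedron K \<longleftrightarrow> (\<exists>a b p1 p2 p3.
     a \<noteq> b \<and>
     path_from_to a p1 b \<and> path_from_to a p2 b \<and> path_from_to a p3 b \<and>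
     2 \<le> length p1 - 1 \<and> 2 \<le> length p2 - 1 \<and> 2 \<le> length p3 - 1 \<and>
     set p1 \<inter> set p2 \<subseteq> {a, b} \<and> set p1 \<inter> set p3 \<subseteq> {a, b} \<and> set p2 \<inter> set p3 \<subseteq> {a, b} \<and>
     K = graph_Union {path_graph p1, path_graph p2, path_graph p3})"

definition stamp :: "'a pair_pre_digraph \<Rightarrow> bool" where
  "stamp K \<longleftrightarrow> (\<exists>x1 x2 x3 x p1 p2 p3.
     distinct [x1, x2, x3] \<and> x \<notin> {x1, x2, x3} \<and>
     path_from_to x1 p1 x \<and> path_from_to x2 p2 x \<and> path_from_to x3 p3 x \<and>
     1 \<le> length p1 - 1 \<and> 1 \<le> length p2 - 1 \<and> 1 \<le> length p3 - 1 \<and>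
     (set p1 - {x}) \<inter> (set p2 - {x}) = {} \<and>
     (set p1 - {x}) \<inter> (set p3 - {x}) = {} \<and>
     (set p2 - {x}) \<inter> (set p3 - {x}) = {} \<and>
     set p1 \<inter> {x1, x2, x3} = {x1} \<and>
     set p2 \<inter> {x1, x2, x3} = {x2} \<and>
     set p3 \<inter> {x1, x2, x3} = {x3} \<and>
     K = graph_Union {cycle_graph [x1, x2, x3], path_graph p1, path_graph p2, path_graph p3})"

definition prism :: "'a pair_pre_digraph \<Rightarrow> bool" where
  "prism K \<longleftrightarrow> (\<exists>x1 x2 x3 y1 y2 y3 p1 p2 p3.
     distinct [x1, x2, x3, y1, y2, y3] \<and>
     path_from_to x1 p1 y1 \<and> path_from_to x2 p2 y2 \<and> path_from_to x3 p3 y3 \<and>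
     set p1 \<inter> set p2 = {} \<and> set p1 \<inter> set p3 = {} \<and> set p2 \<inter> set p3 = {} \<and>
     K = graph_Union {cycle_graph [x1, x2, x3], cycle_graph [y1, y2, y3],
                      path_graph p1, path_graph p2, path_graph p3})"

definition solid_graph :: "'a pair_pre_digraph \<Rightarrow> bool" where
  "solid_graph K \<longleftrightarrow> pyramid K \<or> trihedron K \<or> stamp K \<or> prism K"

definition solids :: "'a pair_pre_digraph \<Rightarrow> 'a pair_pre_digraph set" where
  "solids G = {H. induced_subgraph (with_proj H) (with_proj G) \<and>
     (\<exists>K :: 'a pair_pre_digraph. solid_graph K \<and> digraph_iso (with_proj K) (with_proj H))}"

end

theory Submission
  imports Defs
begin

text \<open>
  The key fact is that contracting an edge does not create solids: every solid \<open>S\<close> of a contraction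
  of \<open>G\<close> lifts to a solid \<open>T\<close> of \<open>G\<close> that the contraction maps onto \<open>S\<close>. For this, solids are seen as
  induced cycles together with a minimal connected set that is attached to more than an edge of the
  cycle. If the contracted vertex lies in that set, a minimal such subset of its preimage does the
  job, and each vertex of a solid can be put into this position, apart from the branch vertices of a
  trihedron and the apex of a stamp, which are split by hand.

  If \<open>h(G) \<ge> n\<close>, then each four of the \<open>n\<close> branch sets of a \<open>K\<^sup>n\<close> minor contract to a \<open>K\<^sup>4\<close>, which lifts
  to a solid that meets exactly these branch sets.

  If \<open>\<chi>(G) \<ge> n\<close>, consider a vertex \<open>v\<close> of a moplex. Any three of its neighbours form, with \<open>v\<close>, a
  \<open>K\<^sup>4\<close>, or else there is a connected set of non-neighbours of \<open>v\<close> whose contraction yields a solid on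
  \<open>v\<close>, these three and one more vertex. Hence a vertex of degree \<open>d\<close> of this kind lies in at least
  \<open>d choose 3\<close> solids, and induction over \<open>G - v\<close> gives \<open>n choose 4\<close> solids.
\<close>

section \<open>Induced paths, cycles and solids\<close>

text \<open>Being attached to more than an edge of an induced cycle passes to preimages under the
  contraction of an edge whose ends avoid the cycle; the shape of a solid does not. So shapes matter
  only when a solid is decomposed and when a minimal attached set is turned back into a solid. That
  the lift maps onto the given solid comes from minimality in the contracted graph: the image of the
  lifted set is again connected and attached to more than an edge, so it cannot be smaller. This
  makes the lifts of different 4-sets of branch sets different. The exceptional vertices are forced:
  every cycle of a trihedron passes through both branch vertices, and the only cycle of a stamp that
  avoids its apex is its triangle, beside which the rest need not be a path. Induced subgraphs are
  determined by their vertex sets, so solids are counted as sets. The number 4 is the order of K^4,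
  the pyramid over a triangle. For colourings the count follows Pascal's rule:
  \<open>k choose 3\<close> solids through a vertex of degree at least \<open>k\<close>, and
  \<open>k choose 4\<close> without it.\<close>

locale ugraph =
  fixes E :: "'a \<Rightarrow> 'a \<Rightarrow> bool"
  assumes sym: "E x y \<Longrightarrow> E y x"
    and irrefl: "\<not> E x x"
begin

lemma sym_iff: "E x y \<longleftrightarrow> E y x"
  using sym by blast

end

text \<open>Adjacency is prescribed in list order only; \<open>sym\<close> supplies the other
  direction. The value \<open>hd xs\<close> is consulted only for nonempty
  \<open>xs\<close>.\<close>

primrec ipath :: "('a \<Rightarrow> 'a \<Rightarrow> bool) \<Rightarrow> 'a list \<Rightarrow> bool" where
  "ipath E [] \<longleftrightarrow> True"
| "ipath E (x # xs) \<longleftrightarrow> x \<notin> set xs \<and> (\<forall>y \<in> set xs. E x y \<longleftrightarrow> y = hd xs) \<and> ipath E xs"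

text \<open>One vertex closes up an induced path. With two vertices in \<open>d\<close> this is a
  triangle, so triangles count as induced cycles.\<close>

definition icycle :: "('a \<Rightarrow> 'a \<Rightarrow> bool) \<Rightarrow> 'a list \<Rightarrow> bool" where
  "icycle E c \<longleftrightarrow> (\<exists>z d. c = z # d \<and> z \<notin> set d \<and> ipath E d \<and> 2 \<le> length d \<and>
     (\<forall>y \<in> set d. E z y \<longleftrightarrow> y = hd d \<or> y = last d))"

text \<open>Induced solids of \<open>E\<close>. The three paths of a trihedron are given without their common ends
  \<open>z\<close>, \<open>y\<close>, those of a stamp without their common end \<open>z\<close>.\<close>

definition ipyramid :: "('a \<Rightarrow> 'a \<Rightarrow> bool) \<Rightarrow> 'a list \<Rightarrow> 'a \<Rightarrow> bool" where
  "ipyramid E c w \<longleftrightarrow> icycle E c \<and> w \<notin> set c \<and> 3 \<le> card {x \<in> set c. E w x}"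

definition arms :: "('a \<Rightarrow> 'a \<Rightarrow> bool) \<Rightarrow> 'a list \<Rightarrow> 'a list \<Rightarrow> 'a list \<Rightarrow> bool" where
  "arms E p q r \<longleftrightarrow> ipath E p \<and> ipath E q \<and> ipath E r \<and> p \<noteq> [] \<and> q \<noteq> [] \<and> r \<noteq> [] \<and>
     set p \<inter> set q = {} \<and> set p \<inter> set r = {} \<and> set q \<inter> set r = {}"

definition apex :: "('a \<Rightarrow> 'a \<Rightarrow> bool) \<Rightarrow> 'a \<Rightarrow> 'a list \<Rightarrow> bool" where
  "apex E z p \<longleftrightarrow> z \<notin> set p \<and> (\<forall>x \<in> set p. E z x \<longleftrightarrow> x = hd p)"

definition itrihedron :: "('a \<Rightarrow> 'a \<Rightarrow> bool) \<Rightarrow> 'a \<Rightarrow> 'a \<Rightarrow> 'a list \<Rightarrow> 'a list \<Rightarrow> 'a list \<Rightarrow> bool" where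
  "itrihedron E z y p q r \<longleftrightarrow> arms E p q r \<and> z \<noteq> y \<and> \<not> E z y \<and>
     apex E z p \<and> apex E z q \<and> apex E z r \<and>
     apex E y (rev p) \<and> apex E y (rev q) \<and> apex E y (rev r) \<and>
     (\<forall>x \<in> set p. \<forall>x' \<in> set q. \<not> E x x') \<and>
     (\<forall>x \<in> set p. \<forall>x' \<in> set r. \<not> E x x') \<and>
     (\<forall>x \<in> set q. \<forall>x' \<in> set r. \<not> E x x')"

definition istamp :: "('a \<Rightarrow> 'a \<Rightarrow> bool) \<Rightarrow> 'a \<Rightarrow> 'a list \<Rightarrow> 'a list \<Rightarrow> 'a list \<Rightarrow> bool" where
  "istamp E z p q r \<longleftrightarrow> arms E p q r \<and> apex E z p \<and> apex E z q \<and> apex E z r \<and>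
     (\<forall>x \<in> set p. \<forall>x' \<in> set q. E x x' \<longleftrightarrow> x = last p \<and> x' = last q) \<and>
     (\<forall>x \<in> set p. \<forall>x' \<in> set r. E x x' \<longleftrightarrow> x = last p \<and> x' = last r) \<and>
     (\<forall>x \<in> set q. \<forall>x' \<in> set r. E x x' \<longleftrightarrow> x = last q \<and> x' = last r)"

definition iprism :: "('a \<Rightarrow> 'a \<Rightarrow> bool) \<Rightarrow> 'a list \<Rightarrow> 'a list \<Rightarrow> 'a list \<Rightarrow> bool" where
  "iprism E p q r \<longleftrightarrow> arms E p q r \<and> hd p \<noteq> last p \<and> hd q \<noteq> last q \<and> hd r \<noteq> last r \<and>
     (\<forall>x \<in> set p. \<forall>x' \<in> set q. E x x' \<longleftrightarrow> x = hd p \<and> x' = hd q \<or> x = last p \<and> x' = last q) \<and>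
     (\<forall>x \<in> set p. \<forall>x' \<in> set r. E x x' \<longleftrightarrow> x = hd p \<and> x' = hd r \<or> x = last p \<and> x' = last r) \<and>
     (\<forall>x \<in> set q. \<forall>x' \<in> set r. E x x' \<longleftrightarrow> x = hd q \<and> x' = hd r \<or> x = last q \<and> x' = last r)"

definition solid_set :: "('a \<Rightarrow> 'a \<Rightarrow> bool) \<Rightarrow> 'a set \<Rightarrow> bool" where
  "solid_set E S \<longleftrightarrow>
     (\<exists>c w. ipyramid E c w \<and> S = insert w (set c)) \<or>
     (\<exists>z y p q r. itrihedron E z y p q r \<and> S = {z, y} \<union> set p \<union> set q \<union> set r) \<or>
     (\<exists>z p q r. istamp E z p q r \<and> S = insert z (set p \<union> set q \<union> set r)) \<or>
     (\<exists>p q r. iprism E p q r \<and> S = set p \<union> set q \<union> set r)"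

text \<open>The sets that are at most an edge: what a connected set may see of an induced cycle
  without forcing a solid. Three vertices are never small, not even those of a triangle.\<close>

definition small :: "('a \<Rightarrow> 'a \<Rightarrow> bool) \<Rightarrow> 'a set \<Rightarrow> bool" where
  "small E A \<longleftrightarrow> (\<exists>x y. A \<subseteq> {x, y} \<and> (x = y \<or> E x y))"

definition att :: "('a \<Rightarrow> 'a \<Rightarrow> bool) \<Rightarrow> 'a set \<Rightarrow> 'a set \<Rightarrow> 'a set" where
  "att E C R = {x \<in> C. \<exists>y \<in> R. E x y}"

text \<open>Adding an induced path \<open>r\<close> that is attached to more than an edge of an induced cycle \<open>c\<close>, but
  loses this property if an end of \<open>r\<close> is deleted, always gives a solid.\<close>
definition ear :: "('a \<Rightarrow> 'a \<Rightarrow> bool) \<Rightarrow> 'a list \<Rightarrow> 'a list \<Rightarrow> bool" where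
  "ear E c r \<longleftrightarrow> icycle E c \<and> ipath E r \<and> r \<noteq> [] \<and> set c \<inter> set r = {} \<and>
     \<not> small E (att E (set c) (set r)) \<and>
     small E (att E (set c) (set (tl r))) \<and> small E (att E (set c) (set (butlast r)))"

section \<open>Splitting, reversing and rotating induced paths and cycles\<close>

lemma ipath_distinct: "ipath E p \<Longrightarrow> distinct p"
  by (induction p) auto

lemma ipath_append:
  "ipath E (p @ q) \<longleftrightarrow> ipath E p \<and> ipath E q \<and> set p \<inter> set q = {} \<and>
     (\<forall>x \<in> set p. \<forall>y \<in> set q. E x y \<longleftrightarrow> x = last p \<and> y = hd q)"
proof (induction p)
  case Nil
  then show ?case by simp
next
  case (Cons a p)
  show ?case
  proof (cases "p = []")
    case True
    then show ?thesis by auto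
  next
    case False
    then have "hd p \<in> set p" "last p \<in> set p" by auto
    have "(\<forall>y \<in> set (p @ q). E a y \<longleftrightarrow> y = hd (p @ q)) \<and> a \<notin> set (p @ q) \<and> set p \<inter> set q = {} \<longleftrightarrow>
      (\<forall>y \<in> set p. E a y \<longleftrightarrow> y = hd p) \<and> (\<forall>y \<in> set q. E a y \<longleftrightarrow> a = last p \<and> y = hd q) \<and>
      a \<notin> set p \<and> a \<notin> set q \<and> set p \<inter> set q = {}"
      using False \<open>hd p \<in> set p\<close> \<open>last p \<in> set p\<close> by (auto simp: disjoint_iff)
    moreover have "set (a # p) \<inter> set q = {} \<longleftrightarrow> a \<notin> set q \<and> set p \<inter> set q = {}" by auto
    moreover have "last (a # p) = last p" using False by simp
    ultimately show ?thesis
      unfolding append_Cons ipath.simps Cons list.set(2) ball_simps(7) \<open>last (a # p) = last p\<close> by argo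
  qed
qed

lemma icycle_Cons:
  "icycle E (z # d) \<longleftrightarrow> z \<notin> set d \<and> ipath E d \<and> 2 \<le> length d \<and>
     (\<forall>y \<in> set d. E z y \<longleftrightarrow> y = hd d \<or> y = last d)"
  by (auto simp: icycle_def)

lemma icycle_nonempty: "icycle E c \<Longrightarrow> c \<noteq> []"
  by (auto simp: icycle_def)

lemma hd_neq_last: "distinct p \<Longrightarrow> 2 \<le> length p \<Longrightarrow> hd p \<noteq> last p"
  by (cases p) auto

context ugraph
begin

lemma ipath_rev: "ipath E (rev p) \<longleftrightarrow> ipath E p"
proof (induction p)
  case (Cons a p)
  show ?case
    by (cases "p = []") (auto simp: ipath_append Cons last_rev sym_iff[of a])
qed simp

lemma icycle_append:
  assumes "p \<noteq> []" "q \<noteq> []"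
  shows "icycle E (p @ q) \<longleftrightarrow> ipath E p \<and> ipath E q \<and> set p \<inter> set q = {} \<and> 3 \<le> length (p @ q) \<and>
    (\<forall>x \<in> set p. \<forall>y \<in> set q. E x y \<longleftrightarrow> x = last p \<and> y = hd q \<or> x = hd p \<and> y = last q)"
proof -
  obtain z p' where p: "p = z # p'" using assms by (cases p) auto
  show ?thesis
  proof (cases "p' = []")
    case True
    then show ?thesis using assms p by (auto simp: icycle_Cons)
  next
    case False
    then have "hd p' \<in> set p'" "last p' \<in> set p'" "hd q \<in> set q" "last q \<in> set q" using assms by auto
    then show ?thesis using assms p False 
      by (auto simp: icycle_Cons ipath_append disjoint_iff Suc_le_eq)
  qed
qed

lemma icycle_rotate: "icycle E (p @ q) \<Longrightarrow> icycle E (q @ p)"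
proof (cases "p = [] \<or> q = []")
  case False
  assume "icycle E (p @ q)"
  then have H: "ipath E p" "ipath E q" "set p \<inter> set q = {}" "3 \<le> length (p @ q)"
    "\<forall>x \<in> set p. \<forall>y \<in> set q. E x y \<longleftrightarrow> x = last p \<and> y = hd q \<or> x = hd p \<and> y = last q"
    using False by (auto simp: icycle_append)
  have "E x y \<longleftrightarrow> x = last q \<and> y = hd p \<or> x = hd q \<and> y = last p" if "x \<in> set q" "y \<in> set p" for x y
    using H(5) that sym_iff[of x y] by auto
  then show ?thesis using False H(1-4) by (simp add: icycle_append Int_commute)
qed auto

lemma icycle_rev: "icycle E (rev c) \<longleftrightarrow> icycle E c"
proof -
  have *: "icycle E (rev c)" if "icycle E c" for c
  proof -
    from icycle_nonempty[OF that] obtain z d where c: "c = z # d" by (cases c) auto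
    then have "d \<noteq> []" using that by (auto simp: icycle_Cons)
    then have "icycle E (z # rev d)"
      using that unfolding c by (auto simp: icycle_Cons ipath_rev last_rev hd_rev)
    then show ?thesis unfolding c using icycle_rotate[of "[z]" "rev d"] by simp
  qed
  show ?thesis using *[of c] *[of "rev c"] by auto
qed

lemma icycle_rotate_to:
  assumes "icycle E c" "x \<in> set c"
  obtains d where "icycle E (x # d)" "set c = insert x (set d)" "length c = Suc (length d)"
proof -
  obtain p q where c: "c = p @ x # q" using assms(2) by (meson split_list)
  have "icycle E (x # q @ p)" using icycle_rotate[of p "x # q"] assms(1) c by simp
  then show thesis using that[of "q @ p"] c by auto
qed

lemma icycle_rotate_edge:
  assumes "icycle E c" "x \<in> set c" "y \<in> set c" "E x y"
  obtains d where "icycle E (x # d)" "set c = insert x (set d)" "hd d = y" "length c = Suc (length d)"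
proof -
  obtain d where d: "icycle E (x # d)" "set c = insert x (set d)" "length c = Suc (length d)"
    using icycle_rotate_to assms(1,2) by metis
  have "y \<in> set d" using d assms irrefl by auto
  then have "y = hd d \<or> y = last d" using d(1) assms(4) by (auto simp: icycle_Cons)
  moreover have "icycle E (x # rev d)" using icycle_rotate[of "[x]" d] d(1) icycle_rev[of "d @ [x]"] by simp
  moreover have "hd (rev d) = last d" using d(1) by (auto simp: icycle_Cons hd_rev)
  ultimately show thesis using that[of d] that[of "rev d"] d by auto
qed

section \<open>The shapes that a cycle and an attached path can form\<close>

lemma itrihedron_of_ear:
  assumes c: "icycle E c" and r: "ipath E r" "r \<noteq> []" "set c \<inter> set r = {}"
    and xy: "x \<in> set c" "y \<in> set c" "x \<noteq> y" "\<not> E x y"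
    and e: "\<And>v s. v \<in> set c \<Longrightarrow> s \<in> set r \<Longrightarrow> E v s \<longleftrightarrow> v = x \<and> s = hd r \<or> v = y \<and> s = last r"
  shows "solid_set E (set c \<union> set r)"
proof -
  obtain d where d: "icycle E (x # d)" "set c = insert x (set d)"
    using icycle_rotate_to c xy by metis
  have "y \<in> set d" using d xy by auto
  then obtain a b where ab: "d = a @ y # b" by (meson split_list)
  \<comment> \<open>As \<open>x\<close> and \<open>y\<close> are not adjacent, both arcs between
    them have inner vertices; with \<open>r\<close> they are the three paths.\<close>
  have ne: "a \<noteq> []" "b \<noteq> []" using d(1) xy unfolding ab by (auto simp: icycle_Cons)
  have i: "ipath E (a @ y # b)" and i0: "x \<notin> set (a @ y # b)"
    and x: "\<And>v. v \<in> set (a @ y # b) \<Longrightarrow> E x v \<longleftrightarrow> v = hd (a @ y # b) \<or> v = last (a @ y # b)"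
    using d(1) unfolding ab icycle_Cons by blast+
  then have i: "ipath E (a @ y # b)" "x \<notin> set a" "x \<notin> set b" by auto
  have i': "ipath E a" "ipath E b" "y \<notin> set a" "y \<notin> set b" "set a \<inter> set b = {}"
    and e1: "\<And>v. v \<in> set b \<Longrightarrow> E y v \<longleftrightarrow> v = hd b"
    and e2: "\<And>v s. v \<in> set a \<Longrightarrow> s \<in> set (y # b) \<Longrightarrow> E v s \<longleftrightarrow> v = last a \<and> s = y"
    using i(1) by (auto simp: ipath_append)
  have in1: "hd a \<in> set a" "last a \<in> set a" "hd b \<in> set b" "last b \<in> set b" using ne by auto
  have sub: "set a \<subseteq> set c" "set b \<subseteq> set c" using d(2) ab by auto
  have "arms E a (rev b) r"
    using i' ne r sub by (auto simp: arms_def ipath_rev)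
  moreover have "apex E x a" "apex E x (rev b)"
    using i(2,3) x ne i'(5) in1 by (auto simp: apex_def hd_rev disjoint_iff)
  moreover have "apex E y (rev a)"
    using i'(3) e2 sym_iff[of y] by (auto simp: apex_def hd_rev)
  moreover have "apex E y b"
    using i'(4) e1 by (auto simp: apex_def)
  moreover have "apex E x r" "apex E y (rev r)"
    using xy e r(3) by (auto simp: apex_def hd_rev)
  moreover have "\<not> E v s" if "v \<in> set a" "s \<in> set b" for v s
    using e2 that i' by auto
  moreover have "\<not> E v s" if "v \<in> set a \<union> set b" "s \<in> set r" for v s
    using e[of v s] that sub i(2,3) i'(3,4) by blast
  ultimately have "itrihedron E x y a (rev b) r"
    using xy unfolding itrihedron_def by auto
  moreover have "set c \<union> set r = {x, y} \<union> set a \<union> set (rev b) \<union> set r" using d ab by auto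
  ultimately show ?thesis unfolding solid_set_def by blast
qed

text \<open>The order in which the path meets the ends of the edge is unknown, hence the unordered
  pair.\<close>

lemma ipath_split_edge:
  assumes "ipath E d" "y \<in> set d" "y' \<in> set d" "E y y'"
  obtains a b where "d = a @ b" "a \<noteq> []" "b \<noteq> []" "{last a, hd b} = {y, y'}"
proof -
  have *: "\<exists>a b. d = a @ b \<and> a \<noteq> [] \<and> b \<noteq> [] \<and> last a = y \<and> hd b = y'"
    if "d = a @ y # b" "y' \<in> set b" "E y y'" "ipath E d" for y y' a b
    using that by (intro exI[of _ "a @ [y]"] exI[of _ b]) (auto simp: ipath_append)
  obtain a b where ab: "d = a @ y # b" using assms(2) by (meson split_list)
  show thesis
  proof (cases "y' \<in> set b")
    case True
    then show thesis using *[OF ab True assms(4,1)] that by blast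
  next
    case False
    then have "y' \<in> set a" using assms ab irrefl by auto
    then obtain a1 a2 where "a = a1 @ y' # a2" by (meson split_list)
    then show thesis using *[of a1 y' "a2 @ y # b" y] that assms(1,4) ab sym[OF assms(4)] by auto
  qed
qed

text \<open>The edge \<open>y y'\<close> and \<open>last r\<close> form the triangle,
  \<open>x\<close> is the apex, and cutting the cycle at \<open>x\<close> and at this edge leaves
  two of the three paths.\<close>

lemma stamp_of_ear:
  assumes c: "icycle E c" and r: "ipath E r" "r \<noteq> []" "set c \<inter> set r = {}"
    and xy: "x \<in> set c" "y \<in> set c" "y' \<in> set c" "x \<noteq> y" "x \<noteq> y'" "E y y'"
    and e: "\<And>v s. v \<in> set c \<Longrightarrow> s \<in> set r \<Longrightarrow>
      E v s \<longleftrightarrow> v = x \<and> s = hd r \<or> (v = y \<or> v = y') \<and> s = last r"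
  shows "solid_set E (set c \<union> set r)"
proof -
  obtain d where d: "icycle E (x # d)" "set c = insert x (set d)"
    using icycle_rotate_to c xy by metis
  have yd: "y \<in> set d" "y' \<in> set d" using d xy by auto
  have di: "ipath E d" "x \<notin> set d" "\<And>v. v \<in> set d \<Longrightarrow> E x v \<longleftrightarrow> v = hd d \<or> v = last d"
    using d(1) by (auto simp: icycle_Cons)
  obtain a b where ab: "d = a @ b" "a \<noteq> []" "b \<noteq> []" "{last a, hd b} = {y, y'}"
    using ipath_split_edge[OF di(1) yd xy(6)] .
  have i: "ipath E a" "ipath E b" "set a \<inter> set b = {}"
    and e1: "\<And>v s. v \<in> set a \<Longrightarrow> s \<in> set b \<Longrightarrow> E v s \<longleftrightarrow> v = last a \<and> s = hd b"
    using di(1) unfolding ab(1) by (auto simp: ipath_append)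
  have in1: "hd a \<in> set a" "last a \<in> set a" "hd b \<in> set b" "last b \<in> set b" using ab by auto
  have sub: "set a \<subseteq> set c" "set b \<subseteq> set c" using d(2) ab by auto
  have "arms E a (rev b) r"
    using i ab r sub by (auto simp: arms_def ipath_rev)
  moreover have "apex E x a" "apex E x (rev b)"
    using di(2,3) ab i(3) in1 by (auto simp: apex_def hd_rev disjoint_iff)
  moreover have "apex E x r"
    using xy e r(3) by (auto simp: apex_def)
  moreover have "E v s \<longleftrightarrow> v = last a \<and> s = last (rev b)" if "v \<in> set a" "s \<in> set (rev b)" for v s
    using e1 that by (auto simp: last_rev)
  moreover have "E v s \<longleftrightarrow> v = last a \<and> s = last r" if "v \<in> set a" "s \<in> set r" for v s
  proof -
    have "v \<in> {y, y'} \<longleftrightarrow> v = last a" using ab(4) that i(3) in1 by (metis disjoint_iff insert_iff singletonD)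
    then show ?thesis using e[of v s] that sub di(2) ab by auto
  qed
  moreover have "E v s \<longleftrightarrow> v = last (rev b) \<and> s = last r" if "v \<in> set (rev b)" "s \<in> set r" for v s
  proof -
    have "v \<in> {y, y'} \<longleftrightarrow> v = hd b" using ab(4) that i(3) in1
      by (metis disjoint_iff insert_iff singletonD set_rev)
    then show ?thesis using e[of v s] that sub di(2) ab by (auto simp: last_rev)
  qed
  ultimately have "istamp E x a (rev b) r"
    unfolding istamp_def by blast
  moreover have "set c \<union> set r = insert x (set a \<union> set (rev b) \<union> set r)" using d ab by auto
  ultimately show ?thesis unfolding solid_set_def by blast
qed

text \<open>Cutting the cycle at two disjoint edges leaves two paths, and \<open>r\<close> is the
  third. Each end of \<open>r\<close> completes one of the edges to a triangle.\<close>

lemma prism_of_ear: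
  assumes c: "icycle E c" and r: "ipath E r" "set c \<inter> set r = {}" "hd r \<noteq> last r" "r \<noteq> []"
    and xy: "x \<in> set c" "x' \<in> set c" "y \<in> set c" "y' \<in> set c" "{x, x'} \<inter> {y, y'} = {}" "E x x'" "E y y'"
    and e: "\<And>v s. v \<in> set c \<Longrightarrow> s \<in> set r \<Longrightarrow>
      E v s \<longleftrightarrow> (v = x \<or> v = x') \<and> s = hd r \<or> (v = y \<or> v = y') \<and> s = last r"
  shows "solid_set E (set c \<union> set r)"
proof -
  obtain d where d: "icycle E (x' # d)" "set c = insert x' (set d)" "hd d = x"
    using icycle_rotate_edge c xy(1,2) sym[OF xy(6)] by metis
  have yd: "y \<in> set d" "y' \<in> set d" using d xy by auto
  have di: "ipath E d" using d(1) by (auto simp: icycle_Cons)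
  obtain a b where ab: "d = a @ b" "a \<noteq> []" "b \<noteq> []" "{last a, hd b} = {y, y'}"
    using ipath_split_edge[OF di(1) yd xy(7)] .
  \<comment> \<open>The cycle was opened at \<open>x'\<close>, which has to return to the end of the
    second arc.\<close>
  define b' where "b' = b @ [x']"
  have "icycle E (a @ b')"
    using icycle_rotate[of "[x']" d] d(1) unfolding ab(1) b'_def by simp
  moreover have b': "b' \<noteq> []" "hd b' = hd b" "last b' = x'" using ab by (auto simp: b'_def)
  ultimately have i: "ipath E a" "ipath E b'" "set a \<inter> set b' = {}"
    and e1: "\<And>v s. v \<in> set a \<Longrightarrow> s \<in> set b' \<Longrightarrow> E v s \<longleftrightarrow> v = last a \<and> s = hd b' \<or> v = hd a \<and> s = last b'"
    using icycle_append[OF ab(2) b'(1)] by auto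
  have ha: "hd a = x" using d(3) ab by simp
  have in1: "hd a \<in> set a" "last a \<in> set a" "hd b' \<in> set b'" "last b' \<in> set b'"
    using ab(2) b'(1) by (metis hd_in_set last_in_set)+
  have sub: "set a \<subseteq> set c" "set b' \<subseteq> set c" "set c = set a \<union> set b'" using d(2) ab b'_def by auto
  have ne: "hd a \<noteq> last a" "hd (rev b') \<noteq> last (rev b')" 
    using ha ab(4) xy(5) b' by (auto simp: hd_rev last_rev)
  have "arms E a (rev b') r"
    using i ab r sub b' by (auto simp: arms_def ipath_rev)
  moreover have "E v s \<longleftrightarrow> v = hd a \<and> s = hd (rev b') \<or> v = last a \<and> s = last (rev b')"
    if "v \<in> set a" "s \<in> set (rev b')" for v s
    using e1 that by (auto simp: last_rev hd_rev)
  moreover have "E v s \<longleftrightarrow> v = hd a \<and> s = hd r \<or> v = last a \<and> s = last r" if "v \<in> set a" "s \<in> set r" for v s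
  proof -
    have "v \<in> {y, y'} \<longleftrightarrow> v = last a" "v \<in> {x, x'} \<longleftrightarrow> v = hd a"
      using ab(4) that i(3) in1 ha b' by (metis disjoint_iff insert_iff singletonD)+
    then show ?thesis using e[of v s] that sub by auto
  qed
  moreover have "E v s \<longleftrightarrow> v = hd (rev b') \<and> s = hd r \<or> v = last (rev b') \<and> s = last r"
    if "v \<in> set (rev b')" "s \<in> set r" for v s
  proof -
    have "v \<in> {y, y'} \<longleftrightarrow> v = hd b'" "v \<in> {x, x'} \<longleftrightarrow> v = last b'"
      using ab(4) that i(3) in1 ha b' by (metis disjoint_iff insert_iff singletonD set_rev)+
    then show ?thesis using e[of v s] that sub by (auto simp: last_rev hd_rev)
  qed
  ultimately have "iprism E a (rev b') r"
    using ne r unfolding iprism_def by blast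
  moreover have "set c \<union> set r = set a \<union> set (rev b') \<union> set r" using sub by auto
  ultimately show ?thesis unfolding solid_set_def by blast
qed

text \<open>Cycle and ear change roles: in the cycle, \<open>h\<close> is replaced by
  \<open>r\<close>, and \<open>h\<close> becomes the apex, which sees \<open>x\<close>,
  \<open>y\<close> and at least one vertex of \<open>r\<close>.\<close>

lemma pyramid_of_ear:
  assumes c: "icycle E c" and r: "ipath E r" "r \<noteq> []" "set c \<inter> set r = {}"
    and xy: "h \<in> set c" "x \<in> set c" "y \<in> set c" "x \<noteq> y" "E h x" "E h y" "s0 \<in> set r" "E h s0"
    and e: "\<And>v s. v \<in> set c \<Longrightarrow> s \<in> set r \<Longrightarrow> v \<noteq> h \<Longrightarrow>
      E v s \<longleftrightarrow> v = x \<and> s = hd r \<or> v = y \<and> s = last r"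
  shows "solid_set E (set c \<union> set r)"
proof -
  obtain d where d: "icycle E (h # d)" "set c = insert h (set d)" "hd d = y"
    using icycle_rotate_edge c xy by metis
  have di: "ipath E d" "d \<noteq> []" "h \<notin> set d" "\<And>v. v \<in> set d \<Longrightarrow> E h v \<longleftrightarrow> v = hd d \<or> v = last d"
    "2 \<le> length d"
    using d(1) by (auto simp: icycle_Cons)
  have xd: "x \<in> set d" "y \<in> set d" using xy irrefl d(2) by auto
  then have lx: "last d = x" using di(4)[of x] xy(4,5) d(3) by auto
  have "icycle E (d @ r)"
    using di r d e lx by (subst icycle_append) (auto simp: Suc_le_eq neq_Nil_conv)
  moreover have "h \<notin> set (d @ r)" using di(3) r(3) xy(1) by auto
  moreover have "card {x, y, s0} \<le> card {v \<in> set (d @ r). E h v}"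
    using xy xd by (intro card_mono) auto
  moreover have "card {x, y, s0} = 3" using xy(2-4,7) r(3) by (auto simp: card_insert_if)
  ultimately have "ipyramid E (d @ r) h" unfolding ipyramid_def by simp
  moreover have "set c \<union> set r = insert h (set (d @ r))" using d by auto
  ultimately show ?thesis unfolding solid_set_def by blast
qed

text \<open>Let \<open>A1\<close> and \<open>A2\<close> be what the ear sees without its last and
  without its first vertex. If they are disjoint, only the two ends of \<open>r\<close> are
  attached, each to a vertex or an edge: trihedron, stamp or prism. If they share a vertex, or if
  \<open>r\<close> is a single vertex with at least three attachments, there is a pyramid; a single
  vertex with two attachments gives a trihedron.\<close>

lemma ear_solid:
  assumes "ear E c r"
  shows "solid_set E (set c \<union> set r)"
proof -
  have c: "icycle E c" and r: "ipath E r" "r \<noteq> []" "set c \<inter> set r = {}"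
    and big: "\<not> small E (att E (set c) (set r))"
    and s1: "small E (att E (set c) (set (butlast r)))" and s2: "small E (att E (set c) (set (tl r)))"
    using assms by (auto simp: ear_def)
  define A1 A2 where "A1 = att E (set c) (set (butlast r))" and "A2 = att E (set c) (set (tl r))"
  obtain x x' where x: "A1 \<subseteq> {x, x'}" "x = x' \<or> E x x'" using s1 unfolding small_def A1_def by blast
  obtain y y' where y: "A2 \<subseteq> {y, y'}" "y = y' \<or> E y y'" using s2 unfolding small_def A2_def by blast
  show ?thesis
  proof (cases "tl r = []")
    case True
    then obtain w where w: "r = [w]" using r(2) by (cases r) auto
    let ?N = "{v \<in> set c. E w v}"
    have N: "att E (set c) (set r) = ?N" using w sym_iff by (auto simp: att_def)
    show ?thesis
    proof (cases "3 \<le> card ?N")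
      case True
      then have "ipyramid E c w" using c w r(3) by (auto simp: ipyramid_def)
      moreover have "set c \<union> set r = insert w (set c)" using w by auto
      ultimately show ?thesis unfolding solid_set_def by blast
    next
      case False
      have "card ?N \<noteq> 0" using big unfolding N small_def by auto
      moreover have "card ?N \<noteq> 1" using big unfolding N small_def by (metis card_1_singletonE insert_absorb2 order_refl)
      ultimately have "card ?N = 2" using False by linarith
      then obtain a b where ab: "?N = {a, b}" "a \<noteq> b" by (meson card_2_iff)
      have "\<not> E a b" using big ab unfolding N small_def by auto
      then show ?thesis 
        using itrihedron_of_ear[of c r a b] c r w ab sym_iff[of _ w] by (auto simp: set_eq_iff)
    qed
  next
    case False
    then obtain f m l where flm: "r = f # m @ [l]" using r(2)
      by (metis append_butlast_last_id list.collapse)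
    have bl: "butlast r = f # m" "tl r = m @ [l]" "hd r = f" "last r = l" using flm by (auto simp: butlast_append)
    have un: "att E (set c) (set r) = A1 \<union> A2"
      unfolding A1_def A2_def bl by (auto simp: att_def flm)
    have sub: "A1 \<subseteq> set c" "A2 \<subseteq> set c" by (auto simp: A1_def A2_def att_def)
    have fl: "f \<noteq> l" using r(1) flm by auto
    show ?thesis
    proof (cases "A1 \<inter> A2 = {}")
      case True
      \<comment> \<open>A vertex seen from the interior of \<open>r\<close> would belong to both
        sets.\<close>
      have e: "E v s \<longleftrightarrow> v \<in> A1 \<and> s = hd r \<or> v \<in> A2 \<and> s = last r" if "v \<in> set c" "s \<in> set r" for v s
        using True that unfolding A1_def A2_def bl by (auto simp: att_def flm)
      have ne: "A1 \<noteq> {}" "A2 \<noteq> {}" using big un s1 s2 A1_def A2_def by auto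
      have c1: "(\<exists>a. A1 = {a}) \<or> (\<exists>a b. A1 = {a, b} \<and> E a b)" using x ne(1)
        by (cases "x \<in> A1"; cases "x' \<in> A1") auto
      have c2: "(\<exists>a. A2 = {a}) \<or> (\<exists>a b. A2 = {a, b} \<and> E a b)" using y ne(2)
        by (cases "y \<in> A2"; cases "y' \<in> A2") auto
      have nE: "\<not> E a b" if "A1 = {a}" "A2 = {b}" for a b 
        using big un that unfolding small_def by auto
      show ?thesis
        using c1 
      proof
        assume "\<exists>a. A1 = {a}"
        then obtain a where a: "A1 = {a}" by blast
        show ?thesis using c2
        proof
          assume "\<exists>a. A2 = {a}"
          then obtain b where b: "A2 = {b}" by blast
          show ?thesis using itrihedron_of_ear[of c r a b] c r e a b sub nE[OF a b] True by auto
        next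
          assume "\<exists>a b. A2 = {a, b} \<and> E a b"
          then obtain b b' where b: "A2 = {b, b'}" "E b b'" by blast
          show ?thesis using stamp_of_ear[of c r a b b'] c r e a b sub True by auto
        qed
      next
        assume "\<exists>a b. A1 = {a, b} \<and> E a b"
        then obtain a a' where a: "A1 = {a, a'}" "E a a'" by blast
        show ?thesis using c2
        proof
          assume "\<exists>a. A2 = {a}"
          then obtain b where b: "A2 = {b}" by blast
          have "solid_set E (set c \<union> set (rev r))"
            using stamp_of_ear[of c "rev r" b a a'] c r e a b sub True
            by (auto simp: ipath_rev hd_rev last_rev)
          then show ?thesis by simp
        next
          assume "\<exists>a b. A2 = {a, b} \<and> E a b"
          then obtain b b' where b: "A2 = {b, b'}" "E b b'" by blast
          show ?thesis using prism_of_ear[of c r a a' b b'] c r e a b sub True fl bl by auto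
        qed
      qed
    next
      case False
      then obtain h where h: "h \<in> A1" "h \<in> A2" by auto
      obtain a where a: "A1 \<subseteq> {h, a}" "h = a \<or> E h a" using x h sym by blast
      obtain b where b: "A2 \<subseteq> {h, b}" "h = b \<or> E h b" using y h sym by blast
      \<comment> \<open>If one set contained the other, it would be the whole attachment, which is
        not small.\<close>
      have ne: "\<not> A1 \<subseteq> A2" "\<not> A2 \<subseteq> A1" using big s1 s2 un by (auto simp: A1_def A2_def Un_absorb1 Un_absorb2)
      then have "A1 = {h, a}" "A2 = {h, b}" "a \<noteq> b" "a \<noteq> h" "b \<noteq> h" using a b h by auto
      moreover obtain s0 where "s0 \<in> set r" "E h s0" using h(1) flm by (auto simp: A1_def bl att_def)
      moreover have "E v s \<longleftrightarrow> v = a \<and> s = hd r \<or> v = b \<and> s = last r" 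
        if "v \<in> set c" "s \<in> set r" "v \<noteq> h" for v s
      proof -
        have "v \<in> A1 \<longleftrightarrow> v = a" "v \<in> A2 \<longleftrightarrow> v = b" using calculation that by auto
        then show ?thesis
          using \<open>a \<noteq> b\<close> that unfolding A1_def A2_def bl by (auto simp: att_def flm)
      qed
      ultimately show ?thesis using pyramid_of_ear[of c r h a b s0] c r a b sub h by blast
    qed
  qed
qed

end

section \<open>Connected sets attached to a cycle\<close>

text \<open>Connectedness by cuts instead of walks: unions, images and contractions then only need a
  look at where a cut goes.\<close>

definition conn :: "('a \<Rightarrow> 'a \<Rightarrow> bool) \<Rightarrow> 'a set \<Rightarrow> bool" where
  "conn E R \<longleftrightarrow> R \<noteq> {} \<and> (\<forall>X. X \<subseteq> R \<and> X \<noteq> {} \<and> X \<noteq> R \<longrightarrow> (\<exists>x \<in> X. \<exists>y \<in> R - X. E x y))"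

text \<open>The minimality of an \<open>ear\<close> without its shape: \<open>R\<close> may be any
  connected set, and it competes with all its proper connected subsets.\<close>

definition critical :: "('a \<Rightarrow> 'a \<Rightarrow> bool) \<Rightarrow> 'a list \<Rightarrow> 'a set \<Rightarrow> bool" where
  "critical E c R \<longleftrightarrow> icycle E c \<and> set c \<inter> R = {} \<and> conn E R \<and> \<not> small E (att E (set c) R) \<and>
     (\<forall>R'. R' \<subset> R \<and> conn E R' \<longrightarrow> small E (att E (set c) R'))"

lemma connE:
  assumes "conn E R" "X \<subseteq> R" "X \<noteq> {}" "X \<noteq> R"
  obtains x y where "x \<in> X" "y \<in> R" "y \<notin> X" "E x y"
  using assms unfolding conn_def by blast

lemma conn_nonempty: "conn E R \<Longrightarrow> R \<noteq> {}"
  by (simp add: conn_def)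

lemma conn_sing: "conn E {x}"
  unfolding conn_def by blast

lemma small_mono: "small E A \<Longrightarrow> B \<subseteq> A \<Longrightarrow> small E B"
  unfolding small_def by blast

lemma small_empty: "small E {}"
  unfolding small_def by blast

lemma att_mono: "R \<subseteq> R' \<Longrightarrow> att E C R \<subseteq> att E C R'"
  unfolding att_def by blast

lemma not_small3:
  assumes "a \<in> A" "b \<in> A" "d \<in> A" "a \<noteq> b" "a \<noteq> d" "b \<noteq> d"
  shows "\<not> small E A"
  using assms unfolding small_def by blast

context ugraph
begin

lemma small_adj: "small E A \<Longrightarrow> x \<in> A \<Longrightarrow> y \<in> A \<Longrightarrow> x = y \<or> E x y"
  unfolding small_def using sym by blast

lemma conn_Un:
  assumes A: "conn E A" and B: "conn E B" and ab: "a \<in> A" "b \<in> B" "a = b \<or> E a b"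
  shows "conn E (A \<union> B)"
  unfolding conn_def
proof (intro conjI allI impI)
  show "A \<union> B \<noteq> {}" using A by (auto simp: conn_def)
  fix X assume X: "X \<subseteq> A \<union> B \<and> X \<noteq> {} \<and> X \<noteq> A \<union> B"
  consider "X \<inter> A \<noteq> {} \<and> X \<inter> A \<noteq> A" | "X \<inter> B \<noteq> {} \<and> X \<inter> B \<noteq> B"
    | "X \<inter> A = {}" "B \<subseteq> X" | "A \<subseteq> X" "X \<inter> B = {}"
    using X by blast
  then show "\<exists>x \<in> X. \<exists>y \<in> A \<union> B - X. E x y"
  proof cases
    case 1
    then obtain x y where "x \<in> X \<inter> A" "y \<in> A" "y \<notin> X \<inter> A" "E x y" using connE[OF A, of "X \<inter> A"] by blast
    then show ?thesis by blast
  next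
    case 2
    then obtain x y where "x \<in> X \<inter> B" "y \<in> B" "y \<notin> X \<inter> B" "E x y" using connE[OF B, of "X \<inter> B"] by blast
    then show ?thesis by blast
  next
    case 3
    then show ?thesis using ab sym by blast
  next
    case 4
    then show ?thesis using ab by blast
  qed
qed

lemma conn_insert: "conn E A \<Longrightarrow> a \<in> A \<Longrightarrow> E x a \<Longrightarrow> conn E (insert x A)"
  using conn_Un[of "{x}" A x a] conn_sing[of E x] by auto

lemma conn_ipath: "ipath E p \<Longrightarrow> p \<noteq> [] \<Longrightarrow> conn E (set p)"
proof (induction p)
  case (Cons x p)
  then show ?case
    by (cases "p = []") (auto simp: conn_sing intro!: conn_insert[of _ "hd p"])
qed simp

text \<open>A missing vertex would separate the two ends.\<close>

lemma conn_subset_ipath: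
  assumes p: "ipath E p" and X: "conn E X" "X \<subseteq> set p" "hd p \<in> X" "last p \<in> X"
  shows "X = set p"
proof (rule ccontr)
  assume "X \<noteq> set p"
  then obtain v where v: "v \<in> set p" "v \<notin> X" using X(2) by blast
  then obtain a b where ab: "p = a @ v # b" by (meson split_list)
  have ne: "a \<noteq> []" "b \<noteq> []" using ab X(3,4) v by auto
  then have "hd p \<in> set a" "last p \<in> set b" using ab by auto
  moreover have d: "set a \<inter> set b = {}" "\<And>s t. s \<in> set a \<Longrightarrow> t \<in> set b \<Longrightarrow> \<not> E s t"
    using p unfolding ab by (auto simp: ipath_append)
  ultimately obtain x y where "x \<in> X \<inter> set a" "y \<in> X" "y \<notin> X \<inter> set a" "E x y"
    using connE[OF X(1), of "X \<inter> set a"] X(3,4) by blast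
  then show False using d(2)[of x y] v X(2) ab by auto
qed

text \<open>The ends of induced paths in \<open>R\<close> that meet \<open>A\<close> exactly at
  their start form a set that no edge of \<open>R\<close> leaves, so they are all of
  \<open>R\<close>. A shortest such path that ends in \<open>B\<close> meets \<open>B\<close>
  nowhere else.\<close>

lemma conn_path:
  assumes R: "conn E R" and A: "a0 \<in> A" "a0 \<in> R" and B: "b0 \<in> B" "b0 \<in> R"
  obtains p where "ipath E p" "p \<noteq> []" "set p \<subseteq> R" "hd p \<in> A" "last p \<in> B"
    "set (tl p) \<inter> A = {}" "set (butlast p) \<inter> B = {}"
proof -
  define P where "P p \<longleftrightarrow> ipath E p \<and> p \<noteq> [] \<and> set p \<subseteq> R \<and> hd p \<in> A \<and> set (tl p) \<inter> A = {}" for p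
  have pre: "P a" if "P (a @ b)" "a \<noteq> []" for a b
    using that unfolding P_def ipath_append by (cases a) auto
  define X where "X = {y \<in> R. \<exists>p. P p \<and> last p = y}"
  have "X = R"
  proof (rule ccontr)
    assume "X \<noteq> R"
    have "P [a0]" using A by (auto simp: P_def)
    then have "a0 \<in> X" using A(2) by (force simp: X_def)
    moreover have "X \<subseteq> R" by (auto simp: X_def)
    ultimately obtain x y where xy: "x \<in> X" "y \<in> R" "y \<notin> X" "E x y"
      using connE[OF R, of X] \<open>X \<noteq> R\<close> by blast
    then obtain p where p: "P p" "last p = x" by (auto simp: X_def)
    have yA: "y \<notin> A"
    proof
      assume "y \<in> A"
      then have "P [y]" using xy by (auto simp: P_def)
      then show False using xy by (force simp: X_def)
    qed
    have yp: "y \<notin> set p"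
    proof
      assume "y \<in> set p"
      then obtain a b where "p = (a @ [y]) @ b" by (metis append.assoc append_Cons append_Nil split_list)
      then have "P (a @ [y])" using pre p by blast
      then show False using xy by (force simp: X_def)
    qed
    \<comment> \<open>Stopping at the first vertex of \<open>p\<close> adjacent to \<open>y\<close>
      keeps the path induced when \<open>y\<close> is appended.\<close>
    have "\<exists>v \<in> set p. E v y" using p xy by (force simp: P_def)
    then obtain a v b where avb: "p = a @ v # b" "E v y" "\<forall>t \<in> set a. \<not> E t y"
      using split_list_first_prop[of p "\<lambda>v. E v y"] by blast
    have Pa: "P (a @ [v])" using pre[of "a @ [v]" b] p avb by simp
    have "P ((a @ [v]) @ [y])"
      using Pa yp yA avb xy(2) unfolding P_def ipath_append
      by (cases a) auto
    then show False using xy by (force simp: X_def)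
  qed
  then have ex: "\<exists>p. P p \<and> last p \<in> B" proof -
    have "b0 \<in> X" using \<open>X = R\<close> B(2) by simp
    then show ?thesis using B(1) unfolding X_def by blast
  qed
  \<comment> \<open>The prefix up to an earlier vertex of \<open>B\<close> would be shorter.\<close>
  define p where "p = (ARG_MIN length p. P p \<and> last p \<in> B)"
  have p: "P p" "last p \<in> B" and m: "\<And>q. P q \<Longrightarrow> last q \<in> B \<Longrightarrow> length p \<le> length q"
    using arg_min_nat_lemma[of "\<lambda>p. P p \<and> last p \<in> B" _ length] ex unfolding p_def by blast+
  have "set (butlast p) \<inter> B = {}"
  proof (rule ccontr)
    assume "set (butlast p) \<inter> B \<noteq> {}"
    then obtain b where b: "b \<in> set (butlast p)" "b \<in> B" by blast
    then obtain s t where st: "butlast p = s @ b # t" by (meson split_list)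
    have "p \<noteq> []" using p by (auto simp: P_def)
    then have "p = butlast p @ [last p]" by simp
    then have pp: "p = (s @ [b]) @ (t @ [last p])" using st by simp
    then have "P (s @ [b])" using pre p by (metis append_is_Nil_conv not_Cons_self2)
    then have "length p \<le> length (s @ [b])" using m[of "s @ [b]"] b by simp
    then show False using arg_cong[OF pp, of length] by simp
  qed
  then show thesis using that p unfolding P_def by blast
qed

text \<open>A largest connected proper subset containing \<open>a\<close> misses just one vertex,
  since any vertex adjacent to it could be added.\<close>

lemma conn_remove:
  assumes R: "conn E R" "finite R" "a \<in> R" "R \<noteq> {a}"
  obtains b where "b \<in> R" "b \<noteq> a" "conn E (R - {b})"
proof -
  let ?P = "\<lambda>T. conn E T \<and> T \<subset> R \<and> a \<in> T"
  have "?P {a}" using R conn_sing by auto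
  then have ne: "{T. ?P T} \<noteq> {}" by blast
  have "{T. ?P T} \<subseteq> Pow R" by blast
  then have fin: "finite {T. ?P T}" using R(2) finite_subset by blast
  from finite_has_maximal[OF fin ne] obtain T
    where T: "?P T" "\<And>T'. ?P T' \<Longrightarrow> T \<subseteq> T' \<Longrightarrow> T = T'" by auto
  obtain x y where xy: "x \<in> T" "y \<in> R" "y \<notin> T" "E x y" using connE[OF R(1), of T] T(1) by blast
  have "conn E (insert y T)" using T(1) xy conn_insert sym by blast
  then have "insert y T = R" using T xy by blast
  then have "R - {y} = T" using xy by blast
  then show thesis using that[of y] xy T(1) by blast
qed

text \<open>By \<open>conn_subset_ipath\<close>, a proper connected subset of the path misses one of
  its ends, and the two deletions of ends are covered by \<open>ear\<close>.\<close>

lemma ear_critical: "ear E c r \<Longrightarrow> critical E c (set r)"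
  unfolding critical_def
proof (intro conjI allI impI)
  assume e: "ear E c r"
  show "icycle E c" "set c \<inter> set r = {}" "conn E (set r)" "\<not> small E (att E (set c) (set r))"
    using e conn_ipath by (auto simp: ear_def)
  fix R' assume R': "R' \<subset> set r \<and> conn E R'"
  have r: "ipath E r" "r \<noteq> []" using e by (auto simp: ear_def)
  have "hd r \<notin> R' \<or> last r \<notin> R'" using conn_subset_ipath[OF r(1)] R' by blast
  then have "R' \<subseteq> set (tl r) \<or> R' \<subseteq> set (butlast r)"
  proof
    assume "hd r \<notin> R'"
    moreover have "set r = insert (hd r) (set (tl r))" using r(2) by (cases r) auto
    then have "R' \<subseteq> insert (hd r) (set (tl r))" using R' by (metis psubset_imp_subset)
    ultimately show ?thesis by blast
  next
    assume "last r \<notin> R'"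
    moreover have "set (butlast r @ [last r]) = insert (last r) (set (butlast r))" by simp
    then have "set r = insert (last r) (set (butlast r))" using r(2) by simp
    then have "R' \<subseteq> insert (last r) (set (butlast r))" using R' by (metis psubset_imp_subset)
    ultimately show ?thesis by blast
  qed
  then show "small E (att E (set c) R')" using e small_mono att_mono unfolding ear_def by metis
qed

lemma ear_of_critical:
  assumes "critical E c (set p)" "ipath E p" "p \<noteq> []"
  shows "ear E c p"
proof -
  have d: "distinct p" using ipath_distinct assms by blast
  obtain f m where fm: "p = f # m" using assms(3) by (cases p) auto
  have "small E (att E (set c) (set m))"
  proof (cases "m = []")
    case False
    then have "conn E (set m)" using assms(2) fm conn_ipath by simp
    moreover have "set m \<subset> set p" using d fm by auto
    ultimately show ?thesis using assms(1) unfolding critical_def by blast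
  qed (simp add: att_def small_empty)
  moreover have "small E (att E (set c) (set (butlast p)))"
  proof (cases "butlast p = []")
    case False
    obtain b l where bl: "p = b @ [l]" using assms(3) by (metis append_butlast_last_id)
    then have "conn E (set b)" using False assms(2) conn_ipath by (simp add: ipath_append)
    moreover have "set b \<subset> set p" using d bl by auto
    ultimately show ?thesis using assms(1) bl unfolding critical_def by auto
  qed (simp add: att_def small_empty)
  ultimately show ?thesis using assms fm by (auto simp: ear_def critical_def)
qed

lemma not_small_cases:
  assumes "\<not> small E A"
  obtains x y where "x \<in> A" "y \<in> A" "x \<noteq> y" "\<not> E x y"
  | a b d where "a \<in> A" "b \<in> A" "d \<in> A" "a \<noteq> b" "a \<noteq> d" "b \<noteq> d" "E a b" "E a d" "E b d"
proof -
  obtain a where a: "a \<in> A" using assms unfolding small_def by blast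
  obtain b where b: "b \<in> A" "b \<noteq> a" using assms unfolding small_def by blast
  show thesis
  proof (cases "E a b")
    case False
    then show thesis using that(1) a b by metis
  next
    case True
    then obtain d where d: "d \<in> A" "d \<noteq> a" "d \<noteq> b" using assms unfolding small_def by blast
    then show thesis using that a b True by metis
  qed
qed

text \<open>Induced cycles have no chords: opened at \<open>a\<close> towards \<open>b\<close>, the
  cycle ends in \<open>d\<close>, and \<open>d\<close> also follows \<open>b\<close>.\<close>

lemma icycle_triangle:
  assumes c: "icycle E c" and "a \<in> set c" "b \<in> set c" "d \<in> set c" "a \<noteq> b" "a \<noteq> d" "b \<noteq> d"
    "E a b" "E a d" "E b d"
  shows "set c = {a, b, d}"
proof -
  obtain e where e: "icycle E (a # e)" "set c = insert a (set e)" "hd e = b"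
    using icycle_rotate_edge[of c a b] assms by metis
  have "b \<in> set e" "d \<in> set e" "e \<noteq> []" using e assms by auto
  then have "d = last e" using e assms by (auto simp: icycle_Cons)
  obtain e' where e': "e = b # e'" using e(3) \<open>e \<noteq> []\<close> by (cases e) auto
  then have "d \<in> set e'" "ipath E e'" "d = hd e'" "e' \<noteq> []"
    using \<open>d \<in> set e\<close> assms e(1) by (auto simp: icycle_Cons)
  moreover have "d = last e'" using \<open>d = last e\<close> e' \<open>e' \<noteq> []\<close> by simp
  ultimately have "e' = [d]" using hd_neq_last[of e'] ipath_distinct[of E e']
    by (cases e' rule: list.exhaust) (auto split: if_splits)
  then show ?thesis using e e' by auto
qed

lemma icycle_of_triangle:
  "a \<noteq> b \<Longrightarrow> a \<noteq> d \<Longrightarrow> b \<noteq> d \<Longrightarrow> E a b \<Longrightarrow> E a d \<Longrightarrow> E b d \<Longrightarrow> icycle E [a, b, d]"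
  using irrefl by (auto simp: icycle_Cons)

text \<open>Every vertex whose removal leaves \<open>R\<close> connected is the only link of \<open>R\<close> to some vertex of the
  triangle. Two such vertices are joined by a path in \<open>R\<close>, and what remains of \<open>R\<close> is a path from there
  to the third vertex of the triangle.\<close>
lemma critical_triangle:
  assumes c: "critical E c R" and fin: "finite R" and abd: "set c = {a, b, d}" "a \<noteq> b" "a \<noteq> d" "b \<noteq> d"
    "E a b" "E a d" "E b d"
  shows "solid_set E (set c \<union> R)"
proof -
  have ic: "icycle E c" and disj: "set c \<inter> R = {}" and R: "conn E R"
    and big: "\<not> small E (att E (set c) R)"
    and crit: "\<And>R'. R' \<subset> R \<Longrightarrow> conn E R' \<Longrightarrow> small E (att E (set c) R')"
    using c by (auto simp: critical_def)
  have adj: "x = y \<or> E x y" if "x \<in> set c" "y \<in> set c" for x y using that abd sym by auto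
  \<comment> \<open>On a triangle, attached to at most an edge means missing a vertex.\<close>
  have small_iff: "small E (att E (set c) R') \<longleftrightarrow> (\<exists>x \<in> set c. \<forall>s \<in> R'. \<not> E x s)" for R'
  proof
    assume "small E (att E (set c) R')"
    then show "\<exists>x \<in> set c. \<forall>s \<in> R'. \<not> E x s"
      using not_small3[of a "att E (set c) R'" b d E] abd unfolding att_def by auto
  next
    assume "\<exists>x \<in> set c. \<forall>s \<in> R'. \<not> E x s"
    then obtain x where x: "x \<in> set c" "\<forall>s \<in> R'. \<not> E x s" by blast
    obtain y z where "set c \<subseteq> {x, y, z}" "y \<in> set c" "z \<in> set c" using x(1) abd by auto
    then have "att E (set c) R' \<subseteq> {y, z}" "y = z \<or> E y z" using x(2) adj by (auto simp: att_def)
    then show "small E (att E (set c) R')" unfolding small_def by blast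
  qed
  have link: "\<exists>s \<in> R. E x s" if "x \<in> set c" for x using big that small_iff by blast
  have path: "solid_set E (set c \<union> R)" if "ipath E p" "p \<noteq> []" "R = set p" for p
    using ear_of_critical[of c p] ear_solid[of c p] c that by auto
  show ?thesis
  proof (cases "\<exists>s. R = {s}")
    case True
    then obtain s where "R = {s}" by blast
    then show ?thesis using path[of "[s]"] by simp
  next
    case False
    obtain s0 where "s0 \<in> R" using conn_nonempty[OF R] by blast
    then obtain u where u: "u \<in> R" "conn E (R - {u})" using conn_remove[OF R fin] False by metis
    then obtain v where v: "v \<in> R" "v \<noteq> u" "conn E (R - {v})" using conn_remove[OF R fin, of u] False by metis
    \<comment> \<open>Without \<open>u\<close> some vertex \<open>x\<close> of the triangle is no
      longer seen, although \<open>R\<close> sees all three.\<close>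
    have only: "\<exists>x \<in> set c. \<forall>s \<in> R. E x s \<longleftrightarrow> s = u" if "u \<in> R" "conn E (R - {u})" for u
    proof -
      have "small E (att E (set c) (R - {u}))" using crit[of "R - {u}"] that by auto
      then obtain x where "x \<in> set c" "\<forall>s \<in> R - {u}. \<not> E x s" using small_iff[of "R - {u}"] by auto
      then show ?thesis using link[of x] by (intro bexI[of _ x]) auto
    qed
    obtain x where x: "x \<in> set c" "\<And>s. s \<in> R \<Longrightarrow> E x s \<longleftrightarrow> s = u" using only[OF u] by auto
    obtain y where y: "y \<in> set c" "\<And>s. s \<in> R \<Longrightarrow> E y s \<longleftrightarrow> s = v" using only[OF v(1,3)] by auto
    have xy: "x \<noteq> y" using x y u v by blast
    obtain z where z: "set c = {x, y, z}" "z \<noteq> x" "z \<noteq> y" using x(1) y(1) xy abd by auto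
    \<comment> \<open>Since \<open>x\<close> is linked to \<open>R\<close> only by \<open>u\<close>
      and \<open>y\<close> only by \<open>v\<close>, a connected set with \<open>u\<close>,
      \<open>v\<close> and a neighbour of \<open>z\<close> already sees the whole triangle.\<close>
    have big': "\<not> small E (att E (set c) R')" if "R' \<subseteq> R" "u \<in> R'" "v \<in> R'" "s \<in> R'" "E z s" for R' s
      using not_small3[of x "att E (set c) R'" y z E] that x y z xy unfolding att_def by auto
    have zxy: "E z x" "E z y" "E x y" using adj z xy by blast+
    obtain p where p': "ipath E p" "p \<noteq> []" "set p \<subseteq> R" "hd p \<in> {u}" "last p \<in> {v}"
      "set (tl p) \<inter> {u} = {}" "set (butlast p) \<inter> {v} = {}"
      by (rule conn_path[OF R singletonI u(1) singletonI v(1)])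
    then have p: "ipath E p" "p \<noteq> []" "set p \<subseteq> R" "hd p = u" "last p = v" by auto
    have pconn: "conn E (set p)" using p conn_ipath by blast
    have uv: "u \<in> set p" "v \<in> set p" using p by auto
    show ?thesis
    proof (cases "\<exists>s \<in> set p. E z s")
      case True
      then have "\<not> small E (att E (set c) (set p))" using big' uv p(3) by blast
      then have "R = set p" using crit[of "set p"] pconn p(3) by blast
      then show ?thesis using path p by blast
    next
      case False
      obtain s where s: "s \<in> R" "s \<in> {s. E z s}" using link[of z] z(1) by auto
      \<comment> \<open>A connection from \<open>p\<close> to the neighbours of \<open>z\<close>.
        Its first vertex \<open>t\<close> lies on \<open>p\<close> and is split off, which leaves
        \<open>q\<close> disjoint from \<open>p\<close>.\<close>
      obtain q0 where q0': "ipath E q0" "q0 \<noteq> []" "set q0 \<subseteq> R" "hd q0 \<in> set p" "last q0 \<in> {s. E z s}"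
        "set (tl q0) \<inter> set p = {}" "set (butlast q0) \<inter> {s. E z s} = {}"
        by (rule conn_path[OF R uv(1) u(1) s(2) s(1)])
      then have q0: "ipath E q0" "q0 \<noteq> []" "set q0 \<subseteq> R" "hd q0 \<in> set p" "E z (last q0)"
        "set (tl q0) \<inter> set p = {}" "\<forall>s \<in> set (butlast q0). \<not> E z s" by auto
      define q where "q = tl q0"
      obtain t where t: "q0 = t # q" "t \<in> set p" using q0(2,4) by (cases q0) (auto simp: q_def)
      have qne: "q \<noteq> []" using t q0(5) False by auto
      have q: "ipath E q" "set q \<subseteq> R" "set q \<inter> set p = {}" "E (hd q) t" "E z (last q)"
        "\<forall>s \<in> set (butlast q). \<not> E z s"
        using q0 t qne sym[of t "hd q"] by auto
      have zq: "E z s \<longleftrightarrow> s = last q" if "s \<in> set q" for s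
      proof -
        have "set q = insert (last q) (set (butlast q))" using qne
          by (metis append_butlast_last_id list.simps(15) rotate1.simps(2) set_rotate1)
        then show ?thesis using q(5,6) that by auto
      qed
      have qconn: "conn E (set q)" using q conn_ipath qne by blast
      have full: "R' = R" if "conn E R'" "R' \<subseteq> R" "u \<in> R'" "v \<in> R'" "last q \<in> R'" for R'
      proof -
        have "\<not> small E (att E (set c) R')" using big' that(2-5) q(5) by blast
        then show ?thesis using crit[of R'] that by blast
      qed
      have Rpq: "R = set p \<union> set q"
        using full[of "set p \<union> set q"] conn_Un[OF pconn qconn t(2), of "hd q"] sym[OF q(4)]
          p(3) q(2) uv qne by auto
      \<comment> \<open>Only the first vertex of \<open>q\<close> is adjacent to \<open>p\<close>:
        otherwise \<open>q\<close> could be entered later, and \<open>hd q\<close> would be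
        dispensable, contrary to \<open>full\<close>.\<close>
      have ptq: "\<not> E s s'" if s: "s \<in> set p" "s' \<in> set (tl q)" for s s'
      proof
        assume e: "E s s'"
        obtain f m where q': "q = f # m" using qne by (cases q) auto
        obtain m1 m2 where m: "m = m1 @ s' # m2" using s(2) q' by (auto dest: split_list)
        let ?q = "s' # m2"
        have i: "ipath E ?q" using q(1) unfolding q' m by (auto simp: ipath_append)
        have "conn E (set p \<union> set ?q)" using conn_Un[OF pconn conn_ipath[OF i], of s s'] e s by auto
        moreover have "last q = last ?q" using q' m by simp
        then have "last q \<in> set p \<union> set ?q" by simp
        ultimately have "set p \<union> set ?q = R" using full[of "set p \<union> set ?q"] Rpq uv q' m by auto
        moreover have "f \<in> R" "f \<notin> set p" "f \<notin> set ?q" using Rpq q' m q(1,3) by auto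
        ultimately show False by blast
      qed
      \<comment> \<open>What the path \<open>q\<close> sees of \<open>p\<close>; by
        \<open>ptq\<close> it sees it through \<open>hd q\<close> alone.\<close>
      define D where "D = {s \<in> set p. E s (hd q)}"
      have p2: "ipath E (p @ [y])" "x \<notin> set (p @ [y])"
        using p y v z xy disj by (auto simp: ipath_append sym_iff[of _ y])
      have c2: "icycle E (x # p @ [y])"
        unfolding icycle_Cons using p2 p x xy zxy(3) by (auto simp: Suc_le_eq) 
      have tD: "t \<in> D" using t sym[OF q(4)] by (auto simp: D_def)
      \<comment> \<open>Given two nonadjacent vertices of \<open>D\<close>, the stretch of
        \<open>p\<close> between them could be bypassed through \<open>hd q\<close>, contrary to
        \<open>full\<close>. A triangle in \<open>D\<close> would be the whole cycle
        \<open>x # p @ [y]\<close>, but \<open>x\<close> is not on \<open>p\<close>.\<close>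
      have Dsmall: "small E D"
      proof (rule ccontr)
        assume "\<not> small E D"
        then show False
        proof (cases rule: not_small_cases)
          case (1 s s')
          have *: False if st: "p = p1 @ s # m @ s' # p3" "E s (hd q)" "E s' (hd q)" "\<not> E s s'" for s s' p1 m p3
          proof -
            have mne: "m \<noteq> []" using p(1) st(4) unfolding st(1) by (auto simp: ipath_append)
            have i: "ipath E (p1 @ [s])" "ipath E (s' # p3)"
              using p(1) unfolding st(1) by (auto simp: ipath_append)
            let ?R = "(set (p1 @ [s]) \<union> set q) \<union> set (s' # p3)"
            have "conn E (set (p1 @ [s]) \<union> set q)"
              using conn_Un[OF conn_ipath[OF i(1)] qconn, of s "hd q"] st(2) qne by simp
            then have "conn E ?R"
              using conn_Un[OF _ conn_ipath[OF i(2)], of "set (p1 @ [s]) \<union> set q" "hd q" s'] sym[OF st(3)] qne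
              by simp
            moreover have "u \<in> ?R" "v \<in> ?R" using p(4,5) st(1) by (cases p1; cases p3; auto)+
            ultimately have "?R = R" using full[of ?R] Rpq st(1) qne by auto
            moreover have "hd m \<in> R" "hd m \<notin> ?R"
              using Rpq st(1) q(3) ipath_distinct[OF p(1)] hd_in_set[OF mne] by auto
            ultimately show False by blast
          qed
          have "s \<in> set p" "s' \<in> set p" using 1 by (auto simp: D_def)
          then obtain p1 p3 where pp: "p = p1 @ s # p3" by (meson split_list)
          show False
          proof (cases "s' \<in> set p3")
            case True
            then show False using *[of p1 s _ s'] 1 pp by (auto simp: D_def dest!: split_list)
          next
            case False
            then have "s' \<in> set p1" using 1 \<open>s' \<in> set p\<close> pp by auto
            then obtain m1 m2 where "p1 = m1 @ s' # m2" by (meson split_list)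
            then show False using *[of m1 s' m2 s p3] 1 pp sym[of s' s] by (auto simp: D_def)
          qed
        next
          case (2 a' b' d')
          then have "set (x # p @ [y]) = {a', b', d'}" using icycle_triangle[OF c2] by (auto simp: D_def)
          then have "x \<in> set p" using 2 by (auto simp: D_def)
          then show False using p2 by auto
        qed
      qed
      have yc: "E y s \<longleftrightarrow> s = v" "E x s \<longleftrightarrow> s = u" if "s \<in> R" for s using x y that by auto
      have notq: "u \<notin> set q" "v \<notin> set q" using uv q(3) by auto
      \<comment> \<open>The cycle is exchanged: the new one runs through \<open>x\<close>,
        \<open>p\<close> and \<open>y\<close>. The ear begins in \<open>z\<close>, which sees the
        edge \<open>x y\<close>, and ends in \<open>hd q\<close>, which sees
        \<open>D\<close>.\<close>
      let ?c = "x # p @ [y]" and ?r = "z # rev q"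
      have at1: "att E (set ?c) (set q) = D"
      proof -
        have "set q = insert (hd q) (set (tl q))" using qne by (cases q) auto
        then show ?thesis unfolding att_def D_def using yc notq Rpq ptq by auto
      qed
      have zp: "s \<in> set p \<Longrightarrow> \<not> E s z" for s using False sym by blast
      have at2: "att E (set ?c) (set (z # rev (tl q))) \<subseteq> {x, y}"
        unfolding att_def using yc notq Rpq ptq zp by auto
      have "ear E ?c ?r"
        unfolding ear_def
      proof (intro conjI)
        show "icycle E ?c" by fact
        show "ipath E ?r" using q(1) zq z disj Rpq qne by (auto simp: ipath_rev hd_rev)
        show "?r \<noteq> []" by simp
        show "set ?c \<inter> set ?r = {}" using z disj Rpq q(3) by auto
        have "x \<in> att E (set ?c) (set ?r)" "y \<in> att E (set ?c) (set ?r)"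
          using sym[OF zxy(1)] sym[OF zxy(2)] by (auto simp: att_def)
        moreover have "t \<in> att E (set ?c) (set ?r)" using t(2) sym[OF q(4)] qne by (auto simp: att_def)
        moreover have "t \<noteq> x" "t \<noteq> y" using t(2) disj Rpq x(1) y(1) by auto
        ultimately show "\<not> small E (att E (set ?c) (set ?r))" using not_small3 xy by metis
        show "small E (att E (set ?c) (set (tl ?r)))" using at1 Dsmall by simp
        have "butlast ?r = z # rev (tl q)" using qne by (cases q) auto
        then show "small E (att E (set ?c) (set (butlast ?r)))" using at2 zxy(3) unfolding small_def by metis
      qed
      moreover have "set ?c \<union> set ?r = set c \<union> R" using z Rpq by auto
      ultimately show ?thesis using ear_solid[of ?c ?r] by simp
    qed
  qed
qed

text \<open>If two attachments are nonadjacent, a path in \<open>R\<close> between neighbours of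
  them is already attached to more than an edge, so it is all of \<open>R\<close>. Otherwise there
  is a triangle of attachments, and it is the whole cycle.\<close>

lemma critical_solid:
  assumes c: "critical E c R" and fin: "finite R"
  shows "solid_set E (set c \<union> R)"
proof -
  have R: "conn E R" "\<not> small E (att E (set c) R)" using c by (auto simp: critical_def)
  from R(2) show ?thesis
  proof (cases rule: not_small_cases)
    case (1 x y)
    then obtain s t where st: "s \<in> R" "E x s" "t \<in> R" "E y t" by (auto simp: att_def)
    then obtain p where p: "ipath E p" "p \<noteq> []" "set p \<subseteq> R" "E x (hd p)" "E y (last p)"
      using conn_path[OF R(1), of s "{s. E x s}" t "{s. E y s}"] by (metis mem_Collect_eq)
    have "x \<in> att E (set c) (set p)" "y \<in> att E (set c) (set p)"
      using 1 p by (auto simp: att_def)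
    then have "\<not> small E (att E (set c) (set p))" using small_adj 1 by blast
    then have "R = set p" using c p conn_ipath[of p] unfolding critical_def by blast
    then show ?thesis using ear_of_critical[of c p] ear_solid[of c p] c p by simp
  next
    case (2 a b d)
    then have "set c = {a, b, d}"
      using icycle_triangle[of c a b d] c by (auto simp: critical_def att_def)
    then show ?thesis using critical_triangle[OF c fin] 2 by blast
  qed
qed

end

section \<open>Decompositions of a solid around a vertex\<close>

lemma ipath_map:
  assumes "inj_on g S" "\<And>x y. x \<in> S \<Longrightarrow> y \<in> S \<Longrightarrow> E (g x) (g y) \<longleftrightarrow> F x y" "set p \<subseteq> S"
  shows "ipath E (map g p) \<longleftrightarrow> ipath F p"
  using assms(3)
proof (induction p)
  case (Cons x p)
  have "g x \<in> g ` set p \<longleftrightarrow> x \<in> set p"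
    using Cons.prems assms(1) by (auto simp: inj_on_image_mem_iff)
  moreover have "p \<noteq> [] \<Longrightarrow> hd (map g p) = g (hd p) \<and> hd p \<in> set p" by (simp add: hd_map)
  moreover have "E (g x) (g y) \<longleftrightarrow> F x y" if "y \<in> set p" for y
    using that Cons.prems by (intro assms(2)) auto
  moreover have "g y = g (hd p) \<longleftrightarrow> y = hd p" if "y \<in> set p" for y
  proof -
    have "hd p \<in> set p" using that by (cases p) auto
    then show ?thesis using that Cons.prems inj_on_eq_iff[OF assms(1), of y "hd p"] by auto
  qed
  ultimately show ?case using Cons by (cases "p = []") auto
qed simp

lemma icycle_map:
  assumes "inj_on g S" "\<And>x y. x \<in> S \<Longrightarrow> y \<in> S \<Longrightarrow> E (g x) (g y) \<longleftrightarrow> F x y" "set c \<subseteq> S" "icycle F c"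
  shows "icycle E (map g c)"
proof -
  obtain z d where c: "c = z # d" using icycle_nonempty[OF assms(4)] by (cases c) auto
  have d: "z \<notin> set d" "ipath F d" "2 \<le> length d" "\<And>y. y \<in> set d \<Longrightarrow> F z y \<longleftrightarrow> y = hd d \<or> y = last d"
    using assms(4) by (auto simp: c icycle_Cons)
  have "d \<noteq> []" using d by auto
  then have hl: "hd (map g d) = g (hd d)" "last (map g d) = g (last d)" "hd d \<in> set d" "last d \<in> set d"
    by (auto simp: hd_map last_map)
  have sub: "set d \<subseteq> S" "z \<in> S" using assms(3) c by auto
  have "g y = g y' \<longleftrightarrow> y = y'" if "y \<in> set d" "y' \<in> set d" for y y'
    using that sub inj_on_eq_iff[OF assms(1), of y y'] by blast
  moreover have "E (g z) (g y) \<longleftrightarrow> F z y" if "y \<in> set d" for y using that sub assms(2) by blast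
  moreover have "g z \<notin> g ` set d" using sub d(1) assms(1) by (simp add: inj_on_image_mem_iff)
  ultimately show ?thesis
    using d hl ipath_map[of g S E F, OF assms(1,2) sub(1)] unfolding c by (simp add: icycle_Cons)
qed

lemma solid_setI:
  "ipyramid E c w \<Longrightarrow> S = insert w (set c) \<Longrightarrow> solid_set E S"
  "itrihedron E z y p q r \<Longrightarrow> S = {z, y} \<union> set p \<union> set q \<union> set r \<Longrightarrow> solid_set E S"
  "istamp E z p q r \<Longrightarrow> S = insert z (set p \<union> set q \<union> set r) \<Longrightarrow> solid_set E S"
  "iprism E p q r \<Longrightarrow> S = set p \<union> set q \<union> set r \<Longrightarrow> solid_set E S"
  unfolding solid_set_def by (iprover intro: disjI1 disjI2 exI conjI)+

lemma solid_setE: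
  assumes "solid_set E S"
  obtains (ipyramid) c w where "ipyramid E c w" "S = insert w (set c)"
    | (itrihedron) z y p q r where "itrihedron E z y p q r" "S = {z, y} \<union> set p \<union> set q \<union> set r"
    | (istamp) z p q r where "istamp E z p q r" "S = insert z (set p \<union> set q \<union> set r)"
    | (iprism) p q r where "iprism E p q r" "S = set p \<union> set q \<union> set r"
  using assms unfolding solid_set_def
  by (elim disjE exE conjE) (rule that; assumption)+

lemma solid_set_map:
  assumes inj: "inj_on g S" and e: "\<And>x y. x \<in> S \<Longrightarrow> y \<in> S \<Longrightarrow> E (g x) (g y) \<longleftrightarrow> F x y"
    and "solid_set F S"
  shows "solid_set E (g ` S)"
proof -
  have eq: "g x = g y \<longleftrightarrow> x = y" if "x \<in> S" "y \<in> S" for x y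
    using that inj_on_eq_iff[OF inj] by blast
  have im: "ipath E (map g p) \<longleftrightarrow> ipath F p" if "set p \<subseteq> S" for p
    using ipath_map[of g S E F, OF inj e that] by blast
  have arms: "arms E (map g p) (map g q) (map g r)"
    if "arms F p q r" "set p \<subseteq> S" "set q \<subseteq> S" "set r \<subseteq> S" for p q r
  proof -
    have "set (map g s) \<inter> set (map g t) = {}" if "set s \<inter> set t = {}" "set s \<subseteq> S" "set t \<subseteq> S" for s t
      using that eq by (auto simp: disjoint_iff subset_iff)
    then show ?thesis using that im unfolding arms_def by simp
  qed
  have hl: "hd (map g p) = g (hd p)" "last (map g p) = g (last p)" "hd p \<in> S" "last p \<in> S"
    if "p \<noteq> []" "set p \<subseteq> S" for p
    using that by (auto simp: hd_map last_map)
  have apex: "apex E (g z) (map g p)" if "apex F z p" "z \<in> S" "set p \<subseteq> S" "p \<noteq> []" for z p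
    unfolding apex_def
  proof
    show "g z \<notin> set (map g p)" using that eq by (auto simp: apex_def)
    show "\<forall>x \<in> set (map g p). E (g z) x = (x = hd (map g p))"
      using that hl[of p] eq e unfolding apex_def by (auto simp: subset_iff)
  qed
  from assms(3) show ?thesis
  proof (cases rule: solid_setE)
    case (ipyramid c w)
    have "E (g w) (g x) \<longleftrightarrow> F w x" if "x \<in> set c" for x using that ipyramid(2) by (intro e) auto
    then have "{x \<in> set (map g c). E (g w) x} = g ` {x \<in> set c. F w x}" by auto
    moreover have "card (g ` {x \<in> set c. F w x}) = card {x \<in> set c. F w x}"
      using ipyramid by (intro card_image inj_on_subset[OF inj]) auto
    moreover have "icycle E (map g c)" using icycle_map[of g S E F c, OF inj e] ipyramid by (auto simp: ipyramid_def)
    moreover have "g w \<notin> set (map g c)" using ipyramid eq by (auto simp: ipyramid_def)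
    ultimately have "ipyramid E (map g c) (g w)" using ipyramid by (auto simp: ipyramid_def)
    then show ?thesis by (rule solid_setI) (use ipyramid in auto)
  next
    case (itrihedron z y p q r)
    then have sub: "set p \<subseteq> S" "set q \<subseteq> S" "set r \<subseteq> S" "z \<in> S" "y \<in> S" by auto
    have ne: "p \<noteq> []" "q \<noteq> []" "r \<noteq> []" using itrihedron by (auto simp: itrihedron_def arms_def)
    have "itrihedron E (g z) (g y) (map g p) (map g q) (map g r)"
    proof -
      have anti: "\<forall>x \<in> set (map g p). \<forall>x' \<in> set (map g q). \<not> E x x'"
        if "\<forall>x \<in> set p. \<forall>x' \<in> set q. \<not> F x x'" "set p \<subseteq> S" "set q \<subseteq> S" for p q
        using that e by (auto simp: subset_iff)
      have t: "apex F z p" "apex F z q" "apex F z r"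
        "apex F y (rev p)" "apex F y (rev q)" "apex F y (rev r)" "arms F p q r"
        "\<forall>x \<in> set p. \<forall>x' \<in> set q. \<not> F x x'" "\<forall>x \<in> set p. \<forall>x' \<in> set r. \<not> F x x'"
        "\<forall>x \<in> set q. \<forall>x' \<in> set r. \<not> F x x'"
        using itrihedron(1) unfolding itrihedron_def by argo+
      have "z \<noteq> y" "\<not> F z y" using itrihedron(1) by (simp_all add: itrihedron_def)
      then have n: "g z \<noteq> g y" "\<not> E (g z) (g y)" using eq[OF sub(4,5)] e[OF sub(4,5)] by simp_all
      have ar: "apex E (g y) (rev (map g p))" if "apex F y (rev p)" "set p \<subseteq> S" "p \<noteq> []" for p
        using apex[of y "rev p"] that sub by (simp add: rev_map)
      show ?thesis
        unfolding itrihedron_def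
        using apex[OF t(1) sub(4,1) ne(1)] apex[OF t(2) sub(4,2) ne(2)] apex[OF t(3) sub(4,3) ne(3)]
          ar[OF t(4) sub(1) ne(1)] ar[OF t(5) sub(2) ne(2)] ar[OF t(6) sub(3) ne(3)]
          n arms[OF t(7) sub(1-3)] anti[OF t(8) sub(1,2)] anti[OF t(9) sub(1,3)]
          anti[OF t(10) sub(2,3)] by (intro conjI) assumption+
    qed
    moreover have "g ` S = {g z, g y} \<union> set (map g p) \<union> set (map g q) \<union> set (map g r)"
      using itrihedron(2) by auto
    ultimately show ?thesis by (rule solid_setI)
  next
    case (istamp z p q r)
    then have sub: "set p \<subseteq> S" "set q \<subseteq> S" "set r \<subseteq> S" "z \<in> S" by auto
    have ne: "p \<noteq> []" "q \<noteq> []" "r \<noteq> []" using istamp by (auto simp: istamp_def arms_def)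
    have "istamp E (g z) (map g p) (map g q) (map g r)"
    proof -
      have cross: "\<forall>x \<in> set (map g p). \<forall>x' \<in> set (map g q). E x x' \<longleftrightarrow> x = last (map g p) \<and> x' = last (map g q)"
        if "\<forall>x \<in> set p. \<forall>x' \<in> set q. F x x' \<longleftrightarrow> x = last p \<and> x' = last q" "set p \<subseteq> S" "set q \<subseteq> S"
          "p \<noteq> []" "q \<noteq> []" for p q
        using that(1) hl[OF that(4,2)] hl[OF that(5,3)] e eq that(2,3) by (auto simp: subset_iff)
      have t: "apex F z p" "apex F z q" "apex F z r" "arms F p q r"
        "\<forall>x \<in> set p. \<forall>x' \<in> set q. F x x' \<longleftrightarrow> x = last p \<and> x' = last q"
        "\<forall>x \<in> set p. \<forall>x' \<in> set r. F x x' \<longleftrightarrow> x = last p \<and> x' = last r"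
        "\<forall>x \<in> set q. \<forall>x' \<in> set r. F x x' \<longleftrightarrow> x = last q \<and> x' = last r"
        using istamp(1) unfolding istamp_def by argo+
      show ?thesis
        unfolding istamp_def
        using apex[OF t(1) sub(4,1) ne(1)] apex[OF t(2) sub(4,2) ne(2)] apex[OF t(3) sub(4,3) ne(3)]
          arms[OF t(4) sub(1-3)] cross[OF t(5) sub(1,2) ne(1,2)] cross[OF t(6) sub(1,3) ne(1,3)]
          cross[OF t(7) sub(2,3) ne(2,3)] by (intro conjI) assumption+
    qed
    moreover have "g ` S = insert (g z) (set (map g p) \<union> set (map g q) \<union> set (map g r))"
      using istamp(2) by auto
    ultimately show ?thesis by (rule solid_setI)
  next
    case (iprism p q r)
    then have sub: "set p \<subseteq> S" "set q \<subseteq> S" "set r \<subseteq> S" by auto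
    have ne: "p \<noteq> []" "q \<noteq> []" "r \<noteq> []" using iprism by (auto simp: iprism_def arms_def)
    have "iprism E (map g p) (map g q) (map g r)"
    proof -
      have cross: "\<forall>x \<in> set (map g p). \<forall>x' \<in> set (map g q).
          E x x' \<longleftrightarrow> x = hd (map g p) \<and> x' = hd (map g q) \<or> x = last (map g p) \<and> x' = last (map g q)"
        if "\<forall>x \<in> set p. \<forall>x' \<in> set q. F x x' \<longleftrightarrow> x = hd p \<and> x' = hd q \<or> x = last p \<and> x' = last q"
          "set p \<subseteq> S" "set q \<subseteq> S" "p \<noteq> []" "q \<noteq> []" for p q
        using that(1) hl[OF that(4,2)] hl[OF that(5,3)] e eq that(2,3) by (auto simp: subset_iff)
      have t: "arms F p q r" "hd p \<noteq> last p" "hd q \<noteq> last q" "hd r \<noteq> last r"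
        "\<forall>x \<in> set p. \<forall>x' \<in> set q. F x x' \<longleftrightarrow> x = hd p \<and> x' = hd q \<or> x = last p \<and> x' = last q"
        "\<forall>x \<in> set p. \<forall>x' \<in> set r. F x x' \<longleftrightarrow> x = hd p \<and> x' = hd r \<or> x = last p \<and> x' = last r"
        "\<forall>x \<in> set q. \<forall>x' \<in> set r. F x x' \<longleftrightarrow> x = hd q \<and> x' = hd r \<or> x = last q \<and> x' = last r"
        using iprism(1) unfolding iprism_def by argo+
      have "hd (map g p) \<noteq> last (map g p)" if "hd p \<noteq> last p" "p \<noteq> []" "set p \<subseteq> S" for p
        using hl[OF that(2,3)] that(1) eq by simp
      then show ?thesis
        unfolding iprism_def
        using t sub ne arms[OF t(1) sub(1-3)] cross[OF t(5) sub(1,2) ne(1,2)] cross[OF t(6) sub(1,3) ne(1,3)]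
          cross[OF t(7) sub(2,3) ne(2,3)] by (intro conjI) (assumption | blast)+
    qed
    moreover have "g ` S = set (map g p) \<union> set (map g q) \<union> set (map g r)"
      using iprism(2) by auto
    ultimately show ?thesis by (rule solid_setI)
  qed
qed

section \<open>Reading a solid as a cycle with an ear\<close>

lemma att_tl:
  assumes "distinct p" "\<And>x s. x \<in> C \<Longrightarrow> s \<in> set p \<Longrightarrow> s \<noteq> hd p \<Longrightarrow> E x s \<Longrightarrow> x \<in> A"
  shows "att E C (set (tl p)) \<subseteq> A"
  using assms by (cases p) (auto simp: att_def)

lemma att_butlast:
  assumes "distinct p" "\<And>x s. x \<in> C \<Longrightarrow> s \<in> set p \<Longrightarrow> s \<noteq> last p \<Longrightarrow> E x s \<Longrightarrow> x \<in> A"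
  shows "att E C (set (butlast p)) \<subseteq> A"
  using assms by (cases p rule: rev_cases) (auto simp: att_def)

context ugraph
begin

lemma itrihedron_rev: "itrihedron E z y p q r \<Longrightarrow> itrihedron E y z (rev p) (rev q) (rev r)"
  unfolding itrihedron_def arms_def by (auto simp: ipath_rev sym_iff[of y])

lemma arms_perm: "arms E p q r \<Longrightarrow> arms E q p r" "arms E p q r \<Longrightarrow> arms E p r q"
  by (simp_all add: arms_def Int_commute)

lemma itrihedron_perm: 
  assumes "itrihedron E z y p q r"
  shows "itrihedron E z y q p r" "itrihedron E z y p r q"
proof -
  from assms have t: "arms E p q r" "\<forall>x \<in> set p. \<forall>x' \<in> set q. \<not> E x x'" "\<forall>x \<in> set q. \<forall>x' \<in> set r. \<not> E x x'"
    unfolding itrihedron_def by argo+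
  have "\<forall>x \<in> set q. \<forall>x' \<in> set p. \<not> E x x'" using t(2) sym by blast
  then show "itrihedron E z y q p r"
    using assms arms_perm(1)[OF t(1)] unfolding itrihedron_def by argo
  have "\<forall>x \<in> set r. \<forall>x' \<in> set q. \<not> E x x'" using t(3) sym by blast
  then show "itrihedron E z y p r q"
    using assms arms_perm(2)[OF t(1)] unfolding itrihedron_def by argo
qed

lemma istamp_perm:
  assumes "istamp E z p q r"
  shows "istamp E z q p r" "istamp E z p r q"
proof -
  from assms have t: "arms E p q r" "\<forall>x \<in> set p. \<forall>x' \<in> set q. E x x' \<longleftrightarrow> x = last p \<and> x' = last q"
    "\<forall>x \<in> set q. \<forall>x' \<in> set r. E x x' \<longleftrightarrow> x = last q \<and> x' = last r"
    unfolding istamp_def by argo+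
  have "\<forall>x \<in> set q. \<forall>x' \<in> set p. E x x' \<longleftrightarrow> x = last q \<and> x' = last p" using t(2) sym by blast
  then show "istamp E z q p r"
    using assms arms_perm(1)[OF t(1)] unfolding istamp_def by argo
  have "\<forall>x \<in> set r. \<forall>x' \<in> set q. E x x' \<longleftrightarrow> x = last r \<and> x' = last q" using t(3) sym by blast
  then show "istamp E z p r q"
    using assms arms_perm(2)[OF t(1)] unfolding istamp_def by argo
qed

lemma iprism_perm:
  assumes "iprism E p q r"
  shows "iprism E q p r" "iprism E p r q"
proof -
  from assms have t: "arms E p q r"
    "\<forall>x \<in> set p. \<forall>x' \<in> set q. E x x' \<longleftrightarrow> x = hd p \<and> x' = hd q \<or> x = last p \<and> x' = last q"
    "\<forall>x \<in> set q. \<forall>x' \<in> set r. E x x' \<longleftrightarrow> x = hd q \<and> x' = hd r \<or> x = last q \<and> x' = last r"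
    unfolding iprism_def by argo+
  have "\<forall>x \<in> set q. \<forall>x' \<in> set p. E x x' \<longleftrightarrow> x = hd q \<and> x' = hd p \<or> x = last q \<and> x' = last p"
    using t(2) sym by blast
  then show "iprism E q p r"
    using assms arms_perm(1)[OF t(1)] unfolding iprism_def by argo
  have "\<forall>x \<in> set r. \<forall>x' \<in> set q. E x x' \<longleftrightarrow> x = hd r \<and> x' = hd q \<or> x = last r \<and> x' = last q"
    using t(3) sym by blast
  then show "iprism E p r q"
    using assms arms_perm(2)[OF t(1)] unfolding iprism_def by argo
qed

lemma earI:
  assumes "icycle E c" "ipath E r" "r \<noteq> []" "set c \<inter> set r = {}" "\<not> small E A" "A \<subseteq> att E (set c) (set r)"
    "att E (set c) (set (tl r)) \<subseteq> {x, y}" "x = y \<or> E x y"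
    "att E (set c) (set (butlast r)) \<subseteq> {x', y'}" "x' = y' \<or> E x' y'"
  shows "ear E c r"
  unfolding ear_def using assms small_mono[of E] unfolding small_def[of E "att _ _ _"] 
  by (metis small_def)

text \<open>A converse to \<open>itrihedron_of_ear\<close>: the ear sees the cycle only in the
  nonadjacent branch vertices, one from each end. By the permutation lemmas each of the three paths
  can be the ear.\<close>

lemma itrihedron_ear:
  assumes "itrihedron E z y p q r"
  shows "ear E (z # q @ y # rev r) p"
proof -
  have t: "ipath E p" "ipath E q" "ipath E r" "p \<noteq> []" "q \<noteq> []" "r \<noteq> []"
    "set p \<inter> set q = {}" "set p \<inter> set r = {}" "set q \<inter> set r = {}" "z \<noteq> y" "\<not> E z y"
    "z \<notin> set p" "z \<notin> set q" "z \<notin> set r" "y \<notin> set p" "y \<notin> set q" "y \<notin> set r"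
    and zp: "\<And>x. x \<in> set p \<Longrightarrow> E z x \<longleftrightarrow> x = hd p"
    and zq: "\<And>x. x \<in> set q \<Longrightarrow> E z x \<longleftrightarrow> x = hd q"
    and zr: "\<And>x. x \<in> set r \<Longrightarrow> E z x \<longleftrightarrow> x = hd r"
    and yp: "\<And>x. x \<in> set p \<Longrightarrow> E y x \<longleftrightarrow> x = last p"
    and yq: "\<And>x. x \<in> set q \<Longrightarrow> E y x \<longleftrightarrow> x = last q"
    and yr: "\<And>x. x \<in> set r \<Longrightarrow> E y x \<longleftrightarrow> x = last r"
    and pq: "\<And>x x'. x \<in> set p \<Longrightarrow> x' \<in> set q \<Longrightarrow> \<not> E x x'"
    and pr: "\<And>x x'. x \<in> set p \<Longrightarrow> x' \<in> set r \<Longrightarrow> \<not> E x x'"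
    and qr: "\<And>x x'. x \<in> set q \<Longrightarrow> x' \<in> set r \<Longrightarrow> \<not> E x x'"
    using assms unfolding itrihedron_def arms_def apex_def by (auto simp: hd_rev)
  have d: "distinct p" using t(1) ipath_distinct by blast
  have hl: "hd p \<in> set p" "last p \<in> set p" using t by auto
  have "ipath E (y # rev r)" using t yr by (simp add: ipath_rev hd_rev)
  moreover have "\<forall>x \<in> set q. \<forall>x' \<in> set (y # rev r). E x x' \<longleftrightarrow> x = last q \<and> x' = y"
    using yq sym_iff[of _ y] qr t by auto
  ultimately have "ipath E (q @ y # rev r)"
    unfolding ipath_append using t by auto
  then have c: "icycle E (z # q @ y # rev r)"
    using t zq zr by (auto simp: icycle_Cons last_rev Suc_le_eq)
  have nc: "x = z \<and> s = hd p \<or> x = y \<and> s = last p" if "x \<in> set (z # q @ y # rev r)" "s \<in> set p" "E x s" for x s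
    using that zp[of s] yp[of s] pq[of s x] pr[of s x] sym by auto
  show ?thesis
  proof (rule earI[OF c t(1,4), of "{z, y}" y y z z])
    show "set (z # q @ y # rev r) \<inter> set p = {}" using t by auto
    show "\<not> small E {z, y}" using small_adj[of "{z, y}" z y] t by auto
    show "{z, y} \<subseteq> att E (set (z # q @ y # rev r)) (set p)" using zp yp hl by (auto simp: att_def)
    show "att E (set (z # q @ y # rev r)) (set (tl p)) \<subseteq> {y, y}"
      using nc by (intro att_tl[OF d]) blast
    show "att E (set (z # q @ y # rev r)) (set (butlast p)) \<subseteq> {z, z}"
      using nc by (intro att_butlast[OF d]) blast
  qed auto
qed

lemma istamp_ear:
  assumes "istamp E z p q r"
  shows "ear E (z # q @ rev r) p"
proof -
  have t: "ipath E p" "ipath E q" "ipath E r" "p \<noteq> []" "q \<noteq> []" "r \<noteq> []"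
    "set p \<inter> set q = {}" "set p \<inter> set r = {}" "set q \<inter> set r = {}"
    "z \<notin> set p" "z \<notin> set q" "z \<notin> set r"
    and zp: "\<And>x. x \<in> set p \<Longrightarrow> E z x \<longleftrightarrow> x = hd p"
    and zq: "\<And>x. x \<in> set q \<Longrightarrow> E z x \<longleftrightarrow> x = hd q"
    and zr: "\<And>x. x \<in> set r \<Longrightarrow> E z x \<longleftrightarrow> x = hd r"
    and pq: "\<And>x x'. x \<in> set p \<Longrightarrow> x' \<in> set q \<Longrightarrow> E x x' \<longleftrightarrow> x = last p \<and> x' = last q"
    and pr: "\<And>x x'. x \<in> set p \<Longrightarrow> x' \<in> set r \<Longrightarrow> E x x' \<longleftrightarrow> x = last p \<and> x' = last r"
    and qr: "\<And>x x'. x \<in> set q \<Longrightarrow> x' \<in> set r \<Longrightarrow> E x x' \<longleftrightarrow> x = last q \<and> x' = last r"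
    using assms unfolding istamp_def arms_def apex_def by auto
  have d: "distinct p" using t(1) ipath_distinct by blast
  have hl: "hd p \<in> set p" "last p \<in> set p" "last q \<in> set q" "last r \<in> set r" using t by auto
  have i: "ipath E (q @ rev r)"
    unfolding ipath_append using t qr by (auto simp: ipath_rev hd_rev)
  then have c: "icycle E (z # q @ rev r)"
    using t zq zr by (auto simp: icycle_Cons last_rev Suc_le_eq neq_Nil_conv)
  have nc: "x = z \<and> s = hd p \<or> x \<in> {last q, last r} \<and> s = last p"
    if "x \<in> set (z # q @ rev r)" "s \<in> set p" "E x s" for x s
    using that zp pq[of s x] pr[of s x] sym by auto
  show ?thesis
  proof (rule earI[OF c t(1,4), of "{z, last q, last r}" "last q" "last r" z z])
    show "set (z # q @ rev r) \<inter> set p = {}" using t by auto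
    show "\<not> small E {z, last q, last r}"
      using hl t(9,11,12) by (intro not_small3[of z _ "last q" "last r"]) (auto simp: disjoint_iff)
    show "{z, last q, last r} \<subseteq> att E (set (z # q @ rev r)) (set p)"
      using zp[of "hd p"] pq[of "last p" "last q"] pr[of "last p" "last r"] hl sym by (auto simp: att_def)
    show "att E (set (z # q @ rev r)) (set (tl p)) \<subseteq> {last q, last r}"
      using nc by (intro att_tl[OF d]) blast
    show "att E (set (z # q @ rev r)) (set (butlast p)) \<subseteq> {z, z}"
      using nc by (intro att_butlast[OF d]) blast
    show "last q = last r \<or> E (last q) (last r)" using qr hl by blast
  qed auto
qed

lemma iprism_ear:
  assumes "iprism E p q r"
  shows "ear E (q @ rev r) p"
proof -
  have t: "ipath E p" "ipath E q" "ipath E r" "p \<noteq> []" "q \<noteq> []" "r \<noteq> []"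
    "set p \<inter> set q = {}" "set p \<inter> set r = {}" "set q \<inter> set r = {}"
    "hd p \<noteq> last p" "hd q \<noteq> last q" "hd r \<noteq> last r"
    and pq: "\<And>x x'. x \<in> set p \<Longrightarrow> x' \<in> set q \<Longrightarrow> E x x' \<longleftrightarrow> x = hd p \<and> x' = hd q \<or> x = last p \<and> x' = last q"
    and pr: "\<And>x x'. x \<in> set p \<Longrightarrow> x' \<in> set r \<Longrightarrow> E x x' \<longleftrightarrow> x = hd p \<and> x' = hd r \<or> x = last p \<and> x' = last r"
    and qr: "\<And>x x'. x \<in> set q \<Longrightarrow> x' \<in> set r \<Longrightarrow> E x x' \<longleftrightarrow> x = hd q \<and> x' = hd r \<or> x = last q \<and> x' = last r"
    using assms unfolding iprism_def arms_def by auto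
  have d: "distinct p" using t(1) ipath_distinct by blast
  have hl: "hd p \<in> set p" "last p \<in> set p" "last q \<in> set q" "last r \<in> set r" "hd q \<in> set q" "hd r \<in> set r"
    using t by auto
  have len: "2 \<le> length q" using t(5,11) by (cases q) (auto simp: Suc_le_eq)
  have c: "icycle E (q @ rev r)"
    using t qr len by (subst icycle_append) (auto simp: ipath_rev hd_rev last_rev neq_Nil_conv)
  have nc: "x \<in> {hd q, hd r} \<and> s = hd p \<or> x \<in> {last q, last r} \<and> s = last p"
    if "x \<in> set (q @ rev r)" "s \<in> set p" "E x s" for x s
    using that pq[of s x] pr[of s x] sym by auto
  show ?thesis
  proof (rule earI[OF c t(1,4), of "{hd q, last q, last r}" "last q" "last r" "hd q" "hd r"])
    show "set (q @ rev r) \<inter> set p = {}" using t by auto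
    show "\<not> small E {hd q, last q, last r}"
      using hl t(9,11) by (intro not_small3[of "hd q" _ "last q" "last r"]) (auto simp: disjoint_iff)
    show "{hd q, last q, last r} \<subseteq> att E (set (q @ rev r)) (set p)"
      using pq[of "hd p" "hd q"] pq[of "last p" "last q"] pr[of "last p" "last r"] hl sym by (auto simp: att_def)
    show "att E (set (q @ rev r)) (set (tl p)) \<subseteq> {last q, last r}"
      using nc by (intro att_tl[OF d]) blast
    show "att E (set (q @ rev r)) (set (butlast p)) \<subseteq> {hd q, hd r}"
      using nc by (intro att_butlast[OF d]) blast
    show "last q = last r \<or> E (last q) (last r)" "hd q = hd r \<or> E (hd q) (hd r)" using qr hl by blast+
  qed
qed

text \<open>A pyramid whose rim passes through \<open>z\<close>: the new cycle runs through the apex and a sector of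
  the rim that avoids \<open>z\<close>.\<close>
lemma ipyramid_ear:
  assumes "ipyramid E c w" "z \<in> set c"
  obtains c' r where "ear E c' r" "z \<in> set r" "insert w (set c) = set c' \<union> set r"
proof -
  let ?N = "{x \<in> set c. E w x}"
  have w: "w \<notin> set c" "icycle E c" "3 \<le> card ?N" using assms by (auto simp: ipyramid_def)
  obtain d where d: "icycle E (z # d)" "set c = insert z (set d)"
    using icycle_rotate_to w assms(2) by metis
  \<comment> \<open>Two vertices never exhaust the at least three neighbours of \<open>w\<close> on
    the rim.\<close>
  have big: "\<exists>s \<in> ?N. s \<noteq> x \<and> s \<noteq> y" for x y
  proof (rule ccontr)
    assume "\<not> (\<exists>s \<in> ?N. s \<noteq> x \<and> s \<noteq> y)"
    then have "?N \<subseteq> {x, y}" by blast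
    then have "card ?N \<le> card {x, y}" by (intro card_mono) auto
    also have "\<dots> \<le> 2" by (simp add: card_insert_if)
    finally show False using w(3) by simp
  qed
  \<comment> \<open>The vertices \<open>a\<close> and \<open>b\<close> are the first two neighbours
    of \<open>w\<close> met on the rim after \<open>z\<close>. The sector between them contains no
    further neighbour of \<open>w\<close>.\<close>
  have "\<exists>x \<in> set d. E w x" using big[of z z] d(2) by auto
  then obtain d1 a d' where d1: "d = d1 @ a # d'" "E w a" "\<forall>t \<in> set d1. \<not> E w t"
    using split_list_first_prop[of d "E w"] by blast
  have "\<exists>x \<in> set d'. E w x" using big[of z a] d(2) d1 by auto
  then obtain m b d2 where m: "d' = m @ b # d2" "E w b" "\<forall>t \<in> set m. \<not> E w t"
    using split_list_first_prop[of d' "E w"] by blast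
  define Q R where "Q = a # m @ [b]" and "R = d2 @ z # d1"
  have dd: "d = d1 @ Q @ d2" using d1 m by (simp add: Q_def)
  have "icycle E (Q @ R)" using d(1) icycle_rotate[of "z # d1" "Q @ d2"] unfolding dd R_def by simp
  moreover have ne: "Q \<noteq> []" "R \<noteq> []" by (auto simp: Q_def R_def)
  moreover have "hd Q = a" "last Q = b" by (auto simp: Q_def)
  ultimately have QR: "ipath E Q" "ipath E R" "set Q \<inter> set R = {}"
    and x: "\<And>x y. x \<in> set Q \<Longrightarrow> y \<in> set R \<Longrightarrow> E x y \<longleftrightarrow> x = b \<and> y = hd R \<or> x = a \<and> y = last R"
    using icycle_append[OF ne] by auto
  have cQR: "set c = set Q \<union> set R" using d(2) dd by (auto simp: R_def)
  have wQ: "E w s \<longleftrightarrow> s = a \<or> s = b" if "s \<in> set Q" for s using that d1(2) m(2,3) by (auto simp: Q_def)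
  have ab: "a \<noteq> b" "a \<in> set Q" "b \<in> set Q" using ipath_distinct[OF QR(1)] by (auto simp: Q_def)
  have dR: "distinct R" using QR(2) ipath_distinct by blast
  have c': "icycle E (w # Q)"
    unfolding icycle_Cons using QR(1) w(1) cQR wQ by (auto simp: Q_def)
  \<comment> \<open>A third neighbour of \<open>w\<close>, possibly \<open>z\<close> itself, lies on
    the remaining arc; so this arc sees \<open>w\<close> besides \<open>a\<close> and
    \<open>b\<close>.\<close>
  obtain s where s: "s \<in> set R" "E w s" using big[of a b] cQR wQ by auto
  have nc: "x = w \<or> x = b \<and> y = hd R \<or> x = a \<and> y = last R"
    if "x \<in> set (w # Q)" "y \<in> set R" "E x y" for x y
    using that x by auto
  have "ear E (w # Q) R"
  proof (rule earI[OF c' QR(2) ne(2), of "{w, a, b}" a w b w])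
    show "set (w # Q) \<inter> set R = {}" using w(1) cQR QR(3) by auto
    show "\<not> small E {w, a, b}" using ab w(1) cQR by (intro not_small3[of w _ a b]) auto
    show "{w, a, b} \<subseteq> att E (set (w # Q)) (set R)"
      using s ab x[of b "hd R"] x[of a "last R"] ne by (auto simp: att_def)
    show "att E (set (w # Q)) (set (tl R)) \<subseteq> {a, w}"
      using nc by (intro att_tl[OF dR]) blast
    show "att E (set (w # Q)) (set (butlast R)) \<subseteq> {b, w}"
      using nc by (intro att_butlast[OF dR]) blast
    show "a = w \<or> E a w" "b = w \<or> E b w" using d1(2) m(2) sym by blast+
  qed
  then show thesis using that[of "w # Q" R] cQR by (auto simp: R_def)
qed

lemma ipyramid_apex_ear: "ipyramid E c w \<Longrightarrow> ear E c [w]"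
proof -
  assume p: "ipyramid E c w"
  let ?N = "{x \<in> set c. E w x}"
  have N: "att E (set c) {w} = ?N" using sym by (auto simp: att_def)
  have "\<not> small E ?N"
  proof
    assume "small E ?N"
    then obtain x y where "?N \<subseteq> {x, y}" unfolding small_def by blast
    then have "card ?N \<le> card {x, y}" by (intro card_mono) auto
    also have "\<dots> \<le> 2" by (simp add: card_insert_if)
    finally show False using p by (simp add: ipyramid_def)
  qed
  then show ?thesis using p N by (auto simp: ear_def ipyramid_def att_def small_empty)
qed

text \<open>In trihedra, stamps and prisms a vertex of one of the paths has that path as ear, the
  other two being closed to the cycle. The last two cases are the branch vertices and the apex;
  reversing the paths of a trihedron lets \<open>z\<close> be the first branch vertex.\<close>

lemma solid_set_split:
  assumes "solid_set E S" "z \<in> S"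
  obtains (ear) c r where "ear E c r" "z \<in> set r" "S = set c \<union> set r"
  | (itrihedron) y p q r where "itrihedron E z y p q r" "S = {z, y} \<union> set p \<union> set q \<union> set r"
  | (istamp) p q r where "istamp E z p q r" "S = insert z (set p \<union> set q \<union> set r)"
proof -
  from assms(1) show thesis
  proof (cases rule: solid_setE)
    case (ipyramid c w)
    show thesis
    proof (cases "z = w")
      case True
      then show thesis using ear[of c "[w]"] ipyramid_apex_ear ipyramid by auto
    next
      case False
      then show thesis using ipyramid_ear[OF ipyramid(1), of z] ear ipyramid assms(2) by auto
    qed
  next
    case t: (itrihedron x y p q r)
    have *: thesis if "z \<in> set p" "itrihedron E x y p q r" "S = {x, y} \<union> set p \<union> set q \<union> set r" for p q r
      using ear[OF itrihedron_ear[OF that(2)] that(1)] that(3) by auto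
    consider "z = x" | "z = y" | "z \<in> set p" | "z \<in> set q" | "z \<in> set r" using assms(2) t(2) by auto
    then show thesis
    proof cases
      case 1
      then show thesis using itrihedron t by blast
    next
      case 2
      then show thesis using itrihedron[OF itrihedron_rev[OF t(1), folded 2]] t(2) by auto
    next
      case 3
      show thesis by (rule *[OF 3 t])
    next
      case 4
      show thesis using t(2) by (intro *[OF 4 itrihedron_perm(1)[OF t(1)]]) auto
    next
      case 5
      show thesis using t(2) by (intro *[OF 5 itrihedron_perm(1)[OF itrihedron_perm(2)[OF t(1)]]]) auto
    qed
  next
    case t: (istamp x p q r)
    have *: thesis if "z \<in> set p" "istamp E x p q r" "S = insert x (set p \<union> set q \<union> set r)" for p q r
      using ear[OF istamp_ear[OF that(2)] that(1)] that(3) by auto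
    consider "z = x" | "z \<in> set p" | "z \<in> set q" | "z \<in> set r" using assms(2) t(2) by auto
    then show thesis
    proof cases
      case 1
      then show thesis using istamp t by blast
    next
      case 2
      show thesis by (rule *[OF 2 t])
    next
      case 3
      show thesis using t(2) by (intro *[OF 3 istamp_perm(1)[OF t(1)]]) auto
    next
      case 4
      show thesis using t(2) by (intro *[OF 4 istamp_perm(1)[OF istamp_perm(2)[OF t(1)]]]) auto
    qed
  next
    case t: (iprism p q r)
    have *: thesis if "z \<in> set p" "iprism E p q r" "S = set p \<union> set q \<union> set r" for p q r
      using ear[OF iprism_ear[OF that(2)] that(1)] that(3) by auto
    consider "z \<in> set p" | "z \<in> set q" | "z \<in> set r" using assms(2) t(2) by auto
    then show thesis
    proof cases
      case 1
      show thesis by (rule *[OF 1 t])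
    next
      case 2
      show thesis using t(2) by (intro *[OF 2 iprism_perm(1)[OF t(1)]]) auto
    next
      case 3
      show thesis using t(2) by (intro *[OF 3 iprism_perm(1)[OF iprism_perm(2)[OF t(1)]]]) auto
    qed
  qed
qed

end

section \<open>Contractions\<close>

text \<open>The edge \<open>uv\<close> is contracted to \<open>u\<close>. As a vertex, \<open>v\<close> remains and has to be excluded.\<close>
definition contr :: "('a \<Rightarrow> 'a \<Rightarrow> bool) \<Rightarrow> 'a \<Rightarrow> 'a \<Rightarrow> 'a \<Rightarrow> 'a \<Rightarrow> bool" where
  "contr E u v x y \<longleftrightarrow> x \<noteq> y \<and> (E x y \<or> x = u \<and> E v y \<or> y = u \<and> E x v)"

context ugraph
begin

lemma ugraph_contr: "ugraph (contr E u v)"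
  unfolding contr_def by unfold_locales (auto simp: sym_iff[of _ v] intro: sym)

lemma contr_eq: "x \<noteq> u \<Longrightarrow> y \<noteq> u \<Longrightarrow> contr E u v x y \<longleftrightarrow> E x y"
  unfolding contr_def using irrefl by auto

lemma contr_u: "x \<noteq> u \<Longrightarrow> contr E u v u x \<longleftrightarrow> E u x \<or> E v x"
  unfolding contr_def by auto

lemma ipath_contr: "u \<notin> set p \<Longrightarrow> ipath (contr E u v) p \<longleftrightarrow> ipath E p"
  using ipath_map[of id "set p" E "contr E u v" p] contr_eq by (metis inj_on_id id_apply list.map_id order_refl)

lemma icycle_contr: "u \<notin> set c \<Longrightarrow> icycle (contr E u v) c \<Longrightarrow> icycle E c"
  using icycle_map[of id "set c" E "contr E u v" c] contr_eq by (metis inj_on_id id_apply list.map_id order_refl)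

text \<open>Split \<open>u\<close> back into \<open>u\<close> and \<open>v\<close>, where
  \<open>p\<close> starts only at \<open>u\<close> and \<open>q\<close> only at \<open>v\<close>. If
  both see \<open>hd r\<close>, then \<open>u\<close>, \<open>v\<close>, \<open>hd r\<close> is the
  triangle of a stamp with apex \<open>y\<close>. If only one does, it is the new branch vertex and
  the other prolongs its own path.\<close>

lemma itrihedron_contr:
  assumes uv: "E u v" and t: "itrihedron (contr E u v) u y p q r" and v: "v \<notin> {u, y} \<union> set p \<union> set q \<union> set r"
    and n: "\<not> E v (hd p)" "\<not> E u (hd q)"
  shows "solid_set E (insert v ({u, y} \<union> set p \<union> set q \<union> set r))"
proof -
  let ?F = "contr E u v"
  have o: "arms ?F p q r" "u \<noteq> y" "\<not> ?F u y" "apex ?F u p" "apex ?F u q" "apex ?F u r"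
    "apex ?F y (rev p)" "apex ?F y (rev q)" "apex ?F y (rev r)"
    "\<forall>x \<in> set p. \<forall>x' \<in> set q. \<not> ?F x x'" "\<forall>x \<in> set p. \<forall>x' \<in> set r. \<not> ?F x x'"
    "\<forall>x \<in> set q. \<forall>x' \<in> set r. \<not> ?F x x'"
    using t unfolding itrihedron_def by blast+
  have uo: "u \<notin> set p" "u \<notin> set q" "u \<notin> set r" using o(4-6) by (auto simp: apex_def)
  have vo: "v \<noteq> u" "v \<noteq> y" "v \<notin> set p" "v \<notin> set q" "v \<notin> set r" using v by auto
  have yo: "y \<notin> set p" "y \<notin> set q" "y \<notin> set r" using o(7-9) by (auto simp: apex_def)
  have a: "ipath E p" "ipath E q" "ipath E r" "p \<noteq> []" "q \<noteq> []" "r \<noteq> []"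
    "set p \<inter> set q = {}" "set p \<inter> set r = {}" "set q \<inter> set r = {}"
    using o(1) uo ipath_contr by (auto simp: arms_def)
  have hl: "hd p \<in> set p" "hd q \<in> set q" "hd r \<in> set r" using a by auto
  have p: "E u x \<longleftrightarrow> x = hd p" "\<not> E v x" if "x \<in> set p" for x
    using that o(4) n(1) uo contr_u[of x u v] hl contr_u[of "hd p" u v] by (auto simp: apex_def)
  have q: "E v x \<longleftrightarrow> x = hd q" "\<not> E u x" if "x \<in> set q" for x
    using that o(5) n(2) uo contr_u[of x u v] hl contr_u[of "hd q" u v] by (auto simp: apex_def)
  have r: "E u x \<or> E v x \<longleftrightarrow> x = hd r" if "x \<in> set r" for x
    using that o(6) uo contr_u[of x u v] by (auto simp: apex_def)
  have yuv: "\<not> E u y" "\<not> E v y" "\<not> E y u" "\<not> E y v" 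
    using o(2,3) contr_u[of y u v] sym by auto
  have y: "apex E y (rev p)" "apex E y (rev q)" "apex E y (rev r)"
  proof -
    have "E y x \<longleftrightarrow> ?F y x" if "x \<in> set p \<union> set q \<union> set r" for x
      using that o(2) uo contr_eq[of y u x v] by auto
    then show "apex E y (rev p)" "apex E y (rev q)" "apex E y (rev r)"
      using o(7-9) unfolding apex_def by auto
  qed
  have np: "\<forall>x \<in> set p. \<forall>x' \<in> set q. \<not> E x x'" "\<forall>x \<in> set p. \<forall>x' \<in> set r. \<not> E x x'"
    "\<forall>x \<in> set q. \<forall>x' \<in> set r. \<not> E x x'"
    using o(10-12) uo contr_eq[of _ u _ v] by metis+
  have up: "arms E (u # p) q r" "arms E p (v # q) r" "arms E (u # p) (v # q) r"
    using a p q uo vo by (auto simp: arms_def)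
  have yup: "apex E y (rev (u # p))" "apex E y (rev (v # q))"
    using y(1,2) yuv o(2) vo uo a(4,5) last_in_set[OF a(4)] last_in_set[OF a(5)] unfolding apex_def
    by (auto simp: hd_append hd_rev)
  consider "E u (hd r)" "E v (hd r)" | "\<not> E u (hd r)" "E v (hd r)" | "E u (hd r)" "\<not> E v (hd r)"
    using r[OF hl(3)] by blast
  then show ?thesis
  proof cases
    case 1
    have "arms E (rev (u # p)) (rev (v # q)) (rev r)"
      using up(3) unfolding arms_def ipath_rev by simp
    moreover have "\<forall>x \<in> set (rev (u # p)). \<forall>x' \<in> set (rev (v # q)).
        E x x' \<longleftrightarrow> x = last (rev (u # p)) \<and> x' = last (rev (v # q))"
      using uv p q np(1) uo vo sym_iff[of _ v] by auto
    moreover have "E u x \<longleftrightarrow> x = hd r" "E v x \<longleftrightarrow> x = hd r" if "x \<in> set r" for x using r[OF that] 1 by blast+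
    then have "\<forall>x \<in> set (rev (u # p)). \<forall>x' \<in> set (rev r). E x x' \<longleftrightarrow> x = last (rev (u # p)) \<and> x' = last (rev r)"
      "\<forall>x \<in> set (rev (v # q)). \<forall>x' \<in> set (rev r). E x x' \<longleftrightarrow> x = last (rev (v # q)) \<and> x' = last (rev r)"
      using np uo vo by (auto simp: last_rev)
    ultimately have "istamp E y (rev (u # p)) (rev (v # q)) (rev r)"
      using yup y(3) unfolding istamp_def by blast
    then show ?thesis by (rule solid_setI) auto
  next
    case 2
    then have r2: "E v x \<longleftrightarrow> x = hd r" "\<not> E u x" if "x \<in> set r" for x using r[OF that] by auto
    have "apex E v (u # p)" "apex E v q" "apex E v r"
      using p q r2 vo uv sym[OF uv] by (auto simp: apex_def)
    moreover have "\<forall>x \<in> set (u # p). \<forall>x' \<in> set q. \<not> E x x'" "\<forall>x \<in> set (u # p). \<forall>x' \<in> set r. \<not> E x x'"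
      using np q r2 by auto
    ultimately have "itrihedron E v y (u # p) q r"
      using up(1) yup(1) y(2,3) np(3) vo yuv unfolding itrihedron_def by blast
    then show ?thesis by (rule solid_setI) auto
  next
    case 3
    then have r2: "E u x \<longleftrightarrow> x = hd r" "\<not> E v x" if "x \<in> set r" for x using r[OF that] by auto
    have "apex E u p" "apex E u (v # q)" "apex E u r"
      using p q r2 vo uo uv by (auto simp: apex_def)
    moreover have "\<forall>x \<in> set p. \<forall>x' \<in> set (v # q). \<not> E x x'" "\<forall>x \<in> set (v # q). \<forall>x' \<in> set r. \<not> E x x'"
      using np p r2 sym_iff[of _ v] by auto
    ultimately have "itrihedron E u y p (v # q) r"
      using up(2) yup(2) y(1,3) np(2) o(2) yuv unfolding itrihedron_def by blast
    then show ?thesis by (rule solid_setI) auto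
  qed
qed

text \<open>The split is that of \<open>itrihedron_contr\<close>. If both \<open>u\<close> and
  \<open>v\<close> see \<open>hd r\<close>, a second triangle arises and the stamp becomes a prism,
  or a pyramid if \<open>r\<close> is one vertex lying in both triangles. If only one sees it, a
  stamp with a longer path remains.\<close>

lemma istamp_contr:
  assumes uv: "E u v" and t: "istamp (contr E u v) u p q r" and v: "v \<notin> {u} \<union> set p \<union> set q \<union> set r"
    and n: "\<not> E v (hd p)" "\<not> E u (hd q)"
  shows "solid_set E (insert v (insert u (set p \<union> set q \<union> set r)))"
proof -
  let ?F = "contr E u v"
  have o: "arms ?F p q r" "apex ?F u p" "apex ?F u q" "apex ?F u r"
    "\<forall>x \<in> set p. \<forall>x' \<in> set q. ?F x x' \<longleftrightarrow> x = last p \<and> x' = last q"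
    "\<forall>x \<in> set p. \<forall>x' \<in> set r. ?F x x' \<longleftrightarrow> x = last p \<and> x' = last r"
    "\<forall>x \<in> set q. \<forall>x' \<in> set r. ?F x x' \<longleftrightarrow> x = last q \<and> x' = last r"
    using t unfolding istamp_def by blast+
  have uo: "u \<notin> set p" "u \<notin> set q" "u \<notin> set r" using o(2-4) by (auto simp: apex_def)
  have vo: "v \<noteq> u" "v \<notin> set p" "v \<notin> set q" "v \<notin> set r" using v by auto
  have a: "ipath E p" "ipath E q" "ipath E r" "p \<noteq> []" "q \<noteq> []" "r \<noteq> []"
    "set p \<inter> set q = {}" "set p \<inter> set r = {}" "set q \<inter> set r = {}"
    using o(1) uo ipath_contr by (auto simp: arms_def)
  have hl: "hd p \<in> set p" "hd q \<in> set q" "hd r \<in> set r" "last p \<in> set p" "last q \<in> set q" "last r \<in> set r"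
    using a by auto
  have p: "E u x \<longleftrightarrow> x = hd p" "\<not> E v x" if "x \<in> set p" for x
    using that o(2) n(1) uo contr_u[of x u v] hl contr_u[of "hd p" u v] by (auto simp: apex_def)
  have q: "E v x \<longleftrightarrow> x = hd q" "\<not> E u x" if "x \<in> set q" for x
    using that o(3) n(2) uo contr_u[of x u v] hl contr_u[of "hd q" u v] by (auto simp: apex_def)
  have r: "E u x \<or> E v x \<longleftrightarrow> x = hd r" if "x \<in> set r" for x
    using that o(4) uo contr_u[of x u v] by (auto simp: apex_def)
  have np: "\<forall>x \<in> set p. \<forall>x' \<in> set q. E x x' \<longleftrightarrow> x = last p \<and> x' = last q"
    "\<forall>x \<in> set p. \<forall>x' \<in> set r. E x x' \<longleftrightarrow> x = last p \<and> x' = last r"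
    "\<forall>x \<in> set q. \<forall>x' \<in> set r. E x x' \<longleftrightarrow> x = last q \<and> x' = last r"
    using o(5-7) uo contr_eq[of _ u _ v] by metis+
  have up: "arms E (u # p) q r" "arms E p (v # q) r" "arms E (u # p) (v # q) r"
    using a p q uo vo by (auto simp: arms_def)
  have l: "last (u # p) = last p" "last (v # q) = last q" using a by auto
  have u_notlast: "last p \<noteq> u" "last q \<noteq> v" "last p \<noteq> v" "last q \<noteq> u" "last r \<noteq> u" "last r \<noteq> v"
    using hl uo vo by metis+
  consider "E u (hd r)" "E v (hd r)" | "\<not> E u (hd r)" "E v (hd r)" | "E u (hd r)" "\<not> E v (hd r)"
    using r[OF hl(3)] by blast
  then show ?thesis
  proof cases
    case 1
    then have r2: "E u x \<longleftrightarrow> x = hd r" "E v x \<longleftrightarrow> x = hd r" if "x \<in> set r" for x using r[OF that] by blast+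
    have pq: "E x x' \<longleftrightarrow> x = u \<and> x' = v \<or> x = last p \<and> x' = last q" 
      if "x \<in> set (u # p)" "x' \<in> set (v # q)" for x x'
      using that uv p q np(1) uo vo u_notlast sym_iff[of _ v] by auto
    show ?thesis
    proof (cases "hd r = last r")
      case True
      then obtain s where s: "r = [s]" using ipath_distinct[OF a(3)] hd_neq_last[of r] a(6)
        by (cases r) (auto simp: Suc_le_eq split: if_splits)
      \<comment> \<open>Here \<open>r\<close> is the single vertex \<open>s\<close>. The other two
        paths close up to a cycle through the edge \<open>u v\<close> and the edge between their
        last vertices, and \<open>s\<close> sees both edges.\<close>
      have c: "icycle E (rev (u # p) @ (v # q))"
      proof -
        have "ipath E (rev (u # p))" "ipath E (v # q)" "set (rev (u # p)) \<inter> set (v # q) = {}"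
          using up(3) unfolding arms_def ipath_rev set_rev by blast+
        moreover have "\<forall>x \<in> set (rev (u # p)). \<forall>y \<in> set (v # q).
            E x y \<longleftrightarrow> x = last (rev (u # p)) \<and> y = hd (v # q) \<or> x = hd (rev (u # p)) \<and> y = last (v # q)"
          using pq unfolding hd_rev last_rev set_rev l by auto
        moreover have "3 \<le> length (rev (u # p) @ (v # q))" using a(4) by (cases p) auto
        ultimately show ?thesis by (subst icycle_append) simp_all
      qed
      let ?c = "rev (u # p) @ (v # q)"
      have "{u, v, last p} \<subseteq> {x \<in> set ?c. E s x}"
        using r2[of s] s np(2) hl sym by auto
      then have "card {u, v, last p} \<le> card {x \<in> set ?c. E s x}" by (intro card_mono) auto
      moreover have "card {u, v, last p} = 3" using vo(1) u_notlast by (auto simp: card_insert_if)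
      moreover have "s \<notin> set ?c" using a(8,9) s uo vo by auto
      ultimately have "ipyramid E ?c s" using c by (simp add: ipyramid_def)
      then show ?thesis by (rule solid_setI) (auto simp: s)
    next
      case False
      have "\<forall>x \<in> set (u # p). \<forall>x' \<in> set (v # q).
          E x x' \<longleftrightarrow> x = hd (u # p) \<and> x' = hd (v # q) \<or> x = last (u # p) \<and> x' = last (v # q)"
        using pq l by simp
      moreover have "\<forall>x \<in> set (u # p). \<forall>x' \<in> set r.
          E x x' \<longleftrightarrow> x = hd (u # p) \<and> x' = hd r \<or> x = last (u # p) \<and> x' = last r"
        using r2(1) np(2) l uo(1) u_notlast by auto
      moreover have "\<forall>x \<in> set (v # q). \<forall>x' \<in> set r.
          E x x' \<longleftrightarrow> x = hd (v # q) \<and> x' = hd r \<or> x = last (v # q) \<and> x' = last r"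
        using r2(2) np(3) l vo u_notlast by auto
      moreover have "hd (u # p) \<noteq> last (u # p)" "hd (v # q) \<noteq> last (v # q)" using l u_notlast by auto
      ultimately have "iprism E (u # p) (v # q) r" using up(3) False unfolding iprism_def by blast
      then show ?thesis by (rule solid_setI) auto
    qed
  next
    case 2
    then have r2: "E v x \<longleftrightarrow> x = hd r" "\<not> E u x" if "x \<in> set r" for x using r[OF that] by auto
    have "apex E v (u # p)" "apex E v q" "apex E v r"
      using p q r2 vo uv sym[OF uv] by (auto simp: apex_def)
    moreover have "\<forall>x \<in> set (u # p). \<forall>x' \<in> set q. E x x' \<longleftrightarrow> x = last (u # p) \<and> x' = last q"
      "\<forall>x \<in> set (u # p). \<forall>x' \<in> set r. E x x' \<longleftrightarrow> x = last (u # p) \<and> x' = last r"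
      unfolding l using np(1,2) q r2 u_notlast by auto
    ultimately have "istamp E v (u # p) q r"
      using up(1) np(3) unfolding istamp_def by blast
    then show ?thesis by (rule solid_setI) auto
  next
    case 3
    then have r2: "E u x \<longleftrightarrow> x = hd r" "\<not> E v x" if "x \<in> set r" for x using r[OF that] by auto
    have "apex E u p" "apex E u (v # q)" "apex E u r"
      using p q r2 vo uo uv by (auto simp: apex_def)
    moreover have "\<forall>x \<in> set p. \<forall>x' \<in> set (v # q). E x x' \<longleftrightarrow> x = last p \<and> x' = last (v # q)"
      "\<forall>x \<in> set (v # q). \<forall>x' \<in> set r. E x x' \<longleftrightarrow> x = last (v # q) \<and> x' = last r"
      unfolding l using np(1,3) p r2 u_notlast sym_iff[of _ v] by auto
    ultimately have "istamp E u p (v # q) r"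
      using up(2) np(2) unfolding istamp_def by blast
    then show ?thesis by (rule solid_setI) auto
  qed
qed

text \<open>A cut that separates \<open>u\<close> from \<open>v\<close> is crossed by the edge
  \<open>uv\<close>; any other cut, with \<open>v\<close> deleted, is a cut of the contracted
  set.\<close>

lemma conn_contr:
  assumes uv: "E u v" and R: "conn (contr E u v) R" "u \<in> R" "v \<notin> R"
  shows "conn E (insert v R)"
  unfolding conn_def
proof (intro conjI allI impI)
  fix X assume X: "X \<subseteq> insert v R \<and> X \<noteq> {} \<and> X \<noteq> insert v R"
  show "\<exists>x \<in> X. \<exists>y \<in> insert v R - X. E x y"
  proof (cases "u \<in> X \<longleftrightarrow> v \<in> X")
    case False
    then show ?thesis using uv sym R(2) by blast
  next
    case True
    let ?Y = "X - {v}"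
    have "?Y \<subseteq> R" "?Y \<noteq> {}" "?Y \<noteq> R" using X True R(2,3) by auto
    then obtain x y where xy: "x \<in> ?Y" "y \<in> R" "y \<notin> ?Y" "contr E u v x y" using connE[OF R(1)] by metis
    have "y \<notin> X" using xy R(3) by auto
    have "E x y \<or> x = u \<and> E v y \<or> y = u \<and> E x v" using xy(4) by (auto simp: contr_def)
    then show ?thesis using xy \<open>y \<notin> X\<close> True by blast
  qed
qed auto

text \<open>A cut of the image pulls back to a cut of \<open>R\<close>, and an edge across the
  latter has ends with different images.\<close>

lemma conn_image:
  assumes R: "conn E R" and g: "\<And>x y. x \<in> R \<Longrightarrow> y \<in> R \<Longrightarrow> E x y \<Longrightarrow> g x \<noteq> g y \<Longrightarrow> F (g x) (g y)"
  shows "conn F (g ` R)"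
  unfolding conn_def
proof (intro conjI allI impI)
  show "g ` R \<noteq> {}" using conn_nonempty[OF R] by auto
  fix X assume X: "X \<subseteq> g ` R \<and> X \<noteq> {} \<and> X \<noteq> g ` R"
  let ?Y = "{x \<in> R. g x \<in> X}"
  have Y: "?Y \<subseteq> R" "?Y \<noteq> {}" using X by auto
  have "?Y \<noteq> R"
  proof
    assume *: "?Y = R"
    have "g ` R \<subseteq> X" by (subst *[symmetric]) auto
    then show False using X by auto
  qed
  then obtain x y where xy: "x \<in> ?Y" "y \<in> R" "y \<notin> ?Y" "E x y" by (rule connE[OF R Y])
  then have "g x \<in> X" "g y \<in> g ` R - X" by blast+
  moreover from this have "g x \<noteq> g y" by auto
  then have "F (g x) (g y)" using g xy by blast
  ultimately show "\<exists>x \<in> X. \<exists>y \<in> g ` R - X. F x y" by blast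
qed

lemma small_contr:
  assumes "u \<notin> A"
  shows "small (contr E u v) A \<longleftrightarrow> small E A"
proof -
  \<comment> \<open>The pair witnessing smallness need not lie in \<open>A\<close>, where the
    relations agree; if it does not, \<open>A\<close> has at most one vertex.\<close>
  have *: "small G A" if sm: "small F A" and FG: "\<And>x y. x \<in> A \<Longrightarrow> y \<in> A \<Longrightarrow> F x y \<longleftrightarrow> G x y" for F G :: "'a \<Rightarrow> 'a \<Rightarrow> bool"
  proof -
    obtain x y where xy: "A \<subseteq> {x, y}" "x = y \<or> F x y" using sm unfolding small_def by blast
    show ?thesis
    proof (cases "x \<in> A \<and> y \<in> A")
      case True
      then show ?thesis using xy FG unfolding small_def by blast
    next
      case False
      then have "A \<subseteq> {x} \<or> A \<subseteq> {y}" using xy by blast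
      then show ?thesis unfolding small_def by blast
    qed
  qed
  have "contr E u v x y \<longleftrightarrow> E x y" if "x \<in> A" "y \<in> A" for x y using that assms contr_eq by metis
  then show ?thesis using *[of "contr E u v" E] *[of E "contr E u v"] by blast
qed

text \<open>A solid of \<open>G/uv\<close> lifts to a solid of \<open>G\<close> that is mapped onto it by the contraction. If \<open>u\<close> lies on
  the connected part attached to the cycle, then a minimal part of its preimage that is still
  attached to more than an edge of the cycle does. Only the apices of trihedra and stamps cannot be
  put there.\<close>
lemma solid_set_contr:
  assumes uv: "E u v" and S: "solid_set (contr E u v) S" "v \<notin> S"
  obtains T where "solid_set E T" "(\<lambda>x. if x = v then u else x) ` T = S"
proof -
  note lifts = that
  let ?F = "contr E u v" and ?g = "\<lambda>x. if x = v then u else x"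
  interpret F: ugraph ?F by (rule ugraph_contr)
  have uvne: "u \<noteq> v" using uv irrefl by auto
  have gS: "?g ` S = S" using S(2) by (auto simp: image_iff)
  have F_u: "?F u x \<Longrightarrow> E u x \<or> E v x" for x unfolding contr_def using uv sym by auto
  \<comment> \<open>If \<open>u\<close> itself sees all its neighbours in the contracted solid, then
    \<open>S\<close> induces the same graph before the contraction.\<close>
  have 1: thesis if h: "\<And>x. x \<in> S \<Longrightarrow> u \<in> S \<Longrightarrow> ?F u x \<Longrightarrow> E u x"
  proof -
    have *: "E u y \<longleftrightarrow> ?F u y" if "y \<in> S" "u \<in> S" for y
      using h[of y] that irrefl F.irrefl contr_u[of y u v] by (cases "y = u") auto
    have "E x y \<longleftrightarrow> ?F x y" if "x \<in> S" "y \<in> S" for x y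
    proof -
      consider "x = u" | "y = u" | "x \<noteq> u" "y \<noteq> u" by blast
      then show ?thesis
        using that * sym_iff[of x y] F.sym_iff[of x y] contr_eq by cases auto
    qed
    then have "solid_set E (id ` S)" using solid_set_map[of id S E ?F] S(1) by simp
    then show thesis using lifts gS by simp
  qed
  show thesis
  proof (cases "u \<in> S")
    case False
    then show thesis using 1 by blast
  next
    case u: True
    \<comment> \<open>If \<open>v\<close> sees all of them, then \<open>v\<close> can take the place
      of \<open>u\<close>.\<close>
    have 2: thesis if h: "\<And>x. x \<in> S \<Longrightarrow> ?F u x \<Longrightarrow> E v x"
    proof -
      let ?h = "\<lambda>x. if x = u then v else x"
      have i: "inj_on ?h S" using S(2) by (auto simp: inj_on_def)
      have *: "E v y \<longleftrightarrow> ?F u y" if "y \<in> S" "y \<noteq> u" for y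
        using h[of y] that contr_u[of y u v] by blast
      have e: "E (?h x) (?h y) \<longleftrightarrow> ?F x y" if "x \<in> S" "y \<in> S" for x y
        using *[of x] *[of y] that sym_iff[of x v] F.sym_iff[of x u] contr_eq irrefl F.irrefl by auto
      have "solid_set E (?h ` S)" by (rule solid_set_map[of ?h S E ?F]) (use i e S(1) in auto)
      moreover have "?g ` ?h ` S = S" using S(2) by (auto simp: image_iff)
      ultimately show thesis using lifts by blast
    qed
    have 3: "?g ` insert v S = S" using gS u by auto
    from S(1) u show thesis
    proof (cases rule: F.solid_set_split)
      case (ear c r)
      have crit: "critical ?F c (set r)" using F.ear_critical[OF ear(1)] .
      have c: "icycle ?F c" "set c \<inter> set r = {}" "conn ?F (set r)" "\<not> small ?F (att ?F (set c) (set r))"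
        and min: "\<And>R'. R' \<subset> set r \<Longrightarrow> conn ?F R' \<Longrightarrow> small ?F (att ?F (set c) R')"
        using crit by (auto simp: critical_def)
      have uc: "u \<notin> set c" "v \<notin> set c" "v \<notin> set r" using ear S(2) c(2) by auto
      have xF: "?F x y \<longleftrightarrow> E x y \<or> y = u \<and> E x v" if "x \<in> set c" "y \<notin> set c" for x y
        using that uc(1) unfolding contr_def by auto
      \<comment> \<open>As \<open>u\<close> is off the cycle, moving \<open>v\<close> to
        \<open>u\<close> never loses an attachment.\<close>
      have up: "att E (set c) R \<subseteq> att ?F (set c) (?g ` R)" if "R \<inter> set c = {}" for R
      proof
        fix x assume "x \<in> att E (set c) R"
        then obtain y where "x \<in> set c" "y \<in> R" "E x y" by (auto simp: att_def)
        moreover from this have "y \<notin> set c" using that by blast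
        ultimately have "?F x (?g y)" using xF[of x "?g y"] uc(1) by (cases "y = v") auto
        then show "x \<in> att ?F (set c) (?g ` R)" using \<open>x \<in> set c\<close> \<open>y \<in> R\<close> unfolding att_def by blast
      qed
      have down: "att ?F (set c) (set r) \<subseteq> att E (set c) (insert v (set r))"
        using xF c(2) ear(2) unfolding att_def by blast
      have sm: "small ?F A \<longleftrightarrow> small E A" if "A \<subseteq> set c" for A
        using that uc(1) by (intro small_contr) auto
      have attc: "att G (set c) R \<subseteq> set c" for G R by (auto simp: att_def)
      \<comment> \<open>The full preimage of the ear qualifies by \<open>conn_contr\<close> and
        \<open>down\<close>, and a minimal qualifying set is critical before the
        contraction.\<close>
      let ?P = "\<lambda>R'. R' \<subseteq> insert v (set r) \<and> conn E R' \<and> \<not> small E (att E (set c) R')"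
      have "?P (insert v (set r))"
        using conn_contr[OF uv c(3) ear(2) uc(3)] c(4) sm[OF attc] small_mono[OF _ down] by blast
      then have ne: "{R'. ?P R'} \<noteq> {}" by blast
      have "{R'. ?P R'} \<subseteq> Pow (insert v (set r))" by blast
      then have "finite {R'. ?P R'}" by (rule finite_subset) simp
      from finite_has_minimal[OF this ne] obtain R'
        where R': "?P R'" and m: "\<And>T. ?P T \<Longrightarrow> T \<subseteq> R' \<Longrightarrow> R' = T" by auto
      have dis: "R' \<inter> set c = {}" using R' c(2) uc(2) by auto
      have "critical E c R'"
        unfolding critical_def
      proof (intro conjI allI impI)
        show "icycle E c" using icycle_contr uc(1) c(1) by blast
        show "set c \<inter> R' = {}" using dis by blast
        show "conn E R'" "\<not> small E (att E (set c) R')" using R' by blast+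
        fix T assume "T \<subset> R' \<and> conn E T"
        then show "small E (att E (set c) T)" using m[of T] R' by blast
      qed
      moreover have "finite R'" using R' finite_subset[of R' "insert v (set r)"] by simp
      ultimately have "solid_set E (set c \<union> R')" by (rule critical_solid)
      moreover have "?g ` R' = set r"
      proof -
        \<comment> \<open>A smaller image would be a connected proper part of the ear that is still
          attached to more than an edge, contrary to \<open>min\<close>.\<close>
        have "?g ` R' \<subseteq> set r" using R' ear(2) by auto
        moreover have "conn ?F (?g ` R')" using R' by (intro conn_image) (auto simp: contr_def)
        moreover have "\<not> small ?F (att ?F (set c) (?g ` R'))"
          using R' sm[OF attc] small_mono[OF _ up[OF dis]] by blast
        ultimately show ?thesis using min[of "?g ` R'"] by blast
      qed
      then have "?g ` (set c \<union> R') = S" using uc ear(3) by (auto simp: image_Un)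
      ultimately show thesis by (rule lifts)
    next
      case t: (itrihedron y p q r)
      show thesis
      proof (cases "(\<forall>x \<in> S. ?F u x \<longrightarrow> E u x) \<or> (\<forall>x \<in> S. ?F u x \<longrightarrow> E v x)")
        case True
        then show thesis using 1 2 by blast
      next
        case False
        then obtain a b where ab: "a \<in> S" "?F u a" "\<not> E u a" "E v a" "b \<in> S" "?F u b" "\<not> E v b"
          using F_u by blast
        have nbr: "x = hd p \<or> x = hd q \<or> x = hd r" if "x \<in> S" "?F u x" for x
          using that t F.irrefl unfolding itrihedron_def apex_def by auto
        \<comment> \<open>The neighbour \<open>a\<close> is seen only by \<open>v\<close> and
          \<open>b\<close> only by \<open>u\<close>. They are the first vertices of two different
          paths, so one of the six orders of the paths fits \<open>itrihedron_contr\<close>.\<close>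
        have fin: thesis if "itrihedron ?F u y p q r" "hd p = b" "hd q = a" "S = {u, y} \<union> set p \<union> set q \<union> set r"
          for p q r
        proof -
          have "solid_set E (insert v S)"
            using itrihedron_contr[OF uv that(1)] that(2-4) ab S(2) by simp
          then show thesis using lifts 3 by blast
        qed
        note pm = F.itrihedron_perm
        have ST: "S = {u, y} \<union> set p \<union> set r \<union> set q" "S = {u, y} \<union> set q \<union> set p \<union> set r"
          "S = {u, y} \<union> set q \<union> set r \<union> set p" "S = {u, y} \<union> set r \<union> set p \<union> set q"
          "S = {u, y} \<union> set r \<union> set q \<union> set p" using t(2) by auto
        have T: "itrihedron ?F u y p r q" "itrihedron ?F u y q p r" "itrihedron ?F u y q r p" "itrihedron ?F u y r p q" "itrihedron ?F u y r q p"
          using pm[OF t(1)] pm(2)[OF pm(1)[OF t(1)]] pm(1)[OF pm(2)[OF t(1)]] pm(2)[OF pm(1)[OF pm(2)[OF t(1)]]]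
          by blast+
        from nbr[OF ab(5,6)] nbr[OF ab(1,2)] ab(4,7) show thesis
          using fin[OF t(1) _ _ t(2)] fin[OF T(1) _ _ ST(1)] fin[OF T(2) _ _ ST(2)] fin[OF T(3) _ _ ST(3)]
            fin[OF T(4) _ _ ST(4)] fin[OF T(5) _ _ ST(5)]
          by metis
      qed
    next
      case t: (istamp p q r)
      show thesis
      proof (cases "(\<forall>x \<in> S. ?F u x \<longrightarrow> E u x) \<or> (\<forall>x \<in> S. ?F u x \<longrightarrow> E v x)")
        case True
        then show thesis using 1 2 by blast
      next
        case False
        then obtain a b where ab: "a \<in> S" "?F u a" "\<not> E u a" "E v a" "b \<in> S" "?F u b" "\<not> E v b"
          using F_u by blast
        have nbr: "x = hd p \<or> x = hd q \<or> x = hd r" if "x \<in> S" "?F u x" for x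
          using that t F.irrefl unfolding istamp_def apex_def by auto
        \<comment> \<open>As for trihedra, one of the six orders of the paths fits
          \<open>istamp_contr\<close>.\<close>
        have fin: thesis if "istamp ?F u p q r" "hd p = b" "hd q = a" "S = insert u (set p \<union> set q \<union> set r)"
          for p q r
        proof -
          have "solid_set E (insert v S)"
            using istamp_contr[OF uv that(1)] that(2-4) ab S(2) by simp
          then show thesis using lifts 3 by blast
        qed
        note pm = F.istamp_perm
        have ST: "S = insert u (set p \<union> set r \<union> set q)" "S = insert u (set q \<union> set p \<union> set r)"
          "S = insert u (set q \<union> set r \<union> set p)" "S = insert u (set r \<union> set p \<union> set q)"
          "S = insert u (set r \<union> set q \<union> set p)" using t(2) by auto
        have T: "istamp ?F u p r q" "istamp ?F u q p r" "istamp ?F u q r p" "istamp ?F u r p q" "istamp ?F u r q p"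
          using pm[OF t(1)] pm(2)[OF pm(1)[OF t(1)]] pm(1)[OF pm(2)[OF t(1)]] pm(2)[OF pm(1)[OF pm(2)[OF t(1)]]]
          by blast+
        from nbr[OF ab(5,6)] nbr[OF ab(1,2)] ab(4,7) show thesis
          using fin[OF t(1) _ _ t(2)] fin[OF T(1) _ _ ST(1)] fin[OF T(2) _ _ ST(2)] fin[OF T(3) _ _ ST(3)]
            fin[OF T(4) _ _ ST(4)] fin[OF T(5) _ _ ST(5)]
          by metis
      qed
    qed
  qed
qed

end

text \<open>The simple graph obtained by contracting all fibres of \<open>f\<close> at once;
  \<open>contr\<close> is its one-edge step.\<close>

definition quot :: "('a \<Rightarrow> 'a \<Rightarrow> bool) \<Rightarrow> 'a set \<Rightarrow> ('a \<Rightarrow> 'b) \<Rightarrow> 'b \<Rightarrow> 'b \<Rightarrow> bool" where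
  "quot E V f a b \<longleftrightarrow> a \<noteq> b \<and> (\<exists>x \<in> V. \<exists>y \<in> V. f x = a \<and> f y = b \<and> E x y)"

lemma solid_set_cong:
  assumes "\<And>x y. x \<in> S \<Longrightarrow> y \<in> S \<Longrightarrow> E x y \<longleftrightarrow> F x y" "solid_set F S"
  shows "solid_set E S"
  using solid_set_map[of id S E F] assms by simp

text \<open>A fibre with two vertices is connected and thus contains an edge. Contracting it keeps
  the quotient and removes a vertex, and \<open>solid_set_contr\<close> undoes this step. Once
  \<open>f\<close> is injective, the quotient is an isomorphic copy. The relation varies in the
  induction because the contraction changes it.\<close>

lemma solid_set_lift:
  assumes "ugraph E" "finite V" "\<And>a. a \<in> f ` V \<Longrightarrow> conn E {x \<in> V. f x = a}"
    "solid_set (quot E V f) S" "S \<subseteq> f ` V"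
  shows "\<exists>T. T \<subseteq> V \<and> solid_set E T \<and> f ` T = S"
  using assms
proof (induction "card V" arbitrary: V E rule: less_induct)
  case less
  interpret ugraph E by fact
  show ?case
  proof (cases "inj_on f V")
    case True
    let ?g = "the_inv_into V f"
    have g: "?g a \<in> V" "f (?g a) = a" if "a \<in> f ` V" for a
      using that True by (auto simp: the_inv_into_into f_the_inv_into_f)
    have e: "E (?g a) (?g b) \<longleftrightarrow> quot E V f a b" if "a \<in> S" "b \<in> S" for a b
    proof -
      have ab: "a \<in> f ` V" "b \<in> f ` V" using that less.prems(5) by auto
      have "quot E V f a b \<longleftrightarrow> a \<noteq> b \<and> E (?g a) (?g b)"
        unfolding quot_def using g[OF ab(1)] g[OF ab(2)] the_inv_into_f_f[OF True] by metis
      then show ?thesis using irrefl by auto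
    qed
    have "inj_on ?g S" using inj_on_the_inv_into[OF True] less.prems(5) inj_on_subset by blast
    then have "solid_set E (?g ` S)"
      by (rule solid_set_map[OF _ _ less.prems(4)]) (use e in auto)
    moreover have "f ` ?g ` S = S" using g less.prems(5) by (force simp: image_iff)
    moreover have "?g ` S \<subseteq> V" using g less.prems(5) by auto
    ultimately show ?thesis by blast
  next
    case False
    then obtain x0 y0 where xy0: "x0 \<in> V" "y0 \<in> V" "f x0 = f y0" "x0 \<noteq> y0" by (auto simp: inj_on_def)
    let ?B = "{x \<in> V. f x = f x0}"
    have cB: "conn E ?B" using less.prems(3) xy0 by blast
    have "{x0} \<subseteq> ?B" "{x0} \<noteq> {}" "{x0} \<noteq> ?B" using xy0 by auto
    then obtain u v where uv: "u \<in> {x0}" "v \<in> ?B" "v \<notin> {x0}" "E u v" by (rule connE[OF cB])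
    then have uv: "u \<in> V" "v \<in> V" "f u = f v" "u \<noteq> v" "E u v" using xy0 by auto
    let ?V = "V - {v}" and ?E = "contr E u v" and ?g = "\<lambda>x. if x = v then u else x"
    have gV: "?g ` V = ?V" using uv by auto
    have fg: "f (?g x) = f x" for x using uv by simp
    have "f v \<in> f ` ?V" using uv by (metis Diff_iff imageI singletonD)
    then have fV: "f ` ?V = f ` V" using uv(2) by (metis image_insert insert_Diff insert_absorb)
    \<comment> \<open>Both ends of the contracted edge lie in the same fibre, so the quotient does
      not notice the contraction.\<close>
    have q: "quot ?E ?V f a b \<longleftrightarrow> quot E V f a b" for a b
    proof
      assume "quot ?E ?V f a b"
      then obtain x y where "a \<noteq> b" "x \<in> ?V" "y \<in> ?V" "f x = a" "f y = b" "?E x y"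
        unfolding quot_def by blast
      moreover from this have "E x y \<or> x = u \<and> E v y \<or> y = u \<and> E x v" by (auto simp: contr_def)
      ultimately show "quot E V f a b" unfolding quot_def using uv(2,3) by (metis DiffD1)
    next
      assume "quot E V f a b"
      then obtain x y where xy: "a \<noteq> b" "x \<in> V" "y \<in> V" "f x = a" "f y = b" "E x y"
        unfolding quot_def by blast
      then have "?g x \<noteq> ?g y" using fg by metis
      then have "?E (?g x) (?g y)" using xy(6) unfolding contr_def by auto
      moreover have "?g x \<in> ?V" "?g y \<in> ?V" using xy gV by blast+
      moreover have "f (?g x) = a" "f (?g y) = b" using fg xy by blast+
      ultimately show "quot ?E ?V f a b" unfolding quot_def using xy(1) by blast
    qed
    have c: "conn ?E {x \<in> ?V. f x = a}" if "a \<in> f ` ?V" for a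
    proof -
      have "conn ?E (?g ` {x \<in> V. f x = a})"
        using less.prems(3) that by (intro conn_image) (auto simp: contr_def)
      moreover have "?g ` {x \<in> V. f x = a} = {x \<in> ?V. f x = a}" using uv by auto
      ultimately show ?thesis by simp
    qed
    have "card ?V < card V" using uv less.prems(2) by (intro psubset_card_mono) auto
    moreover have "solid_set (quot ?E ?V f) S" by (rule solid_set_cong[OF _ less.prems(4)]) (use q in blast)
    ultimately have "\<exists>T. T \<subseteq> ?V \<and> solid_set ?E T \<and> f ` T = S"
      using less.prems(2,5) fV by (intro less.hyps[OF _ ugraph_contr _ c]) auto
    then obtain T where T: "T \<subseteq> ?V" "solid_set ?E T" "f ` T = S" by blast
    have "v \<notin> T" using T(1) by blast
    from solid_set_contr[OF uv(5) T(2) this] obtain U where U: "solid_set E U" "?g ` U = T" .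
    have "f ` U = S" using T(3) fg unfolding U(2)[symmetric] image_image by simp
    moreover have "U \<subseteq> V"
    proof
      fix x assume "x \<in> U"
      then have "?g x \<in> ?V" using U(2) T(1) by blast
      then show "x \<in> V" using uv(2) by (cases "x = v") auto
    qed
    ultimately show ?thesis using U(1) by blast
  qed
qed

section \<open>Counting the solids that come from a clique minor\<close>

lemma solid_set_complete4:
  assumes "card S = 4" "\<And>x y. x \<in> S \<Longrightarrow> y \<in> S \<Longrightarrow> E x y \<longleftrightarrow> x \<noteq> y"
  shows "solid_set E S"
proof -
  have "card S = Suc 3" using assms(1) by simp
  then obtain d S' where "S = insert d S'" "d \<notin> S'" "card S' = 3" by (metis card_Suc_eq)
  moreover from this obtain a b c where "S' = {a, b, c}" "a \<noteq> b" "a \<noteq> c" "b \<noteq> c" by (metis card_3_iff)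
  ultimately have S: "S = {a, b, c, d}" "a \<noteq> b" "a \<noteq> c" "a \<noteq> d" "b \<noteq> c" "b \<noteq> d" "c \<noteq> d" by auto
  \<comment> \<open>K^4 as a pyramid: a triangle whose three vertices are all adjacent to
    \<open>d\<close>.\<close>
  have "icycle E [a, b, c]" using S assms(2) by (auto simp: icycle_Cons)
  moreover have "{x \<in> set [a, b, c]. E d x} = {a, b, c}" using S assms(2) by auto
  moreover have "card {a, b, c} = 3" using S by simp
  ultimately have "ipyramid E [a, b, c] d" using S by (auto simp: ipyramid_def)
  then show ?thesis by (rule solid_setI) (use S in auto)
qed

text \<open>Contracting four of the branch sets gives a \<open>K\<^sup>4\<close>, whose lift meets exactly these four sets.\<close>
lemma solids_of_branch_sets:
  assumes E: "ugraph E" and fin: "finite I" and B: "\<And>i. i \<in> I \<Longrightarrow> B i \<subseteq> V \<and> conn E (B i)" "finite V"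
    and disj: "\<And>i j. i \<in> I \<Longrightarrow> j \<in> I \<Longrightarrow> i \<noteq> j \<Longrightarrow> B i \<inter> B j = {}"
    and adj: "\<And>i j. i \<in> I \<Longrightarrow> j \<in> I \<Longrightarrow> i \<noteq> j \<Longrightarrow> \<exists>x \<in> B i. \<exists>y \<in> B j. E x y"
  shows "card I choose 4 \<le> card {S. S \<subseteq> V \<and> solid_set E S}"
proof -
  \<comment> \<open>The index of the branch set containing \<open>x\<close>. Its value elsewhere
    does not matter, as it is applied only to unions of branch sets.\<close>
  define f where "f x = (THE i. i \<in> I \<and> x \<in> B i)" for x
  have f: "f x = i" if "i \<in> I" "x \<in> B i" for i x
    unfolding f_def using that disj by (intro the_equality) blast+
  have ex: "\<exists>T. T \<subseteq> V \<and> solid_set E T \<and> f ` T = J" if J: "J \<subseteq> I" "card J = 4" for J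
  proof -
    let ?W = "\<Union>i \<in> J. B i"
    have fib: "{x \<in> ?W. f x = i} = B i" if "i \<in> J" for i using f that J(1) by blast
    have fW: "f ` ?W = J"
    proof
      show "f ` ?W \<subseteq> J" using f J(1) by blast
      show "J \<subseteq> f ` ?W"
      proof
        fix i assume i: "i \<in> J"
        then obtain x where "x \<in> B i" using B(1) J(1) conn_nonempty by (metis ex_in_conv subsetD)
        then show "i \<in> f ` ?W" using f[of i x] i J(1) by force
      qed
    qed
    have "quot E ?W f i j \<longleftrightarrow> i \<noteq> j" if ij: "i \<in> J" "j \<in> J" for i j
    proof
      assume "i \<noteq> j"
      moreover from this obtain x y where "x \<in> B i" "y \<in> B j" "E x y" using adj ij J(1) by blast
      moreover from this have "f x = i" "f y = j" using f ij J(1) by blast+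
      ultimately show "quot E ?W f i j" unfolding quot_def using ij by blast
    qed (simp add: quot_def)
    then have "solid_set (quot E ?W f) J" by (rule solid_set_complete4[OF J(2)])
    moreover have "finite ?W" using B J(1) by (meson UN_least finite_subset subsetD)
    moreover have "conn E {x \<in> ?W. f x = i}" if "i \<in> f ` ?W" for i
      using that fW fib[of i] B(1) J(1) by auto
    ultimately obtain T where T: "T \<subseteq> ?W" "solid_set E T" "f ` T = J"
      using solid_set_lift[OF E, of ?W f J] fW by auto
    moreover have "?W \<subseteq> V" using B(1) J(1) by auto
    with T(1) have "T \<subseteq> V" by (rule subset_trans)
    ultimately show ?thesis by blast
  qed
  \<comment> \<open>The image under \<open>f\<close> recovers the 4-set \<open>J\<close> from its
    lift, so the solids are at least as many as the 4-sets.\<close>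
  have "card I choose 4 = card {J. J \<subseteq> I \<and> card J = 4}" using n_subsets[OF fin] by simp
  also have "\<dots> \<le> card ((`) f ` {S. S \<subseteq> V \<and> solid_set E S})"
  proof (rule card_mono)
    show "finite ((`) f ` {S. S \<subseteq> V \<and> solid_set E S})" using B(2) by simp
    show "{J. J \<subseteq> I \<and> card J = 4} \<subseteq> (`) f ` {S. S \<subseteq> V \<and> solid_set E S}" using ex by blast
  qed
  also have "\<dots> \<le> card {S. S \<subseteq> V \<and> solid_set E S}" using B(2) by (intro card_image_le) simp
  finally show ?thesis .
qed

section \<open>A vertex whose neighbours are linked by a connected set of non-neighbours\<close>

context ugraph
begin

text \<open>The vertices of a moplex have this property. Take a vertex and a connected set \<open>K\<close> of
  vertices that are neither equal nor adjacent to it, with \<open>K\<close> as large as possible. By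
  maximality, the vertices that are neither in \<open>K\<close> nor adjacent to \<open>K\<close> are adjacent to all
  neighbours of \<open>K\<close>, so one can pass to the subgraph that they induce.\<close>
lemma ex_moplex_vertex:
  assumes "finite V" "V \<noteq> {}"
  shows "\<exists>v \<in> V. (\<forall>x \<in> V. \<forall>y \<in> V. E v x \<longrightarrow> E v y \<longrightarrow> x \<noteq> y \<longrightarrow> E x y) \<or>
    (\<exists>K. K \<subseteq> V \<and> conn E K \<and> v \<notin> K \<and> (\<forall>x \<in> K. \<not> E v x) \<and>
      (\<forall>x \<in> V. E v x \<longrightarrow> (\<exists>y \<in> K. E x y) \<or> (\<forall>y \<in> V. E v y \<longrightarrow> x \<noteq> y \<longrightarrow> E x y)))"
  using assms
proof (induction "card V" arbitrary: V rule: less_induct)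
  case less
  let ?Q = "\<lambda>(v, K). v \<in> V \<and> K \<subseteq> V \<and> conn E K \<and> v \<notin> K \<and> (\<forall>x \<in> K. \<not> E v x)"
  show ?case
  proof (cases "\<exists>p. ?Q p")
    case False
    \<comment> \<open>Two nonadjacent vertices would give a pair with a singleton as connected
      set.\<close>
    have "E x y" if "x \<in> V" "y \<in> V" "x \<noteq> y" for x y
    proof (rule ccontr)
      assume "\<not> E x y"
      then have "?Q (x, {y})" using that conn_sing[of E y] by auto
      then show False using False by blast
    qed
    then show ?thesis using less.prems by blast
  next
    case True
    have fin: "finite V" using less.prems by simp
    have "card K \<le> card V" if "?Q (v, K)" for v K using that fin by (auto intro: card_mono)
    then have "\<forall>q. ?Q q \<longrightarrow> card (snd q) < Suc (card V)" by (auto simp: less_Suc_eq_le)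
    moreover from True obtain p0 where "?Q p0" ..
    ultimately have "\<exists>p. ?Q p \<and> (\<forall>q. ?Q q \<longrightarrow> card (snd q) \<le> card (snd p))"
      by (intro ex_has_greatest_nat[of ?Q p0 "\<lambda>p. card (snd p)" "Suc (card V)"])
    then obtain p where p: "?Q p" "\<And>q. ?Q q \<Longrightarrow> card (snd q) \<le> card (snd p)" by blast
    obtain w K where wK: "p = (w, K)" by (cases p)
    have K: "w \<in> V" "K \<subseteq> V" "conn E K" "w \<notin> K" "\<forall>x \<in> K. \<not> E w x" using p(1) wK by auto
    have mx: "card L \<le> card K" if "u \<in> V" "L \<subseteq> V" "conn E L" "u \<notin> L" "\<forall>x \<in> L. \<not> E u x" for u L
      using p(2)[of "(u, L)"] that wK by simp
    define M where "M = {x \<in> V - K. \<forall>y \<in> K. \<not> E x y}"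
    \<comment> \<open>Otherwise \<open>m\<close> together with \<open>insert s K\<close> would be a
      pair with a larger connected set.\<close>
    have SM: "E s m" if s: "s \<in> V" "s \<notin> K" "y \<in> K" "E s y" and m: "m \<in> M" for s m y
    proof (rule ccontr)
      assume "\<not> E s m"
      have "conn E (insert s K)" using conn_insert[OF K(3) s(3,4)] .
      moreover have "m \<noteq> s" using s m by (auto simp: M_def)
      ultimately have "card (insert s K) \<le> card K"
        using mx[of m "insert s K"] s m K(2) \<open>\<not> E s m\<close> sym by (auto simp: M_def)
      then show False using s(2) finite_subset[OF K(2) fin] by simp
    qed
    have "w \<in> M" using K by (auto simp: M_def)
    have "M \<subset> V" using K(2) conn_nonempty[OF K(3)] by (auto simp: M_def)
    then have "card M < card V" "finite M" using fin by (auto intro: psubset_card_mono finite_subset)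
    then obtain v where v: "v \<in> M"
      "(\<forall>x \<in> M. \<forall>y \<in> M. E v x \<longrightarrow> E v y \<longrightarrow> x \<noteq> y \<longrightarrow> E x y) \<or>
    (\<exists>K. K \<subseteq> M \<and> conn E K \<and> v \<notin> K \<and> (\<forall>x \<in> K. \<not> E v x) \<and>
      (\<forall>x \<in> M. E v x \<longrightarrow> (\<exists>y \<in> K. E x y) \<or> (\<forall>y \<in> M. E v y \<longrightarrow> x \<noteq> y \<longrightarrow> E x y)))"
      using less.hyps[of M] \<open>w \<in> M\<close> by blast
    have vV: "v \<in> V" "v \<notin> K" "\<forall>x \<in> K. \<not> E v x" using v(1) by (auto simp: M_def)
    have nb: "x \<in> M \<or> (\<exists>y \<in> K. E x y) \<and> x \<notin> K" if "x \<in> V" "E v x" for x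
      using that vV(3) by (auto simp: M_def)
    from v(2) show ?thesis
    proof
      assume a: "\<forall>x \<in> M. \<forall>y \<in> M. E v x \<longrightarrow> E v y \<longrightarrow> x \<noteq> y \<longrightarrow> E x y"
      \<comment> \<open>Here \<open>K\<close> itself serves. A neighbour of \<open>v\<close> that is
        not attached to \<open>K\<close> lies in \<open>M\<close>; it is adjacent to the other
        neighbours in \<open>M\<close> by assumption, and to those outside \<open>M\<close> by
        \<open>SM\<close>.\<close>
      have "(\<exists>y \<in> K. E x y) \<or> (\<forall>y \<in> V. E v y \<longrightarrow> x \<noteq> y \<longrightarrow> E x y)" if "x \<in> V" "E v x" for x
        using nb a that SM sym by metis
      then show ?thesis using vV K(2,3) by blast
    next
      assume "\<exists>K. K \<subseteq> M \<and> conn E K \<and> v \<notin> K \<and> (\<forall>x \<in> K. \<not> E v x) \<and>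
        (\<forall>x \<in> M. E v x \<longrightarrow> (\<exists>y \<in> K. E x y) \<or> (\<forall>y \<in> M. E v y \<longrightarrow> x \<noteq> y \<longrightarrow> E x y))"
      then obtain L where L: "L \<subseteq> M" "conn E L" "v \<notin> L" "\<forall>x \<in> L. \<not> E v x"
        "\<forall>x \<in> M. E v x \<longrightarrow> (\<exists>y \<in> L. E x y) \<or> (\<forall>y \<in> M. E v y \<longrightarrow> x \<noteq> y \<longrightarrow> E x y)" by blast
      obtain l where l: "l \<in> L" using conn_nonempty[OF L(2)] by blast
      \<comment> \<open>The set found inside \<open>M\<close> still works in \<open>V\<close>:
        neighbours of \<open>v\<close> outside \<open>M\<close> are attached to \<open>K\<close>, so
        by \<open>SM\<close> they are adjacent to all of \<open>M\<close>, in particular to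
        \<open>L\<close>.\<close>
      have "(\<exists>y \<in> L. E x y) \<or> (\<forall>y \<in> V. E v y \<longrightarrow> x \<noteq> y \<longrightarrow> E x y)" if "x \<in> V" "E v x" for x
      proof (cases "x \<in> M")
        case True
        then show ?thesis using L(5) nb SM sym that by metis
      next
        case False
        then show ?thesis using nb[OF that] SM[OF that(1)] l L(1) by blast
      qed
      moreover have "L \<subseteq> V" using L(1) by (auto simp: M_def)
      ultimately show ?thesis using vV(1) L(2-4) by blast
    qed
  qed
qed

lemma ugraph_quot: "ugraph (quot E V f)"
proof
  show "quot E V f x y \<Longrightarrow> quot E V f y x" for x y unfolding quot_def using sym by metis
  show "\<not> quot E V f x x" for x by (simp add: quot_def)
qed

text \<open>Contracting \<open>K\<close> to a vertex \<open>k\<close> gives the 4-cycle \<open>v a k c\<close> with \<open>b\<close> attached to it.\<close>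
lemma solid_through_neighbours:
  assumes fin: "finite V" and v: "v \<in> V" and abc: "{a, b, c} \<subseteq> V" "E v a" "E v b" "E v c" "a \<noteq> b" "a \<noteq> c" "b \<noteq> c"
    "\<not> E a c"
    and K: "K \<subseteq> V" "conn E K" "v \<notin> K" "\<forall>x \<in> K. \<not> E v x"
      "\<exists>y \<in> K. E a y" "\<exists>y \<in> K. E c y" "(\<exists>y \<in> K. E b y) \<or> E b a \<and> E b c"
  shows "\<exists>S. S \<subseteq> V \<and> solid_set E S \<and> v \<in> S \<and> {x \<in> S. E v x} = {a, b, c}"
proof -
  \<comment> \<open>Contracting \<open>K\<close> onto one of its own vertices keeps the quotient on
    the same type, with \<open>f\<close> the identity off \<open>K\<close>.\<close>
  obtain k where k: "k \<in> K" using conn_nonempty[OF K(2)] by blast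
  define f where "f x = (if x \<in> K then k else x)" for x
  define W where "W = {v, a, b, c} \<union> K"
  have nK: "a \<notin> K" "b \<notin> K" "c \<notin> K" using K(4) abc by auto
  have ne: "v \<noteq> a" "v \<noteq> b" "v \<noteq> c" using abc irrefl by auto
  have f: "f v = v" "f a = a" "f b = b" "f c = c" "\<And>x. x \<in> K \<Longrightarrow> f x = k" "f k = k"
    using K(3) nK k by (auto simp: f_def)
  have "f ` K = {k}" using f(5) k by force
  then have fW: "f ` W = {v, a, b, c, k}" unfolding W_def image_Un using f(1-4) by auto
  have fk: "f x = k \<longleftrightarrow> x \<in> K" if "x \<in> W" for x using that K(3) nK k by (auto simp: f_def W_def)
  have fx: "f x = y \<longleftrightarrow> x = y" if "x \<in> W" "y \<in> {v, a, b, c}" for x y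
    using that K(3) nK k by (auto simp: f_def W_def split: if_splits)
  have inW: "y \<in> W" if "y \<in> {v, a, b, c}" for y using that by (auto simp: W_def)
  have KW: "K \<subseteq> W" by (auto simp: W_def)
  have W: "W \<subseteq> V" using K(1) v abc(1) by (auto simp: W_def)
  let ?Q = "quot E W f"
  interpret Q: ugraph ?Q by (rule ugraph_quot)
  have Qv: "?Q x y \<longleftrightarrow> E x y" if "x \<in> {v, a, b, c}" "y \<in> {v, a, b, c}" for x y
    unfolding quot_def using fx that inW irrefl by metis
  have Qk: "?Q x k \<longleftrightarrow> (\<exists>y \<in> K. E x y)" if "x \<in> {v, a, b, c}" for x
  proof -
    have "x \<noteq> k" using that k K(3) nK by auto
    then show ?thesis unfolding quot_def using fx[OF _ that] fk inW[OF that] KW by (metis subsetD)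
  qed
  have kn: "k \<noteq> v" "k \<noteq> a" "k \<noteq> b" "k \<noteq> c" using k K(3) nK by auto
  have ic: "icycle ?Q [v, a, k, c]"
    using Qv[of v] Qv[of a] Qk[of v] Qk[of a] Qk[of c] Q.sym_iff[of k] abc K(4-6) ne kn by (auto simp: icycle_Cons)
  \<comment> \<open>The vertex \<open>b\<close> sees two opposite vertices of the 4-cycle:
    \<open>v\<close> and \<open>k\<close> if it is attached to \<open>K\<close>, and
    \<open>a\<close> and \<open>c\<close> otherwise.\<close>
  have "\<not> small ?Q (att ?Q (set [v, a, k, c]) {b})"
  proof (cases "\<exists>y \<in> K. E b y")
    case True
    then have "{v, k} \<subseteq> att ?Q (set [v, a, k, c]) {b}"
      using Qv[of v b] abc(3) Qk[of b] Q.sym_iff[of k] by (auto simp: att_def)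
    moreover have "\<not> ?Q v k" using Qk[of v] K(4) by auto
    ultimately show ?thesis using Q.small_adj[of _ v k] kn by auto
  next
    case False
    then have "{a, c} \<subseteq> att ?Q (set [v, a, k, c]) {b}"
      using Qv[of a b] Qv[of c b] K(7) sym by (auto simp: att_def)
    moreover have "\<not> ?Q a c" using Qv[of a c] abc by auto
    ultimately show ?thesis using Q.small_adj[of _ a c] abc by auto
  qed
  then have "ear ?Q [v, a, k, c] [b]"
    using ic ne abc kn by (auto simp: ear_def att_def small_empty)
  then have "solid_set ?Q ({v, a, b, c, k})" 
    using Q.ear_solid[of "[v, a, k, c]" "[b]"] by (simp add: insert_commute)
  moreover have "conn E {x \<in> W. f x = y}" if "y \<in> f ` W" for y
  proof (cases "y = k")
    case True
    then have "{x \<in> W. f x = y} = K" using fk KW by blast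
    then show ?thesis using K(2) by simp
  next
    case False
    then have y: "y \<in> {v, a, b, c}" using that fW by auto
    have "{x \<in> W. f x = y} = {y}" using fx[OF _ y] inW[OF y] by blast
    then show ?thesis using conn_sing[of E y] by simp
  qed
  moreover have "finite W" using W fin finite_subset by blast
  ultimately obtain T where T: "T \<subseteq> W" "solid_set E T" "f ` T = {v, a, b, c, k}"
    using solid_set_lift[OF ugraph_axioms, of W f "{v, a, b, c, k}"] fW by auto
  \<comment> \<open>The fibres of \<open>v\<close>, \<open>a\<close>, \<open>b\<close>,
    \<open>c\<close> are singletons, so the lift contains these vertices. Its other vertices lie in
    \<open>K\<close> and are not adjacent to \<open>v\<close>.\<close>
  have "y \<in> T" if y: "y \<in> {v, a, b, c}" for y
  proof -
    obtain t where "t \<in> T" "f t = y" using T(3) y by (metis image_iff insert_iff)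
    then show ?thesis using fx[OF _ y] T(1) by (metis subsetD)
  qed
  then have "{v, a, b, c} \<subseteq> T" by blast
  moreover from this have "{x \<in> T. E v x} = {a, b, c}"
    using T(1) abc(2-4) K(4) irrefl unfolding W_def by auto
  moreover have "T \<subseteq> V" using T(1) W by (rule subset_trans)
  ultimately show ?thesis using T(2) by auto
qed

end

section \<open>Colourings\<close>

definition colourable :: "('a \<Rightarrow> 'a \<Rightarrow> bool) \<Rightarrow> 'a set \<Rightarrow> nat \<Rightarrow> bool" where
  "colourable E V k \<longleftrightarrow> (\<exists>f. (\<forall>v \<in> V. f v < k) \<and> (\<forall>x \<in> V. \<forall>y \<in> V. E x y \<longrightarrow> f x \<noteq> f y))"

context ugraph
begin

lemma colourable_insert:
  assumes "colourable E V k" "finite V" "card {x \<in> V. E v x} < k"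
  shows "colourable E (insert v V) k"
proof -
  obtain f where f: "\<forall>v \<in> V. f v < k" "\<forall>x \<in> V. \<forall>y \<in> V. E x y \<longrightarrow> f x \<noteq> f y"
    using assms(1) unfolding colourable_def by blast
  have "card (f ` {x \<in> V. E v x}) < card {..<k}"
    using card_image_le[of "{x \<in> V. E v x}" f] assms(2,3) by simp
  then have "\<not> {..<k} \<subseteq> f ` {x \<in> V. E v x}"
    using card_mono[of "f ` {x \<in> V. E v x}" "{..<k}"] assms(2) by auto
  then obtain c where c: "c < k" "c \<notin> f ` {x \<in> V. E v x}" by auto
  have "(f(v := c)) x \<noteq> (f(v := c)) y" if "x \<in> insert v V" "y \<in> insert v V" "E x y" for x y
    using that f(2) c(2) irrefl sym by (cases "x = v"; cases "y = v") auto
  moreover have "(f(v := c)) x < k" if "x \<in> insert v V" for x using that f(1) c(1) by auto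
  ultimately show ?thesis unfolding colourable_def by blast
qed

lemma colourable_insert_Suc:
  assumes "colourable E V k"
  shows "colourable E (insert v V) (Suc k)"
proof -
  obtain f where f: "\<forall>v \<in> V. f v < k" "\<forall>x \<in> V. \<forall>y \<in> V. E x y \<longrightarrow> f x \<noteq> f y"
    using assms(1) unfolding colourable_def by blast
  have "(f(v := k)) x \<noteq> (f(v := k)) y" if "x \<in> insert v V" "y \<in> insert v V" "E x y" for x y
    using that f irrefl by (cases "x = v"; cases "y = v") auto
  moreover have "(f(v := k)) x < Suc k" if "x \<in> insert v V" for x using that f(1) by (auto simp: less_Suc_eq)
  ultimately show ?thesis unfolding colourable_def by blast
qed

text \<open>Each triple of neighbours of \<open>v\<close> is the full neighbourhood of
  \<open>v\<close> in some solid, so different triples have different solids. A triple of pairwise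
  adjacent neighbours forms a K^4 with \<open>v\<close>.\<close>

lemma ex_vertex_many_solids:
  assumes fin: "finite V" and "V \<noteq> {}"
  shows "\<exists>v \<in> V. card {x \<in> V. E v x} choose 3 \<le> card {S. S \<subseteq> V \<and> solid_set E S \<and> v \<in> S}"
proof -
  obtain v where v: "v \<in> V"
    and dis: "(\<forall>x \<in> V. \<forall>y \<in> V. E v x \<longrightarrow> E v y \<longrightarrow> x \<noteq> y \<longrightarrow> E x y) \<or>
    (\<exists>K. K \<subseteq> V \<and> conn E K \<and> v \<notin> K \<and> (\<forall>x \<in> K. \<not> E v x) \<and>
      (\<forall>x \<in> V. E v x \<longrightarrow> (\<exists>y \<in> K. E x y) \<or> (\<forall>y \<in> V. E v y \<longrightarrow> x \<noteq> y \<longrightarrow> E x y)))"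
    using ex_moplex_vertex[OF assms] by blast
  let ?N = "{x \<in> V. E v x}" and ?S = "{S. S \<subseteq> V \<and> solid_set E S \<and> v \<in> S}"
  have nonadj: "\<exists>S \<in> ?S. {x \<in> S. E v x} = {a, b, c}"
    if abc: "a \<in> ?N" "b \<in> ?N" "c \<in> ?N" "a \<noteq> b" "a \<noteq> c" "b \<noteq> c" "\<not> E a c" for a b c
  proof -
    obtain K where K: "K \<subseteq> V" "conn E K" "v \<notin> K" "\<forall>x \<in> K. \<not> E v x"
      "\<And>x. x \<in> ?N \<Longrightarrow> (\<exists>y \<in> K. E x y) \<or> (\<forall>y \<in> ?N. x \<noteq> y \<longrightarrow> E x y)"
    proof -
      have "\<not> (\<forall>x \<in> V. \<forall>y \<in> V. E v x \<longrightarrow> E v y \<longrightarrow> x \<noteq> y \<longrightarrow> E x y)" using abc by auto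
      with dis obtain K where "K \<subseteq> V" "conn E K" "v \<notin> K" "\<forall>x \<in> K. \<not> E v x"
        "\<forall>x \<in> V. E v x \<longrightarrow> (\<exists>y \<in> K. E x y) \<or> (\<forall>y \<in> V. E v y \<longrightarrow> x \<noteq> y \<longrightarrow> E x y)" by auto
      then show thesis by (intro that[of K]) auto
    qed
    \<comment> \<open>As \<open>a\<close> and \<open>c\<close> are nonadjacent, neither is adjacent
      to all other neighbours of \<open>v\<close>, so both are attached to \<open>K\<close>.\<close>
    have "\<exists>S. S \<subseteq> V \<and> solid_set E S \<and> v \<in> S \<and> {x \<in> S. E v x} = {a, b, c}"
    proof (rule solid_through_neighbours[OF fin v _ _ _ _ abc(4-7) K(1-4)])
      show "\<exists>y \<in> K. E a y" using K(5)[OF abc(1)] abc(3,5,7) by blast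
      show "\<exists>y \<in> K. E c y" using K(5)[OF abc(3)] abc(1,5,7) sym[of c a] by metis
      show "(\<exists>y \<in> K. E b y) \<or> E b a \<and> E b c" using K(5)[OF abc(2)] abc(1,3,4,6) by metis
    qed (use abc in auto)
    then show ?thesis by blast
  qed
  have ex: "\<exists>S \<in> ?S. {x \<in> S. E v x} = J" if J: "J \<subseteq> ?N" "card J = 3" for J
  proof -
    obtain a b c where abc: "J = {a, b, c}" "a \<noteq> b" "a \<noteq> c" "b \<noteq> c" using J(2) by (metis card_3_iff)
    have N: "a \<in> ?N" "b \<in> ?N" "c \<in> ?N" using J(1) abc(1) by auto
    consider "\<not> E a c" | "\<not> E a b" | "\<not> E b c" | "E a b" "E a c" "E b c" by blast
    then show ?thesis
    proof cases
      case 1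
      then show ?thesis using nonadj[of a b c] N abc by auto
    next
      case 2
      then show ?thesis using nonadj[of a c b] N abc by (auto simp: insert_commute)
    next
      case 3
      then show ?thesis using nonadj[of b a c] N abc by (auto simp: insert_commute)
    next
      case 4
      have ne: "v \<noteq> a" "v \<noteq> b" "v \<noteq> c" using N irrefl by auto
      have "solid_set E {v, a, b, c}"
      proof (rule solid_set_complete4)
        show "card {v, a, b, c} = 4" using ne abc by simp
        show "E x y \<longleftrightarrow> x \<noteq> y" if "x \<in> {v, a, b, c}" "y \<in> {v, a, b, c}" for x y
          using that N 4 irrefl sym by auto
      qed
      moreover have "{x \<in> {v, a, b, c}. E v x} = {a, b, c}" using N irrefl by auto
      moreover have "{v, a, b, c} \<subseteq> V" using N v by auto
      ultimately show ?thesis using abc(1) by blast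
    qed
  qed
  have finN: "finite ?N" "finite ?S" using fin by auto
  have "card ?N choose 3 = card {J. J \<subseteq> ?N \<and> card J = 3}" using n_subsets[OF finN(1)] by simp
  also have "\<dots> \<le> card ((\<lambda>S. {x \<in> S. E v x}) ` ?S)"
    using ex finN(2) by (intro card_mono) blast+
  also have "\<dots> \<le> card ?S" using finN(2) by (rule card_image_le)
  finally show ?thesis using v by blast
qed

text \<open>Solids are counted according to whether they contain \<open>v\<close>. If
  \<open>v\<close> has degree below \<open>k\<close>, then \<open>V - {v}\<close> is not
  \<open>k\<close>-colourable either, by greedy colouring, and has enough solids. Otherwise
  \<open>V - {v}\<close> is not colourable with one colour less, which gives
  \<open>k choose 4\<close> solids avoiding \<open>v\<close>, and \<open>v\<close> lies in
  \<open>k choose 3\<close> others. For \<open>k = 0\<close> the bound is zero.\<close>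

lemma solids_of_not_colourable:
  assumes "finite V" "\<not> colourable E V k"
  shows "Suc k choose 4 \<le> card {S. S \<subseteq> V \<and> solid_set E S}"
  using assms
proof (induction "card V" arbitrary: V k rule: less_induct)
  case less
  have fin: "finite V" by fact
  have "V \<noteq> {}" using less.prems(2) unfolding colourable_def by auto
  then obtain v where v: "v \<in> V"
    "card {x \<in> V. E v x} choose 3 \<le> card {S. S \<subseteq> V \<and> solid_set E S \<and> v \<in> S}"
    using ex_vertex_many_solids[OF fin] by blast
  let ?V = "V - {v}"
  let ?A = "{S. S \<subseteq> ?V \<and> solid_set E S}" and ?B = "{S. S \<subseteq> V \<and> solid_set E S \<and> v \<in> S}"
  have V: "V = insert v ?V" "card ?V < card V" "finite ?V"
    using v(1) fin card_Diff1_less[OF fin v(1)] by auto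
  have N: "{x \<in> V. E v x} = {x \<in> ?V. E v x}" using irrefl by auto
  have "{S. S \<subseteq> V \<and> solid_set E S} = ?A \<union> ?B" by auto
  moreover have "?A \<inter> ?B = {}" by auto
  ultimately have un: "card {S. S \<subseteq> V \<and> solid_set E S} = card ?A + card ?B"
    using fin by (simp add: card_Un_disjoint)
  show ?case
  proof (cases "card {x \<in> V. E v x} < k")
    case True
    then have "\<not> colourable E ?V k" using colourable_insert[of ?V k v] less.prems(2) V N by auto
    then show ?thesis using less.hyps[OF V(2,3)] un by fastforce
  next
    case False
    show ?thesis
    proof (cases k)
      case (Suc j)
      then have "\<not> colourable E ?V j" using colourable_insert_Suc[of ?V j v] less.prems(2) V(1) by auto
      then have "k choose 4 \<le> card ?A" using less.hyps[OF V(2,3)] Suc by blast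
      moreover have "k choose 3 \<le> card ?B"
        using binomial_right_mono[of k "card {x \<in> V. E v x}" 3] v(2) False by simp
      moreover have "Suc k choose 4 = (k choose 3) + (k choose 4)" by (simp add: eval_nat_numeral)
      ultimately show ?thesis using un by linarith
    qed (simp add: binomial_eq_0)
  qed
qed

end

section \<open>Solids of a graph\<close>

definition induced :: "('a \<Rightarrow> 'a \<Rightarrow> bool) \<Rightarrow> 'a set \<Rightarrow> 'a pair_pre_digraph" where
  "induced E S = \<lparr> pverts = S, parcs = {(x, y). x \<in> S \<and> y \<in> S \<and> E x y} \<rparr>"

section \<open>From solid sets to the graphs of the definition of a solid\<close>

lemma parcs_path_append:
  assumes "p \<noteq> []" "q \<noteq> []"
  shows "parcs (path_graph (p @ q)) =
    parcs (path_graph p) \<union> parcs (path_graph q) \<union> {(last p, hd q), (hd q, last p)}"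
  using assms
proof (induction p)
  case (Cons x p)
  show ?case
  proof (cases "p = []")
    case True
    then show ?thesis using Cons.prems by (cases q) (auto simp: path_graph_def)
  next
    case False
    have *: "parcs (path_graph (x # r)) = parcs (path_graph r) \<union> {(x, hd r), (hd r, x)}" if "r \<noteq> []" for r
      using that by (cases r) (auto simp: path_graph_def)
    show ?thesis using False Cons *[of p] *[of "p @ q"] by auto
  qed
qed simp

context ugraph
begin

lemma path_graph_induced:
  assumes "ipath E p"
  shows "path_graph p = induced E (set p)"
proof -
  have "parcs (path_graph p) = {(x, y). x \<in> set p \<and> y \<in> set p \<and> E x y}"
    using assms
  proof (induction p)
    case (Cons x p)
    show ?case
    proof (cases "p = []")
      case True
      then show ?thesis using irrefl by (auto simp: path_graph_def)
    next
      case False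
      then have "hd p \<in> set p" by simp
      moreover have "parcs (path_graph (x # p)) = parcs (path_graph p) \<union> {(x, hd p), (hd p, x)}"
        using parcs_path_append[of "[x]" p] False by (auto simp: path_graph_def)
      ultimately show ?thesis using Cons irrefl sym_iff[of _ x] by auto
    qed
  qed (simp add: path_graph_def)
  then show ?thesis by (simp add: path_graph_def induced_def)
qed

lemma cycle_graph_induced:
  assumes "icycle E c"
  shows "cycle_graph c = induced E (set c)"
proof -
  obtain z d where c: "c = z # d" using icycle_nonempty[OF assms] by (cases c) auto
  have d: "z \<notin> set d" "ipath E d" "d \<noteq> []" "\<And>y. y \<in> set d \<Longrightarrow> E z y \<longleftrightarrow> y = hd d \<or> y = last d"
    using assms unfolding c icycle_Cons by auto
  have "parcs (cycle_graph c) = parcs (path_graph d) \<union> {(z, hd d), (hd d, z), (last d, z), (z, last d)}"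
    using parcs_path_append[of "[z]" "d @ [z]"] parcs_path_append[of d "[z]"] d(3)
    by (auto simp: cycle_graph_def c path_graph_def)
  also have "\<dots> = {(x, y). x \<in> set c \<and> y \<in> set c \<and> E x y}"
    unfolding path_graph_induced[OF d(2)] induced_def c
    using d(1,4) irrefl sym_iff[of _ z] hd_in_set[OF d(3)] last_in_set[OF d(3)] by auto
  finally show ?thesis by (auto simp: cycle_graph_def path_graph_def induced_def c)
qed

lemma graph_Union_induced:
  assumes "\<And>x y. x \<in> \<Union>\<A> \<Longrightarrow> y \<in> \<Union>\<A> \<Longrightarrow> E x y \<Longrightarrow> \<exists>A \<in> \<A>. x \<in> A \<and> y \<in> A"
  shows "graph_Union (induced E ` \<A>) = induced E (\<Union>\<A>)"
  using assms unfolding graph_Union_def induced_def by auto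

text \<open>Each shape is a union of induced paths and cycles, and by
  \<open>graph_Union_induced\<close> it remains to see that every edge lies inside one of the
  pieces.\<close>

lemma solid_graph_induced:
  assumes "solid_set E S"
  shows "solid_graph (induced E S)"
  using assms
proof (cases rule: solid_setE)
  case (ipyramid c w)
  let ?N = "{x \<in> set c. E w x}"
  have c: "icycle E c" "w \<notin> set c" "3 \<le> card ?N" using ipyramid(1) by (auto simp: ipyramid_def)
  have "distinct c" "3 \<le> length c"
    using c(1) ipath_distinct[of E] by (auto simp: icycle_def)
  moreover have "induced E S = \<lparr> pverts = insert w (set c),
      parcs = parcs (cycle_graph c) \<union> {w} \<times> ?N \<union> ?N \<times> {w} \<rparr>"
    unfolding cycle_graph_induced[OF c(1)] ipyramid(2) induced_def using irrefl sym_iff[of _ w] by auto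
  ultimately have "pyramid (induced E S)"
    unfolding pyramid_def using c(2,3) by (intro exI[of _ c] exI[of _ w] exI[of _ ?N]) auto
  then show ?thesis by (simp add: solid_graph_def)
next
  case (itrihedron z y p q r)
  have arms: "ipath E p" "ipath E q" "ipath E r" "p \<noteq> []" "q \<noteq> []" "r \<noteq> []"
    "set p \<inter> set q = {}" "set p \<inter> set r = {}" "set q \<inter> set r = {}"
    and zy: "z \<noteq> y" "\<not> E z y"
    and a: "apex E z p" "apex E z q" "apex E z r" "apex E y (rev p)" "apex E y (rev q)" "apex E y (rev r)"
    and n: "\<forall>x \<in> set p. \<forall>x' \<in> set q. \<not> E x x'" "\<forall>x \<in> set p. \<forall>x' \<in> set r. \<not> E x x'"
    "\<forall>x \<in> set q. \<forall>x' \<in> set r. \<not> E x x'"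
    using itrihedron(1) unfolding itrihedron_def arms_def by blast+
  have n': "\<forall>x \<in> set q. \<forall>x' \<in> set p. \<not> E x x'" "\<forall>x \<in> set r. \<forall>x' \<in> set p. \<not> E x x'"
    "\<forall>x \<in> set r. \<forall>x' \<in> set q. \<not> E x x'"
    using n sym by blast+
  \<comment> \<open>The lists omit the branch vertices, which are the ends of the paths in
    \<open>trihedron\<close>.\<close>
  have ip: "ipath E (z # p @ [y])" if "ipath E p" "p \<noteq> []" "apex E z p" "apex E y (rev p)" for p
  proof -
    have "E x y \<longleftrightarrow> x = last p" if "x \<in> set p" for x
      using that \<open>apex E y (rev p)\<close> sym_iff[of x y] by (auto simp: apex_def hd_rev)
    then show ?thesis using that zy by (auto simp: ipath_append apex_def)
  qed
  have pf: "path_from_to z (z # p @ [y]) y" "2 \<le> length (z # p @ [y]) - 1"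
    if "ipath E p" "p \<noteq> []" "apex E z p" "apex E y (rev p)" for p
    using ipath_distinct[OF ip[OF that]] that(2) by (auto simp: path_from_to_def Suc_le_eq)
  let ?P = "set (z # p @ [y])" and ?Q = "set (z # q @ [y])" and ?R = "set (z # r @ [y])"
  have "graph_Union (induced E ` {?P, ?Q, ?R}) = induced E (\<Union>{?P, ?Q, ?R})"
    by (intro graph_Union_induced) (use n n' in auto)
  moreover have "S = \<Union>{?P, ?Q, ?R}" unfolding itrihedron(2) by auto
  ultimately have "induced E S = graph_Union {path_graph (z # p @ [y]), path_graph (z # q @ [y]), path_graph (z # r @ [y])}"
    using path_graph_induced[OF ip[OF arms(1,4) a(1,4)]] path_graph_induced[OF ip[OF arms(2,5) a(2,5)]]
      path_graph_induced[OF ip[OF arms(3,6) a(3,6)]] by simp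
  moreover have "?P \<inter> ?Q \<subseteq> {z, y}" "?P \<inter> ?R \<subseteq> {z, y}" "?Q \<inter> ?R \<subseteq> {z, y}" using arms by auto
  ultimately have "trihedron (induced E S)"
    unfolding trihedron_def using zy(1) pf[OF arms(1,4) a(1,4)] pf[OF arms(2,5) a(2,5)] pf[OF arms(3,6) a(3,6)]
    by blast
  then show ?thesis by (simp add: solid_graph_def)
next
  case (istamp z p q r)
  have arms: "ipath E p" "ipath E q" "ipath E r" "p \<noteq> []" "q \<noteq> []" "r \<noteq> []"
    "set p \<inter> set q = {}" "set p \<inter> set r = {}" "set q \<inter> set r = {}"
    and a: "apex E z p" "apex E z q" "apex E z r"
    and n: "\<forall>x \<in> set p. \<forall>x' \<in> set q. E x x' \<longleftrightarrow> x = last p \<and> x' = last q"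
      "\<forall>x \<in> set p. \<forall>x' \<in> set r. E x x' \<longleftrightarrow> x = last p \<and> x' = last r"
      "\<forall>x \<in> set q. \<forall>x' \<in> set r. E x x' \<longleftrightarrow> x = last q \<and> x' = last r"
    using istamp(1) unfolding istamp_def arms_def by blast+
  have n4: "\<forall>x \<in> set q. \<forall>x' \<in> set p. E x x' \<longleftrightarrow> x = last q \<and> x' = last p"
    using n(1) sym by blast
  have n5: "\<forall>x \<in> set r. \<forall>x' \<in> set p. E x x' \<longleftrightarrow> x = last r \<and> x' = last p"
    using n(2) sym by blast
  have n6: "\<forall>x \<in> set r. \<forall>x' \<in> set q. E x x' \<longleftrightarrow> x = last r \<and> x' = last q"
    using n(3) sym by blast
  note n' = n4 n5 n6
  \<comment> \<open>In \<open>stamp\<close> the paths run from the triangle to the apex, opposite to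
    \<open>istamp\<close>.\<close>
  have ip: "ipath E (rev p @ [z])" if "ipath E p" "apex E z p" "p \<noteq> []" for p
  proof -
    have "E x z \<longleftrightarrow> x = hd p" if "x \<in> set p" for x
      using that \<open>apex E z p\<close> sym_iff[of x z] by (auto simp: apex_def)
    then show ?thesis using that by (auto simp: ipath_append ipath_rev apex_def last_rev)
  qed
  have pf: "path_from_to (last p) (rev p @ [z]) z" "1 \<le> length (rev p @ [z]) - 1"
    if "ipath E p" "apex E z p" "p \<noteq> []" for p
    using ipath_distinct[OF ip[OF that]] that(3) by (auto simp: path_from_to_def Suc_le_eq hd_append hd_rev)
  have l: "last p \<in> set p" "last q \<in> set q" "last r \<in> set r" using arms by auto
  have ne: "last p \<noteq> last q" "last p \<noteq> last r" "last q \<noteq> last r" using l arms by (metis disjoint_iff)+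
  have zn: "z \<notin> set p" "z \<notin> set q" "z \<notin> set r" using a by (auto simp: apex_def)
  let ?P = "set (rev p @ [z])" and ?Q = "set (rev q @ [z])" and ?R = "set (rev r @ [z])"
    and ?T = "{last p, last q, last r}"
  have tri: "cycle_graph [last p, last q, last r] = induced E ?T"
    using cycle_graph_induced[OF icycle_of_triangle[of "last p" "last q" "last r"]] ne n l by simp
  have "graph_Union (induced E ` {?T, ?P, ?Q, ?R}) = induced E (\<Union>{?T, ?P, ?Q, ?R})"
    by (intro graph_Union_induced) (use n n' l in auto)
  moreover have "S = \<Union>{?T, ?P, ?Q, ?R}" unfolding istamp(2) using l by auto
  ultimately have "induced E S = graph_Union {cycle_graph [last p, last q, last r],
      path_graph (rev p @ [z]), path_graph (rev q @ [z]), path_graph (rev r @ [z])}"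
    using path_graph_induced[OF ip[OF arms(1) a(1) arms(4)]] path_graph_induced[OF ip[OF arms(2) a(2) arms(5)]]
      path_graph_induced[OF ip[OF arms(3) a(3) arms(6)]] tri by simp
  moreover have "(?P - {z}) \<inter> (?Q - {z}) = {}" "(?P - {z}) \<inter> (?R - {z}) = {}" "(?Q - {z}) \<inter> (?R - {z}) = {}"
    using arms by auto
  moreover have "?P \<inter> ?T = {last p}" "?Q \<inter> ?T = {last q}" "?R \<inter> ?T = {last r}"
    using arms(7-9) l zn by (auto simp: disjoint_iff)
  moreover have "distinct [last p, last q, last r]" "z \<notin> ?T" using ne l zn by auto
  ultimately have "stamp (induced E S)"
    unfolding stamp_def using pf[OF arms(1) a(1) arms(4)] pf[OF arms(2) a(2) arms(5)] pf[OF arms(3) a(3) arms(6)]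
    by blast
  then show ?thesis by (simp add: solid_graph_def)
next
  case (iprism p q r)
  have arms: "ipath E p" "ipath E q" "ipath E r" "p \<noteq> []" "q \<noteq> []" "r \<noteq> []"
    "set p \<inter> set q = {}" "set p \<inter> set r = {}" "set q \<inter> set r = {}"
    and hl: "hd p \<noteq> last p" "hd q \<noteq> last q" "hd r \<noteq> last r"
    and n: "\<forall>x \<in> set p. \<forall>x' \<in> set q. E x x' \<longleftrightarrow> x = hd p \<and> x' = hd q \<or> x = last p \<and> x' = last q"
      "\<forall>x \<in> set p. \<forall>x' \<in> set r. E x x' \<longleftrightarrow> x = hd p \<and> x' = hd r \<or> x = last p \<and> x' = last r"
      "\<forall>x \<in> set q. \<forall>x' \<in> set r. E x x' \<longleftrightarrow> x = hd q \<and> x' = hd r \<or> x = last q \<and> x' = last r"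
    using iprism(1) unfolding iprism_def arms_def by blast+
  have n4: "\<forall>x \<in> set q. \<forall>x' \<in> set p. E x x' \<longleftrightarrow> x = hd q \<and> x' = hd p \<or> x = last q \<and> x' = last p"
    using n(1) sym by blast
  have n5: "\<forall>x \<in> set r. \<forall>x' \<in> set p. E x x' \<longleftrightarrow> x = hd r \<and> x' = hd p \<or> x = last r \<and> x' = last p"
    using n(2) sym by blast
  have n6: "\<forall>x \<in> set r. \<forall>x' \<in> set q. E x x' \<longleftrightarrow> x = hd r \<and> x' = hd q \<or> x = last r \<and> x' = last q"
    using n(3) sym by blast
  note n' = n4 n5 n6
  have l: "last p \<in> set p" "last q \<in> set q" "last r \<in> set r" "hd p \<in> set p" "hd q \<in> set q" "hd r \<in> set r"
    using arms by auto
  have d: "distinct [hd p, hd q, hd r, last p, last q, last r]"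
    using l arms(7-9) hl by (simp add: disjoint_iff) metis
  have pf: "path_from_to (hd p) p (last p)" if "ipath E p" "p \<noteq> []" for p
    using ipath_distinct[OF that(1)] that(2) by (simp add: path_from_to_def)
  let ?T = "{hd p, hd q, hd r}" and ?T' = "{last p, last q, last r}"
  have tri: "cycle_graph [hd p, hd q, hd r] = induced E ?T" "cycle_graph [last p, last q, last r] = induced E ?T'"
    using cycle_graph_induced[OF icycle_of_triangle[of "hd p" "hd q" "hd r"]]
      cycle_graph_induced[OF icycle_of_triangle[of "last p" "last q" "last r"]] d n l by simp_all
  have "graph_Union (induced E ` {?T, ?T', set p, set q, set r}) = induced E (\<Union>{?T, ?T', set p, set q, set r})"
  proof (rule graph_Union_induced)
    fix x y assume xy: "x \<in> \<Union>{?T, ?T', set p, set q, set r}" "y \<in> \<Union>{?T, ?T', set p, set q, set r}" "E x y"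
    \<comment> \<open>An edge between two different paths joins first vertices or last vertices, so
      it belongs to one of the triangles.\<close>
    have "x \<in> ?T \<and> y \<in> ?T \<or> x \<in> ?T' \<and> y \<in> ?T'"
      if "x \<in> A" "y \<in> B" "\<forall>x \<in> A. \<forall>y \<in> B. E x y \<longleftrightarrow> x = a \<and> y = b \<or> x = c \<and> y = d"
        "{a, b} \<subseteq> ?T" "{c, d} \<subseteq> ?T'" for A B a b c d
    proof -
      have "x = a \<and> y = b \<or> x = c \<and> y = d" using that(1-3) xy(3) by simp
      then show ?thesis using that(4,5) by auto
    qed
    note across = this[OF _ _ n(1)] this[OF _ _ n(2)] this[OF _ _ n(3)] this[OF _ _ n'(1)] this[OF _ _ n'(2)]
      this[OF _ _ n'(3)]
    have "x \<in> set p \<union> set q \<union> set r" "y \<in> set p \<union> set q \<union> set r" using xy(1,2) l by auto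
    then show "\<exists>A \<in> {?T, ?T', set p, set q, set r}. x \<in> A \<and> y \<in> A"
      using across by (elim UnE) (simp_all, blast+)
  qed
  moreover have "S = \<Union>{?T, ?T', set p, set q, set r}" unfolding iprism(2) using l by auto
  ultimately have "induced E S = graph_Union {cycle_graph [hd p, hd q, hd r], cycle_graph [last p, last q, last r],
      path_graph p, path_graph q, path_graph r}"
    using path_graph_induced[OF arms(1)] path_graph_induced[OF arms(2)] path_graph_induced[OF arms(3)] tri by simp
  then have "prism (induced E S)"
    unfolding prism_def using d pf[OF arms(1,4)] pf[OF arms(2,5)] pf[OF arms(3,6)] arms(7-9) by blast
  then show ?thesis by (simp add: solid_graph_def)
qed

end

section \<open>Transfer to the graph \<open>G\<close>, its Hadwiger number and its chromatic
  number\<close>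

lemma digraph_iso_refl:
  assumes "wf_digraph (with_proj G)"
  shows "digraph_iso (with_proj G) (with_proj G)"
proof -
  let ?f = "\<lparr> iso_verts = id, iso_arcs = id, iso_head = snd, iso_tail = fst \<rparr>"
  have "pre_digraph.digraph_isomorphism (with_proj G) ?f"
    using assms by (simp add: pre_digraph.digraph_isomorphism_def)
  moreover have "with_proj G = app_iso ?f (with_proj G)"
    by (simp add: app_iso_def with_proj_def)
  ultimately show ?thesis unfolding digraph_iso_def by blast
qed

context pair_graph
begin

abbreviation "adj u v \<equiv> (u, v) \<in> parcs G"

lemma ugraph_adj: "ugraph adj"
proof
  show "adj u v \<Longrightarrow> adj v u" for u v using pair_sym_arcs by (auto simp: symmetric_def elim: symE)
  show "\<not> adj u u" for u using pair_no_loops by fastforce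
qed

text \<open>An induced subgraph determines its vertex set, so the map is injective. Finiteness of
  \<open>solids G\<close> is essential, as \<open>card\<close> of an infinite set is 0.\<close>

lemma card_solid_sets_le: "card {S. S \<subseteq> pverts G \<and> solid_set adj S} \<le> card (solids G)"
proof (rule card_inj_on_le)
  show "inj_on (induced adj) {S. S \<subseteq> pverts G \<and> solid_set adj S}"
    by (auto simp: inj_on_def induced_def)
  have wf: "wf_digraph (with_proj G)" by unfold_locales
  show "induced adj ` {S. S \<subseteq> pverts G \<and> solid_set adj S} \<subseteq> solids G"
  proof clarify
    fix S assume S: "S \<subseteq> pverts G" "solid_set adj S"
    have wfS: "wf_digraph (with_proj (induced adj S))"
      by unfold_locales (auto simp: induced_def)
    then have "induced_subgraph (with_proj (induced adj S)) (with_proj G)"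
      using S(1) wf unfolding induced_subgraph_def subgraph_def compatible_def
      by (auto simp: induced_def)
    moreover have "solid_graph (induced adj S)" using ugraph.solid_graph_induced[OF ugraph_adj S(2)] .
    ultimately show "induced adj S \<in> solids G"
      unfolding solids_def using digraph_iso_refl[OF wfS] by blast
  qed
  have "solids G \<subseteq> (\<lambda>(V, A). \<lparr> pverts = V, parcs = A \<rparr>) ` (Pow (pverts G) \<times> Pow (parcs G))"
  proof
    fix H assume "H \<in> solids G"
    then have "pverts H \<in> Pow (pverts G)" "parcs H \<in> Pow (parcs G)"
      by (auto simp: solids_def induced_subgraph_def subgraph_def)
    moreover have "H = (\<lambda>(V, A). \<lparr> pverts = V, parcs = A \<rparr>) (pverts H, parcs H)" by simp
    ultimately show "H \<in> (\<lambda>(V, A). \<lparr> pverts = V, parcs = A \<rparr>) ` (Pow (pverts G) \<times> Pow (parcs G))" by blast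
  qed
  then show "finite (solids G)"
    by (rule finite_subset) (simp add: pair_finite_verts pair_finite_arcs)
qed

text \<open>A walk that starts in \<open>X\<close> cannot leave it if no edge crosses the cut; arcs
  of the symmetric closure are edges of \<open>G\<close> anyway.\<close>

lemma conn_of_connected:
  assumes "Digraph_Component.connected (with_proj G \<restriction> B)"
  shows "conn adj B"
  unfolding conn_def
proof (intro conjI allI impI)
  let ?H = "mk_symmetric (with_proj G \<restriction> B)"
  have verts: "pverts ?H = B" by (simp add: mk_symmetric_def)
  have arcs: "adj x y \<and> x \<in> B \<and> y \<in> B" if "(x, y) \<in> parcs ?H" for x y
    using that ugraph.sym[OF ugraph_adj] by (auto simp: mk_symmetric_def)
  have c: "B \<noteq> {}" "\<And>u v. u \<in> B \<Longrightarrow> v \<in> B \<Longrightarrow> u \<rightarrow>\<^sup>*\<^bsub>with_proj ?H\<^esub> v"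
    using assms verts unfolding Digraph_Component.connected_def strongly_connected_def by auto
  show "B \<noteq> {}" by fact
  fix X assume X: "X \<subseteq> B \<and> X \<noteq> {} \<and> X \<noteq> B"
  then obtain u v where uv: "u \<in> X" "v \<in> B" "v \<notin> X" by blast
  show "\<exists>x \<in> X. \<exists>y \<in> B - X. adj x y"
  proof (rule ccontr)
    assume no: "\<not> (\<exists>x \<in> X. \<exists>y \<in> B - X. adj x y)"
    have "(u, v) \<in> rtrancl_on B (parcs ?H)"
      using c(2)[of u v] uv X verts by (auto simp: reachable_def)
    then have "v \<in> X"
    proof (induction rule: rtrancl_on_induct)
      case base
      then show ?case using uv by blast
    next
      case (step y z)
      then show ?case using arcs[of y z] no by blast
    qed
    then show False using uv by blast
  qed
qed

text \<open>The second claim, from one representative per branch set, bounds the set whose maximum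
  is \<open>hadwiger_number G\<close>.\<close>

lemma solids_of_clique_minor:
  assumes "K\<^bsub>t\<^esub> (with_proj K)" "minor K G"
  shows "t choose 4 \<le> card (solids G)" "t \<le> card (pverts G)"
proof -
  have K: "finite (pverts K)" "card (pverts K) = t" 
    "parcs K = {(u, v). (u, v) \<in> pverts K \<times> pverts K \<and> u \<noteq> v}"
    using assms(1) unfolding complete_digraph_pair_def by auto
  obtain B where B: "\<forall>x \<in> pverts K. B x \<subseteq> pverts G \<and> Digraph_Component.connected (with_proj G \<restriction> B x)"
    "\<forall>x \<in> pverts K. \<forall>y \<in> pverts K. x \<noteq> y \<longrightarrow> B x \<inter> B y = {}"
    "\<forall>(x, y) \<in> parcs K. \<exists>u \<in> B x. \<exists>v \<in> B y. (u, v) \<in> parcs G"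
    using assms(2) unfolding minor_def by blast
  have c: "B x \<subseteq> pverts G \<and> conn adj (B x)" if "x \<in> pverts K" for x
    using B(1) that conn_of_connected by blast
  have "card (pverts K) choose 4 \<le> card {S. S \<subseteq> pverts G \<and> solid_set adj S}"
  proof (rule solids_of_branch_sets[OF ugraph_adj K(1) c pair_finite_verts])
    show "B i \<inter> B j = {}" if "i \<in> pverts K" "j \<in> pverts K" "i \<noteq> j" for i j using B(2) that by blast
    show "\<exists>x \<in> B i. \<exists>y \<in> B j. adj x y" if "i \<in> pverts K" "j \<in> pverts K" "i \<noteq> j" for i j
      using B(3) that unfolding K(3) by blast
  qed
  then show "t choose 4 \<le> card (solids G)" using card_solid_sets_le K(2) by simp
  define g where "g x = (SOME u. u \<in> B x)" for x
  have g: "g x \<in> B x" if "x \<in> pverts K" for x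
    using c[OF that] conn_nonempty unfolding g_def by (metis some_in_eq)
  have "inj_on g (pverts K)"
    using g B(2) unfolding inj_on_def by (metis disjoint_iff)
  then show "t \<le> card (pverts G)"
    using card_inj_on_le[of g "pverts K" "pverts G"] g c pair_finite_verts K(2) by blast
qed

lemma solids_of_hadwiger_number: "hadwiger_number G choose 4 \<le> card (solids G)"
proof -
  let ?A = "{t. \<exists>K :: nat pair_pre_digraph. K\<^bsub>t\<^esub> (with_proj K) \<and> minor K G}"
  \<comment> \<open>The empty clique shows that the set of orders is nonempty, so its maximum is
    attained.\<close>
  let ?K0 = "\<lparr> pverts = {}, parcs = {} \<rparr> :: nat pair_pre_digraph"
  have "K\<^bsub>0\<^esub> (with_proj ?K0)" unfolding complete_digraph_pair_def by simp
  moreover have "minor ?K0 G" unfolding minor_def by simp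
  ultimately have "?A \<noteq> {}" by blast
  moreover have "?A \<subseteq> {..card (pverts G)}" using solids_of_clique_minor(2) by blast
  ultimately have "Max ?A \<in> ?A" by (intro Max_in) (auto intro: finite_subset)
  then show ?thesis unfolding hadwiger_number_def using solids_of_clique_minor(1) by blast
qed

lemma solids_of_chromatic_number: "chromatic_number G choose 4 \<le> card (solids G)"
proof (cases "chromatic_number G")
  case (Suc k)
  have "\<not> colourable adj (pverts G) k"
  proof
    assume "colourable adj (pverts G) k"
    then obtain f where f: "\<forall>v \<in> pverts G. f v < k"
      "\<forall>x \<in> pverts G. \<forall>y \<in> pverts G. adj x y \<longrightarrow> f x \<noteq> f y"
      unfolding colourable_def by blast
    then have "proper_colouring G k f"
      unfolding proper_colouring_def using in_arcsD1 in_arcsD2 by blast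
    then have "chromatic_number G \<le> k" unfolding chromatic_number_def by (intro Least_le) blast
    then show False using Suc by simp
  qed
  then have "Suc k choose 4 \<le> card {S. S \<subseteq> pverts G \<and> solid_set adj S}"
    by (rule ugraph.solids_of_not_colourable[OF ugraph_adj pair_finite_verts])
  then show ?thesis using card_solid_sets_le Suc by simp
qed (simp add: binomial_eq_0)

end

theorem theorem5p1p2:
  fixes G :: "'a pair_pre_digraph" and n :: nat
  assumes "pair_graph G"
    and "Digraph_Component.connected (with_proj G)"
    and "0 < n"
    and "card (solids G) < n choose 4"
  shows "max (chromatic_number G) (hadwiger_number G) < n"
proof -
  interpret pair_graph G by fact
  have "m < n" if "m choose 4 \<le> card (solids G)" for m
    using that assms(4) binomial_right_mono[of n m 4] by linarith
  then show ?thesis using solids_of_chromatic_number solids_of_hadwiger_number by simp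
qed

end
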